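(* Let $M=\begin{pmatrix}A&B\\ C&A^T\end{pmatrix}\in\mathrm{Sp}(2n)$ be a Wonenburger matrix whose only eigenvalue is $-1$. Then $M$ has a real symplectic square root if and only if there exists $P\in\mathrm{Sp}(2n)$ such that $$PMP^{-1}=\left[\begin{pmatrix}J_{m_1}(-1)&s_1K_{m_1}\\ D_1&J_{m_1}(-1)^T\end{pmatrix}\diamond\cdots\diamond\begin{pmatrix}J_{m_p}(-1)&s_pK_{m_p}\\ D_p&J_{m_p}(-1)^T\end{pmatrix}\right]^{\diamond 2}\diamond\left[\begin{pmatrix}A_1&B_1\\ C_1&A_1^T\end{pmatrix}\diamond\cdots\diamond\begin{pmatrix}A_q&B_q\\ C_q&A_q^T\end{pmatrix}\right]$$ for some integers $p,q\ge 0$ (an empty bracket being omitted), some integers $m_i\ge 1$ and signs $s_i\in\{\pm1\}$ $(1\le i\le p)$, and some integers $l_j\ge 0$ and signs $t_j\in\{\pm1\}$ $(1\le j\le q)$, where $$A_j=\begin{pmatrix}J_{l_j+1}(-1)&0\\ 0&J_{l_j}(-1)\end{pmatrix},\qquad B_j=\begin{pmatrix}0&0&t_jK_{l_j}\\ 0&0&0\\ t_jK_{l_j}&0&0\end{pmatrix}$$ ($B_j$ being partitioned into blocks of sizes $l_j,1,l_j$), and where $D_i$ $(1\le i\le p)$ and $C_j$ $(1\le j\le q)$ are real symmetric matrices such that the corresponding blocks $\begin{pmatrix}J_{m_i}(-1)&s_iK_{m_i}\\ D_i&J_{m_i}(-1)^T\end{pmatrix}$ and $\begin{pmatrix}A_j&B_j\\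 C_j&A_j^T\end{pmatrix}$ satisfy the Wonenburger relations.
   Context: $\mathrm{Sp}(2n)$ is the group of real $2n\times 2n$ matrices $M$ with $M^TJM=J$, where $J=\begin{pmatrix}0&-I_n\\ I_n&0\end{pmatrix}$. A Wonenburger matrix is a matrix $M=\begin{pmatrix}A&B\\ C&A^T\end{pmatrix}$ with $A,B,C$ real $n\times n$ matrices satisfying the Wonenburger relations $B=B^T$, $C=C^T$, $AB=BA^T$, $A^TC=CA$, $A^2-BC=I$ (these ensure $M\in\mathrm{Sp}(2n)$). A real symplectic square root of $M\in\mathrm{Sp}(2n)$ is a matrix $X\in\mathrm{Sp}(2n)$ with $X^2=M$. $J_m(\lambda)$ is the $m\times m$ Jordan block with eigenvalue $\lambda$ and ones on the superdiagonal; $K_l$ is the $l\times l$ matrix with all anti-diagonal entries equal to $1$ and all other entries $0$; blocks of size $0$ are omitted (so for $l_j=0$, $A_j=(-1)$ and $B_j=(0)$). For $2m_k\times 2m_k$ matrices in square block form $M_k=\begin{pmatrix}A_k&B_k\\ C_k&D_k\end{pmatrix}$, $k=1,2$, the $\diamond$-sum is $$M_1\diamond M_2=\begin{pmatrix}A_1&0&B_1&0\\ 0&A_2&0&B_2\\ C_1&0&D_1&0\\ 0&C_2&0&D_2\end{pmatrix},$$ and $M^{\diamond k}$ is the $k$-fold $\diamond$-sum of $M$ with itself.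
   Formalization: For l_j = 0 the 1×1 matrix C_j is required to be 0: the Wonenburger relations leave it free, and M = (-1 0; 1 -1) would have the stated form with l_1 = 0, C_1 = (1), but has no real square root. *)

theory Defs
  imports Complex_Main "Jordan_Normal_Form.Jordan_Normal_Form" "Jordan_Normal_Form.Spectral_Radius"
begin

definition symplectic_form_mat :: "nat \<Rightarrow> real mat" where
  "symplectic_form_mat n = four_block_mat (0\<^sub>m n n) (- 1\<^sub>m n) (1\<^sub>m n) (0\<^sub>m n n)"

definition symplectic_group :: "nat \<Rightarrow> real mat set" where
  "symplectic_group n =
     {M \<in> carrier_mat (2 * n) (2 * n).
        transpose_mat M * symplectic_form_mat n * M = symplectic_form_mat n}"

definition wonenburger_relations :: "nat \<Rightarrow> real mat \<Rightarrow> real mat \<Rightarrow> real mat \<Rightarrow> bool" where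
  "wonenburger_relations n A B C \<longleftrightarrow>
     A \<in> carrier_mat n n \<and> B \<in> carrier_mat n n \<and> C \<in> carrier_mat n n \<and>
     B = transpose_mat B \<and> C = transpose_mat C \<and>
     A * B = B * transpose_mat A \<and> transpose_mat A * C = C * A \<and>
     A * A - B * C = 1\<^sub>m n"

definition wonenburger_mat :: "real mat \<Rightarrow> real mat \<Rightarrow> real mat \<Rightarrow> real mat" where
  "wonenburger_mat A B C = four_block_mat A B C (transpose_mat A)"

text \<open>Both arguments of the diamond sum are meant to be square matrices of even dimension, each
  cut into four square blocks of equal size. The empty matrix \<open>0\<^sub>m 0 0\<close> is neutral, so it
  is the sum of an empty list (an omitted bracket).\<close>

definition diamond_sum :: "real mat \<Rightarrow> real mat \<Rightarrow> real mat" (infixr "\<diamondop>" 65) where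
  "M1 \<diamondop> M2 =
     (let m1 = dim_row M1 div 2; m2 = dim_row M2 div 2;
          (A1, B1, C1, D1) = split_block M1 m1 m1;
          (A2, B2, C2, D2) = split_block M2 m2 m2
      in four_block_mat (diag_block_mat [A1, A2]) (diag_block_mat [B1, B2])
                        (diag_block_mat [C1, C2]) (diag_block_mat [D1, D2]))"

definition diamond_list :: "real mat list \<Rightarrow> real mat" where
  "diamond_list Ms = foldr (\<diamondop>) Ms (0\<^sub>m 0 0)"

definition diamond_power :: "real mat \<Rightarrow> nat \<Rightarrow> real mat" where
  "diamond_power M k = diamond_list (replicate k M)"

definition anti_diag_mat :: "nat \<Rightarrow> real mat" where
  "anti_diag_mat l = mat l l (\<lambda>(i, j). if i + j + 1 = l then 1 else 0)"

definition odd_A :: "nat \<Rightarrow> real mat" where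
  "odd_A l = diag_block_mat [jordan_block (l + 1) (- 1), jordan_block l (- 1)]"

text \<open>The \<open>3 \<times> 3\<close> block partition with sizes \<open>l, 1, l\<close> is grouped as \<open>l + 1, l\<close>; the lower left
  block is the row \<open>(t K\<^sub>l, 0)\<close>, obtained by transposition because \<open>K\<^sub>l\<close> is symmetric.\<close>

definition odd_B :: "nat \<Rightarrow> real \<Rightarrow> real mat" where
  "odd_B l t =
     four_block_mat
       (0\<^sub>m (l + 1) (l + 1)) ((t \<cdot>\<^sub>m anti_diag_mat l) @\<^sub>r 0\<^sub>m 1 l)
       (transpose_mat ((t \<cdot>\<^sub>m anti_diag_mat l) @\<^sub>r 0\<^sub>m 1 l)) (0\<^sub>m l l)"

text \<open>The relations do not determine \<open>C\<close>: its entry at the (0-based) position \<open>(l, l)\<close> is free. For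
  \<open>l \<ge> 1\<close> that entry is immaterial, and the block always has exactly two Jordan blocks, both of
  size \<open>2 * l + 1\<close>. For \<open>l = 0\<close> the block is \<open>(-1, 0; c, -1)\<close>, which for \<open>c \<noteq> 0\<close> has a single
  Jordan block of size 2 and no real square root, so the statement requires \<open>C = 0\<close> then.\<close>

definition odd_block_data :: "nat \<Rightarrow> real \<Rightarrow> real mat \<Rightarrow> bool" where
  "odd_block_data l t C \<longleftrightarrow>
     t \<in> {-1, 1} \<and> wonenburger_relations (2 * l + 1) (odd_A l) (odd_B l t) C"

definition even_block_data :: "nat \<Rightarrow> real \<Rightarrow> real mat \<Rightarrow> bool" where
  "even_block_data m s D \<longleftrightarrow>
     1 \<le> m \<and> s \<in> {-1, 1} \<and>
     wonenburger_relations m (jordan_block m (- 1)) (s \<cdot>\<^sub>m anti_diag_mat m) D"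

end

theory Submission
  imports Defs
begin

text \<open>
  Let \<open>X\<close> be a symplectic root of \<open>M\<close>. Put \<open>T = (X + X\<^sup>-\<^sup>1) / sqrt 2\<close> and \<open>K = (X - X\<^sup>-\<^sup>1) / 2\<close>. These
  commute, \<open>T\<close> is self-adjoint and \<open>K\<close> is skew-adjoint for the symplectic form \<open>\<omega>\<close>, and
  \<open>X = T / sqrt 2 + K\<close>, \<open>K\<^sup>2 = T\<^sup>2 / 2 - 1\<close>, \<open>M + 1 = sqrt 2 T X\<close>. So \<open>T\<close> is nilpotent because \<open>-1\<close> is the
  only eigenvalue of \<open>M\<close>, and \<open>K\<close> is invertible: it plays the role of a complex structure.

  Let \<open>k\<close> be the nilpotency index of \<open>T\<close>. The form \<open>\<omega>(u, K T\<^sup>k\<^sup>-\<^sup>1 v)\<close> is symmetric and not zero, so some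
  \<open>v\<close> is not isotropic for it. Adding multiples of \<open>T\<^sup>r v\<close> to \<open>v\<close> one achieves
  \<open>\<omega>(v, K T\<^sup>j v) = 0\<close> for \<open>j < k - 1\<close>, with the value \<open>1 / sqrt 2\<close> or \<open>- 1 / sqrt 2\<close> at \<open>j = k - 1\<close>. All other
  products among the vectors \<open>T\<^sup>j v\<close> and \<open>K T\<^sup>j v\<close> vanish by skewness; up to scaling they form a
  symplectic basis of an \<open>X\<close>-invariant subspace, on which \<open>X\<close> is the explicit Wonenburger matrix
  \<open>cyclic_root k s\<close> (lemma \<open>krylov_embedding\<close>). The symplectic complement is invariant as well, so by
  induction \<open>X\<close> is a diamond sum of cyclic roots, and \<open>M\<close> is the diamond sum of their squares.

  It remains to recognise the squares. If \<open>k = 2 l + 1\<close>, the square of \<open>cyclic_root k s\<close> becomes an odd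
  block after interleaving the coordinates, and every other admissible \<open>C\<close> arises from this one by a
  shear (lemma \<open>odd_block_conj_cyclic_root_square\<close>). If \<open>k = 2 m\<close>, no computation is needed: for an
  even block \<open>B\<close> of size \<open>2 m\<close> the map \<open>(x, y) \<mapsto> (B y, x)\<close> is a symplectic root of the double of
  \<open>B\<close>, and since \<open>(B + 1)\<^sup>2\<^sup>m\<^sup>-\<^sup>1\<close> is not zero, the Krylov basis of that root already exhausts the
  space. Hence the double is the square of a cyclic root; conjugation with \<open>diag(1, -1)\<close> reverses
  the signs of both, so either sign of the root is reached (lemma \<open>double_even_block_conj_cyclic_root_square\<close>).

  Conversely, doubles and odd blocks have symplectic roots by the same identifications, roots of
  summands give a root of a diamond sum, and roots are transported by symplectic conjugation.
\<close>

section \<open>Matrix algebra\<close>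

text \<open>The ring laws for rectangular matrices are stated with equations between dimensions as premises,
  so that the simplifier can discharge them where membership in a carrier would have to be guessed.\<close>

lemma mat_mult_assoc: "dim_col A = dim_row B \<Longrightarrow> dim_col B = dim_row C \<Longrightarrow> (A * B) * C = A * (B * (C :: real mat))"
  by (rule assoc_mult_mat[of A "dim_row A" "dim_row B" B "dim_row C" C "dim_col C"]) auto

lemma mat_add_mult: "dim_row A = dim_row B \<Longrightarrow> dim_col A = dim_col B \<Longrightarrow> dim_col B = dim_row C \<Longrightarrow>
   (A + B) * C = A * C + B * (C :: real mat)"
  by (rule add_mult_distrib_mat[of A "dim_row A" "dim_row C" B C "dim_col C"]) auto

lemma mat_mult_add: "dim_row B = dim_row C \<Longrightarrow> dim_col B = dim_col C \<Longrightarrow> dim_col A = dim_row C \<Longrightarrow>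
   A * (B + C) = A * B + A * (C :: real mat)"
  by (rule mult_add_distrib_mat[of A "dim_row A" "dim_row C" B "dim_col C" C]) auto

lemma mat_minus_mult: "dim_row A = dim_row B \<Longrightarrow> dim_col A = dim_col B \<Longrightarrow> dim_col B = dim_row C \<Longrightarrow>
   (A - B) * C = A * C - B * (C :: real mat)"
  by (rule minus_mult_distrib_mat[of A "dim_row A" "dim_row C" B C "dim_col C"]) auto

lemma mat_mult_minus: "dim_row B = dim_row C \<Longrightarrow> dim_col B = dim_col C \<Longrightarrow> dim_col A = dim_row C \<Longrightarrow>
   A * (B - C) = A * B - A * (C :: real mat)"
  by (rule mult_minus_distrib_mat[of A "dim_row A" "dim_row C" B "dim_col C" C]) auto

lemma mat_smult_mult: "dim_col A = dim_row B \<Longrightarrow> (c \<cdot>\<^sub>m A) * B = c \<cdot>\<^sub>m (A * (B :: real mat))"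
  by (rule mult_smult_assoc_mat[of A "dim_row A" "dim_row B" B "dim_col B"]) auto

lemma mat_mult_smult: "dim_col A = dim_row B \<Longrightarrow> A * (c \<cdot>\<^sub>m B) = c \<cdot>\<^sub>m (A * (B :: real mat))"
  by (rule mult_smult_distrib[of A "dim_row A" "dim_row B" B "dim_col B"]) auto

lemma mat_transpose_mult: "dim_col A = dim_row B \<Longrightarrow>
   (A * B)\<^sup>T = B\<^sup>T * (A :: real mat)\<^sup>T"
  by (rule transpose_mult[of A "dim_row A" "dim_row B" B "dim_col B"]) auto

lemma mat_transpose_add: "dim_row A = dim_row B \<Longrightarrow> dim_col A = dim_col B \<Longrightarrow>
   (A + B)\<^sup>T = A\<^sup>T + (B :: real mat)\<^sup>T"
  by (rule eq_matI) auto

lemma mat_transpose_minus: "dim_row A = dim_row B \<Longrightarrow> dim_col A = dim_col B \<Longrightarrow>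
   (A - B)\<^sup>T = A\<^sup>T - (B :: real mat)\<^sup>T"
  by (rule eq_matI) auto

lemma mat_transpose_smult: "(c \<cdot>\<^sub>m A)\<^sup>T = c \<cdot>\<^sub>m (A :: real mat)\<^sup>T"
  by (rule eq_matI) auto

lemma mat_smult_smult: "a \<cdot>\<^sub>m (b \<cdot>\<^sub>m A) = (a * b) \<cdot>\<^sub>m (A :: real mat)"
  by (rule eq_matI) auto

lemma mat_smult_add: "dim_row A = dim_row B \<Longrightarrow> dim_col A = dim_col B \<Longrightarrow>
   c \<cdot>\<^sub>m (A + B) = c \<cdot>\<^sub>m A + c \<cdot>\<^sub>m (B :: real mat)"
  by (rule eq_matI) (auto simp: algebra_simps)

lemma mat_smult_minus: "dim_row A = dim_row B \<Longrightarrow> dim_col A = dim_col B \<Longrightarrow>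
   c \<cdot>\<^sub>m (A - B) = c \<cdot>\<^sub>m A - c \<cdot>\<^sub>m (B :: real mat)"
  by (rule eq_matI) (auto simp: algebra_simps)

lemma mat_smult_uminus: "c \<cdot>\<^sub>m (- A) = (- c) \<cdot>\<^sub>m (A :: real mat)" "- (c \<cdot>\<^sub>m A) = (- c) \<cdot>\<^sub>m A"
  by (rule eq_matI; simp)+

lemma mat_uminus_uminus [simp]: "- (- A) = (A :: real mat)"
  by (rule eq_matI) auto

lemma mat_one_smult [simp]: "1 \<cdot>\<^sub>m A = (A :: real mat)"
  by (rule eq_matI) auto

lemmas mat_ring = mat_mult_assoc mat_add_mult mat_mult_add mat_minus_mult mat_mult_minus
  mat_smult_mult mat_mult_smult mat_transpose_mult mat_transpose_add mat_transpose_minus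
  mat_transpose_smult mat_smult_smult mat_smult_add mat_smult_minus transpose_uminus

lemma mat_entryI:
  "dim_row A = dim_row B \<Longrightarrow> dim_col A = dim_col B \<Longrightarrow>
   (\<And>i j. i < dim_row B \<Longrightarrow> j < dim_col B \<Longrightarrow> A $$ (i,j) = B $$ (i,j)) \<Longrightarrow> A = B"
  by (rule eq_matI) auto

section \<open>Coordinate inclusions\<close>

definition coord_incl :: "nat \<Rightarrow> nat \<Rightarrow> (nat \<Rightarrow> nat) \<Rightarrow> real mat" where
  "coord_incl N k \<phi> = mat N k (\<lambda>(i, j). if i = \<phi> j then 1 else 0)"

lemma coord_incl_dim [simp]: "dim_row (coord_incl N k \<phi>) = N" "dim_col (coord_incl N k \<phi>) = k"
  by (auto simp: coord_incl_def)

lemma mult_coord_incl: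
  assumes "dim_col A = N" "i < dim_row A" "j < k" "\<phi> j < N"
  shows "(A * coord_incl N k \<phi>) $$ (i, j) = A $$ (i, \<phi> j)"
proof -
  have "(A * coord_incl N k \<phi>) $$ (i, j) = (\<Sum>a<N. A $$ (i, a) * (if a = \<phi> j then 1 else 0))"
    using assms by (auto simp: scalar_prod_def coord_incl_def atLeast0LessThan intro!: sum.cong)
  also have "\<dots> = (\<Sum>a<N. if a = \<phi> j then A $$ (i, a) else 0)"
    by (intro sum.cong) auto
  also have "\<dots> = A $$ (i, \<phi> j)" using assms by simp
  finally show ?thesis .
qed

lemma transpose_coord_incl_mult:
  assumes "dim_row A = N" "i < k" "j < dim_col A" "\<phi> i < N"
  shows "((coord_incl N k \<phi>)\<^sup>T * A) $$ (i, j) = A $$ (\<phi> i, j)"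
proof -
  have "(coord_incl N k \<phi>)\<^sup>T * A = (A\<^sup>T * coord_incl N k \<phi>)\<^sup>T"
    using assms by (simp add: mat_transpose_mult)
  thus ?thesis using assms by (simp add: mult_coord_incl del: index_mult_mat(1))
qed

lemma coord_incl_isometry:
  assumes "\<And>j. j < k \<Longrightarrow> \<phi> j < N" "inj_on \<phi> {..<k}"
  shows "(coord_incl N k \<phi>)\<^sup>T * coord_incl N k \<phi> = 1\<^sub>m k"
proof (rule mat_entryI)
  fix i j assume "i < dim_row (1\<^sub>m k :: real mat)" "j < dim_col (1\<^sub>m k :: real mat)"
  thus "((coord_incl N k \<phi>)\<^sup>T * coord_incl N k \<phi>) $$ (i, j) = 1\<^sub>m k $$ (i, j)"
    using assms by (subst transpose_coord_incl_mult) (auto simp: coord_incl_def inj_on_def)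
qed auto

lemma coord_incl_mult_transpose:
  assumes "inj_on \<phi> {..<k}" "i < N" "j < N"
  shows "(coord_incl N k \<phi> * (coord_incl N k \<phi>)\<^sup>T) $$ (i, j)
     = (if i = j \<and> i \<in> \<phi> ` {..<k} then 1 else 0)"
proof -
  have "(coord_incl N k \<phi> * (coord_incl N k \<phi>)\<^sup>T) $$ (i, j)
     = (\<Sum>a<k. if i = \<phi> a \<and> j = \<phi> a then 1 else 0)"
    using assms by (auto simp: scalar_prod_def coord_incl_def atLeast0LessThan intro!: sum.cong)
  also have "\<dots> = (if i = j \<and> i \<in> \<phi> ` {..<k} then 1 else 0)"
  proof (cases "i = j \<and> i \<in> \<phi> ` {..<k}")
    case True
    then obtain b where b: "b < k" "i = \<phi> b" "j = \<phi> b" by auto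
    have "(\<Sum>a<k. if i = \<phi> a \<and> j = \<phi> a then 1 else 0) = (\<Sum>a<k. if a = b then 1 else (0::real))"
      using b assms by (intro sum.cong) (auto simp: inj_on_def)
    thus ?thesis using True b by simp
  qed (auto intro!: sum.neutral)
  finally show ?thesis .
qed

section \<open>Symplectic matrices\<close>

abbreviation J :: "nat \<Rightarrow> real mat" where "J \<equiv> symplectic_form_mat"

lemma J_dim [simp]: "dim_row (J n) = 2 * n" "dim_col (J n) = 2 * n"
  by (auto simp: symplectic_form_mat_def)

lemma J_index:
  "i < 2 * n \<Longrightarrow> j < 2 * n \<Longrightarrow> J n $$ (i, j) = (if j = i + n then -1 else if i = j + n then 1 else 0)"
  by (auto simp: symplectic_form_mat_def)

lemma J_transpose: "(J n)\<^sup>T = - J n"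
  by (rule mat_entryI) (auto simp: J_index)

lemma J_square: "J n * J n = - 1\<^sub>m (2 * n)"
proof -
  have "J n * J n = four_block_mat (- 1\<^sub>m n) (0\<^sub>m n n) (0\<^sub>m n n) (- 1\<^sub>m n)"
    unfolding symplectic_form_mat_def by (subst mult_four_block_mat[of _ n n _ n _ n _ _ n _ n]) auto
  also have "\<dots> = - 1\<^sub>m (2 * n)" by (rule mat_entryI) auto
  finally show ?thesis .
qed

lemma J_J_mult [simp]: "dim_row A = 2 * n \<Longrightarrow> J n * (J n * A) = - A"
  by (simp add: mat_mult_assoc[symmetric] J_square)

lemma symplectic_groupD:
  assumes "M \<in> symplectic_group n"
  shows "dim_row M = 2 * n" "dim_col M = 2 * n" "M \<in> carrier_mat (2 * n) (2 * n)"
    "M\<^sup>T * (J n * M) = J n"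
  using assms by (auto simp: symplectic_group_def mat_mult_assoc)

lemma symplectic_groupI:
  assumes "dim_row M = 2 * n" "dim_col M = 2 * n" "M\<^sup>T * (J n * M) = J n"
  shows "M \<in> symplectic_group n"
  using assms by (auto simp: symplectic_group_def mat_mult_assoc)

definition symp_inv :: "nat \<Rightarrow> real mat \<Rightarrow> real mat" where
  "symp_inv n M = - (J n * (M\<^sup>T * J n))"

lemma symp_inv_dim [simp]: "dim_row (symp_inv n M) = 2 * n" "dim_col (symp_inv n M) = 2 * n"
  by (auto simp: symp_inv_def)

lemma symp_inv_left:
  assumes "M \<in> symplectic_group n"
  shows "symp_inv n M * M = 1\<^sub>m (2 * n)"
proof -
  note M = symplectic_groupD[OF assms]
  have "symp_inv n M * M = - (J n * (M\<^sup>T * (J n * M)))"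
    using M(1,2) by (simp add: symp_inv_def mat_mult_assoc)
  thus ?thesis by (simp add: M(4) J_square)
qed

lemma symp_inv_right:
  assumes "M \<in> symplectic_group n"
  shows "M * symp_inv n M = 1\<^sub>m (2 * n)"
  by (rule mat_mult_left_right_inverse[OF _ _ symp_inv_left[OF assms]])
    (auto intro!: carrier_matI simp: symplectic_groupD(1,2)[OF assms])

lemma symp_inv_left_mult:
  assumes "M \<in> symplectic_group n" "dim_row A = 2 * n"
  shows "symp_inv n M * (M * A) = A" "M * (symp_inv n M * A) = A"
proof -
  note M = symplectic_groupD(1,2)[OF assms(1)]
  have "symp_inv n M * (M * A) = (symp_inv n M * M) * A" "M * (symp_inv n M * A) = (M * symp_inv n M) * A"
    using M assms(2) by (simp_all add: mat_mult_assoc)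
  thus "symp_inv n M * (M * A) = A" "M * (symp_inv n M * A) = A"
    using assms(2) by (simp_all add: symp_inv_left[OF assms(1)] symp_inv_right[OF assms(1)])
qed

lemma symplectic_mult:
  assumes "M \<in> symplectic_group n" "N \<in> symplectic_group n"
  shows "M * N \<in> symplectic_group n"
proof (rule symplectic_groupI)
  note M = symplectic_groupD[OF assms(1)] and N = symplectic_groupD[OF assms(2)]
  have "(M * N)\<^sup>T * (J n * (M * N)) = N\<^sup>T * ((M\<^sup>T * (J n * M)) * N)"
    using M(1,2) N(1,2) by (simp add: mat_ring)
  also have "\<dots> = J n" unfolding M(4) by (rule N(4))
  finally show "(M * N)\<^sup>T * (J n * (M * N)) = J n" .
qed (simp_all add: symplectic_groupD(1,2)[OF assms(1)] symplectic_groupD(1,2)[OF assms(2)])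

lemma symplectic_symp_inv:
  assumes "M \<in> symplectic_group n"
  shows "symp_inv n M \<in> symplectic_group n"
proof (rule symplectic_groupI)
  note M = symplectic_groupD[OF assms]
  have "(symp_inv n M)\<^sup>T * (J n * symp_inv n M)
      = (symp_inv n M)\<^sup>T * ((M\<^sup>T * (J n * M)) * symp_inv n M)"
    by (simp only: M(4))
  also have "\<dots> = (M * symp_inv n M)\<^sup>T * (J n * (M * symp_inv n M))"
    using M(1,2) by (simp add: mat_ring)
  also have "\<dots> = J n" using symp_inv_right[OF assms] by simp
  finally show "(symp_inv n M)\<^sup>T * (J n * symp_inv n M) = J n" .
qed auto

lemma one_symplectic: "1\<^sub>m (2 * n) \<in> symplectic_group n"
  by (rule symplectic_groupI) auto

section \<open>The diamond sum as an orthogonal direct sum\<close>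

text \<open>The diamond sum interleaves the Lagrangian halves of its summands: the first summand occupies the
  coordinates \<open>0, \<dots>, m - 1\<close> and \<open>m + n, \<dots>, 2 m + n - 1\<close>, the second one the others.\<close>

definition incl_left :: "nat \<Rightarrow> nat \<Rightarrow> real mat" where
  "incl_left m n = coord_incl (2 * (m + n)) (2 * m) (\<lambda>j. if j < m then j else j + n)"

definition incl_right :: "nat \<Rightarrow> nat \<Rightarrow> real mat" where
  "incl_right m n = coord_incl (2 * (m + n)) (2 * n) (\<lambda>j. if j < n then j + m else j + 2 * m)"

lemma incl_dim [simp]:
  "dim_row (incl_left m n) = 2 * (m + n)" "dim_col (incl_left m n) = 2 * m"
  "dim_row (incl_right m n) = 2 * (m + n)" "dim_col (incl_right m n) = 2 * n"
  by (auto simp: incl_left_def incl_right_def)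

lemma incl_isometry:
  "(incl_left m n)\<^sup>T * incl_left m n = 1\<^sub>m (2 * m)"
  "(incl_right m n)\<^sup>T * incl_right m n = 1\<^sub>m (2 * n)"
  unfolding incl_left_def incl_right_def
  by (rule coord_incl_isometry; auto simp: inj_on_def split: if_splits)+

lemma incl_complete:
  "incl_left m n * (incl_left m n)\<^sup>T + incl_right m n * (incl_right m n)\<^sup>T
     = 1\<^sub>m (2 * (m + n))"
proof (rule mat_entryI)
  let ?f = "\<lambda>j. if j < m then j else j + n" and ?g = "\<lambda>j. if j < n then j + m else j + 2 * m"
  fix i j assume "i < dim_row (1\<^sub>m (2 * (m + n)) :: real mat)" "j < dim_col (1\<^sub>m (2 * (m + n)) :: real mat)"
  hence ij: "i < 2 * (m + n)" "j < 2 * (m + n)" by auto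
  have inj: "inj_on ?f {..<2*m}" "inj_on ?g {..<2*n}" by (auto simp: inj_on_def split: if_splits)
  have f: "i \<in> ?f ` {..<2*m} \<longleftrightarrow> i < m \<or> (m + n \<le> i \<and> i < 2 * m + n)"
  proof
    assume "i < m \<or> (m + n \<le> i \<and> i < 2 * m + n)"
    thus "i \<in> ?f ` {..<2*m}"
      by (intro image_eqI[of _ _ "if i < m then i else i - n"]) auto
  qed auto
  have g: "i \<in> ?g ` {..<2*n} \<longleftrightarrow> (m \<le> i \<and> i < m + n) \<or> (2 * m + n \<le> i)"
  proof
    assume "(m \<le> i \<and> i < m + n) \<or> (2 * m + n \<le> i)"
    thus "i \<in> ?g ` {..<2*n}" using ij
      by (intro image_eqI[of _ _ "if i < m + n then i - m else i - 2 * m"]) auto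
  qed auto
  have "(incl_left m n * (incl_left m n)\<^sup>T) $$ (i, j) = (if i = j \<and> i \<in> ?f ` {..<2*m} then 1 else 0)"
    "(incl_right m n * (incl_right m n)\<^sup>T) $$ (i, j) = (if i = j \<and> i \<in> ?g ` {..<2*n} then 1 else 0)"
    unfolding incl_left_def incl_right_def
    by (rule coord_incl_mult_transpose[OF inj(1) ij], rule coord_incl_mult_transpose[OF inj(2) ij])
  thus "(incl_left m n * (incl_left m n)\<^sup>T + incl_right m n * (incl_right m n)\<^sup>T) $$ (i, j)
     = 1\<^sub>m (2 * (m + n)) $$ (i, j)"
    using ij by (simp only: f g index_mult_mat(2,3) index_transpose_mat(2,3) incl_dim index_add_mat(1) index_one_mat) auto
qed auto

lemma diag_block_two:
  "diag_block_mat [A, B] = four_block_mat A (0\<^sub>m (dim_row A) (dim_col B)) (0\<^sub>m (dim_row B) (dim_col A)) (B :: real mat)"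
  by (rule eq_matI) (auto simp: Let_def)

lemma diamond_four_block:
  assumes "A1 \<in> carrier_mat m m" "B1 \<in> carrier_mat m m" "C1 \<in> carrier_mat m m" "D1 \<in> carrier_mat m m"
    "A2 \<in> carrier_mat n n" "B2 \<in> carrier_mat n n" "C2 \<in> carrier_mat n n" "D2 \<in> carrier_mat n n"
  shows "four_block_mat A1 B1 C1 D1 \<diamondop> four_block_mat A2 B2 C2 D2 =
    four_block_mat (four_block_mat A1 (0\<^sub>m m n) (0\<^sub>m n m) A2) (four_block_mat B1 (0\<^sub>m m n) (0\<^sub>m n m) B2)
      (four_block_mat C1 (0\<^sub>m m n) (0\<^sub>m n m) C2) (four_block_mat D1 (0\<^sub>m m n) (0\<^sub>m n m) D2)"
proof -
  have split: "split_block (four_block_mat A B C D) k k = (A, B, C, D)"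
    if "A \<in> carrier_mat k k" "B \<in> carrier_mat k k" "C \<in> carrier_mat k k" "D \<in> carrier_mat k k"
    for A B C D :: "real mat" and k
    using that by (auto simp: split_block_def Let_def intro!: eq_matI)
  have d: "dim_row (four_block_mat A1 B1 C1 D1) div 2 = m" "dim_row (four_block_mat A2 B2 C2 D2) div 2 = n"
    using assms by auto
  show ?thesis
    unfolding diamond_sum_def Let_def d split[OF assms(1-4)] split[OF assms(5-8)]
    using assms by (simp only: prod.case diag_block_two carrier_matD)
qed

lemma quadrants:
  assumes "dim_row M = 2 * n" "dim_col M = 2 * n"
  obtains A B C D where "M = four_block_mat A B C D" "A \<in> carrier_mat n n" "B \<in> carrier_mat n n"
    "C \<in> carrier_mat n n" "D \<in> carrier_mat n n"
proof -
  obtain A B C D where "split_block M n n = (A, B, C, D)" by (metis prod_cases4)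
  from split_block[OF this, of n n] show ?thesis using assms that by auto
qed

lemma diamond_dim [simp]:
  assumes "dim_row M = 2 * m" "dim_col M = 2 * m" "dim_row N = 2 * n" "dim_col N = 2 * n"
  shows "dim_row (M \<diamondop> N) = 2 * (m + n)" "dim_col (M \<diamondop> N) = 2 * (m + n)"
  using assms by (auto simp: diamond_sum_def Let_def split_block_def)

lemma diamond_assoc:
  assumes "dim_row M = 2 * m" "dim_col M = 2 * m" "dim_row N = 2 * n" "dim_col N = 2 * n"
    "dim_row K = 2 * k" "dim_col K = 2 * k"
  shows "(M \<diamondop> N) \<diamondop> K = M \<diamondop> (N \<diamondop> K)"
proof -
  obtain A1 B1 C1 D1 where M: "M = four_block_mat A1 B1 C1 D1" and
    c1: "A1 \<in> carrier_mat m m" "B1 \<in> carrier_mat m m" "C1 \<in> carrier_mat m m" "D1 \<in> carrier_mat m m"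
    using quadrants[of M m] assms by metis
  obtain A2 B2 C2 D2 where N: "N = four_block_mat A2 B2 C2 D2" and
    c2: "A2 \<in> carrier_mat n n" "B2 \<in> carrier_mat n n" "C2 \<in> carrier_mat n n" "D2 \<in> carrier_mat n n"
    using quadrants[of N n] assms by metis
  obtain A3 B3 C3 D3 where K: "K = four_block_mat A3 B3 C3 D3" and
    c3: "A3 \<in> carrier_mat k k" "B3 \<in> carrier_mat k k" "C3 \<in> carrier_mat k k" "D3 \<in> carrier_mat k k"
    using quadrants[of K k] assms by metis
  have d: "four_block_mat X (0\<^sub>m a b) (0\<^sub>m b a) Y \<in> carrier_mat (a + b) (a + b)"
    if "X \<in> carrier_mat a a" "Y \<in> carrier_mat b b" for X Y :: "real mat" and a b using that by auto
  have assoc: "four_block_mat (four_block_mat X (0\<^sub>m m n) (0\<^sub>m n m) Y) (0\<^sub>m (m + n) k) (0\<^sub>m k (m + n)) Z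
     = four_block_mat X (0\<^sub>m m (n + k)) (0\<^sub>m (n + k) m) (four_block_mat Y (0\<^sub>m n k) (0\<^sub>m k n) Z)"
    if "X \<in> carrier_mat m m" "Y \<in> carrier_mat n n" "Z \<in> carrier_mat k k" for X Y Z :: "real mat"
    using assoc_four_block_mat[of X Y Z] that by simp
  show ?thesis
    unfolding M N K diamond_four_block[OF c1 c2] diamond_four_block[OF c2 c3]
      diamond_four_block[OF d[OF c1(1) c2(1)] d[OF c1(2) c2(2)] d[OF c1(3) c2(3)] d[OF c1(4) c2(4)] c3]
      diamond_four_block[OF c1 d[OF c2(1) c3(1)] d[OF c2(2) c3(2)] d[OF c2(3) c3(3)] d[OF c2(4) c3(4)]]
    by (intro cong_four_block_mat assoc c1 c2 c3)
qed

definition upper_incl :: "nat \<Rightarrow> nat \<Rightarrow> real mat" where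
  "upper_incl m n = four_block_mat (1\<^sub>m m) (0\<^sub>m m 0) (0\<^sub>m n m) (0\<^sub>m n 0)"

definition lower_incl :: "nat \<Rightarrow> nat \<Rightarrow> real mat" where
  "lower_incl m n = four_block_mat (0\<^sub>m m n) (0\<^sub>m m 0) (1\<^sub>m n) (0\<^sub>m n 0)"

lemma vert_incl_dim [simp]:
  "dim_row (upper_incl m n) = m + n" "dim_col (upper_incl m n) = m"
  "dim_row (lower_incl m n) = m + n" "dim_col (lower_incl m n) = n"
  by (auto simp: upper_incl_def lower_incl_def)

lemma incl_four_block:
  "incl_left m n = four_block_mat (upper_incl m n) (0\<^sub>m (m + n) m) (0\<^sub>m (m + n) m) (upper_incl m n)"
  "incl_right m n = four_block_mat (lower_incl m n) (0\<^sub>m (m + n) n) (0\<^sub>m (m + n) n) (lower_incl m n)"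
  unfolding incl_left_def incl_right_def coord_incl_def upper_incl_def lower_incl_def
  by (rule mat_entryI; auto)+

lemma diag_mult_vert_incl:
  assumes "A \<in> carrier_mat m m" "B \<in> carrier_mat n n"
  shows "four_block_mat A (0\<^sub>m m n) (0\<^sub>m n m) B * upper_incl m n = upper_incl m n * A"
    "four_block_mat A (0\<^sub>m m n) (0\<^sub>m n m) B * lower_incl m n = lower_incl m n * B"
proof -
  have 0: "X = four_block_mat X (0\<^sub>m k 0) (0\<^sub>m 0 k) (0\<^sub>m 0 0)" if "X \<in> carrier_mat k k" for X :: "real mat" and k
    using that by (auto intro!: eq_matI)
  have "four_block_mat A (0\<^sub>m m n) (0\<^sub>m n m) B * upper_incl m n
     = upper_incl m n * four_block_mat A (0\<^sub>m m 0) (0\<^sub>m 0 m) (0\<^sub>m 0 0)"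
    "four_block_mat A (0\<^sub>m m n) (0\<^sub>m n m) B * lower_incl m n
     = lower_incl m n * four_block_mat B (0\<^sub>m n 0) (0\<^sub>m 0 n) (0\<^sub>m 0 0)"
    unfolding upper_incl_def lower_incl_def
    using assms
    by (simp_all add: mult_four_block_mat[of _ m m _ n _ n _ _ m _ 0] mult_four_block_mat[of _ m m _ 0 _ n _ _ m _ 0]
        mult_four_block_mat[of _ m m _ n _ n _ _ n _ 0] mult_four_block_mat[of _ m n _ 0 _ n _ _ n _ 0])
  thus "four_block_mat A (0\<^sub>m m n) (0\<^sub>m n m) B * upper_incl m n = upper_incl m n * A"
    "four_block_mat A (0\<^sub>m m n) (0\<^sub>m n m) B * lower_incl m n = lower_incl m n * B"
    by (simp_all only: 0[OF assms(1), symmetric] 0[OF assms(2), symmetric])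
qed

lemma four_block_mult_diag:
  fixes A B C D P :: "real mat"
  assumes "A \<in> carrier_mat r n" "B \<in> carrier_mat r n" "C \<in> carrier_mat r n" "D \<in> carrier_mat r n"
    "P \<in> carrier_mat n k"
  shows "four_block_mat A B C D * four_block_mat P (0\<^sub>m n k) (0\<^sub>m n k) P
    = four_block_mat (A * P) (B * P) (C * P) (D * P)"
proof -
  have "four_block_mat A B C D * four_block_mat P (0\<^sub>m n k) (0\<^sub>m n k) P
    = four_block_mat (A * P + B * 0\<^sub>m n k) (A * 0\<^sub>m n k + B * P) (C * P + D * 0\<^sub>m n k) (C * 0\<^sub>m n k + D * P)"
    using assms by (intro mult_four_block_mat) auto
  also have "\<dots> = four_block_mat (A * P) (B * P) (C * P) (D * P)"
    using assms by (intro cong_four_block_mat) (simp_all add: left_add_zero_mat[of _ r k] right_add_zero_mat[of _ r k])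
  finally show ?thesis .
qed

lemma four_block_diag_mult:
  fixes A B C D P :: "real mat"
  assumes "A \<in> carrier_mat n k" "B \<in> carrier_mat n k" "C \<in> carrier_mat n k" "D \<in> carrier_mat n k"
    "P \<in> carrier_mat r n"
  shows "four_block_mat P (0\<^sub>m r n) (0\<^sub>m r n) P * four_block_mat A B C D
    = four_block_mat (P * A) (P * B) (P * C) (P * D)"
proof -
  have "four_block_mat P (0\<^sub>m r n) (0\<^sub>m r n) P * four_block_mat A B C D
    = four_block_mat (P * A + 0\<^sub>m r n * C) (P * B + 0\<^sub>m r n * D) (0\<^sub>m r n * A + P * C) (0\<^sub>m r n * B + P * D)"
    using assms by (intro mult_four_block_mat) auto
  also have "\<dots> = four_block_mat (P * A) (P * B) (P * C) (P * D)"
    using assms by (intro cong_four_block_mat) (simp_all add: left_add_zero_mat[of _ r k] right_add_zero_mat[of _ r k])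
  finally show ?thesis .
qed

lemma diamond_mult_incl:
  assumes "dim_row M = 2 * m" "dim_col M = 2 * m" "dim_row N = 2 * n" "dim_col N = 2 * n"
  shows "(M \<diamondop> N) * incl_left m n = incl_left m n * M"
    "(M \<diamondop> N) * incl_right m n = incl_right m n * N"
proof -
  obtain A1 B1 C1 D1 where M: "M = four_block_mat A1 B1 C1 D1" and
    c1: "A1 \<in> carrier_mat m m" "B1 \<in> carrier_mat m m" "C1 \<in> carrier_mat m m" "D1 \<in> carrier_mat m m"
    using quadrants[of M m] assms by metis
  obtain A2 B2 C2 D2 where N: "N = four_block_mat A2 B2 C2 D2" and
    c2: "A2 \<in> carrier_mat n n" "B2 \<in> carrier_mat n n" "C2 \<in> carrier_mat n n" "D2 \<in> carrier_mat n n"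
    using quadrants[of N n] assms by metis
  have u: "upper_incl m n \<in> carrier_mat (m + n) m" and l: "lower_incl m n \<in> carrier_mat (m + n) n" by auto
  have d: "four_block_mat X (0\<^sub>m m n) (0\<^sub>m n m) Y \<in> carrier_mat (m + n) (m + n)"
    if "X \<in> carrier_mat m m" "Y \<in> carrier_mat n n" for X Y :: "real mat" using that by auto
  note d' = d[OF c1(1) c2(1)] d[OF c1(2) c2(2)] d[OF c1(3) c2(3)] d[OF c1(4) c2(4)]
  show "(M \<diamondop> N) * incl_left m n = incl_left m n * M"
    unfolding M N diamond_four_block[OF c1 c2] incl_four_block
      four_block_mult_diag[OF d' u] four_block_diag_mult[OF c1 u]
    by (intro cong_four_block_mat diag_mult_vert_incl c1 c2)
  show "(M \<diamondop> N) * incl_right m n = incl_right m n * N"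
    unfolding M N diamond_four_block[OF c1 c2] incl_four_block
      four_block_mult_diag[OF d' l] four_block_diag_mult[OF c2 l]
    by (intro cong_four_block_mat diag_mult_vert_incl c1 c2)
qed

lemma incl_disjoint:
  "(incl_left m n)\<^sup>T * incl_right m n = 0\<^sub>m (2 * m) (2 * n)"
  "(incl_right m n)\<^sup>T * incl_left m n = 0\<^sub>m (2 * n) (2 * m)"
proof -
  let ?L = "incl_left m n" and ?R = "incl_right m n"
  have "?L\<^sup>T * (?L * ?L\<^sup>T + ?R * ?R\<^sup>T) * ?R = ?L\<^sup>T * ?R"
    unfolding incl_complete by simp
  moreover have "?L\<^sup>T * (?L * ?L\<^sup>T + ?R * ?R\<^sup>T) * ?R
     = (?L\<^sup>T * ?L) * (?L\<^sup>T * ?R) + ?L\<^sup>T * ?R * (?R\<^sup>T * ?R)"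
    by (simp add: mat_ring)
  ultimately have eq: "?L\<^sup>T * ?R + ?L\<^sup>T * ?R = ?L\<^sup>T * ?R"
    by (simp add: incl_isometry)
  hence z: "(?L\<^sup>T * ?R) $$ (i, j) = 0" if "i < 2 * m" "j < 2 * n" for i j
  proof -
    have "(?L\<^sup>T * ?R + ?L\<^sup>T * ?R) $$ (i, j) = (?L\<^sup>T * ?R) $$ (i, j)"
      by (simp only: eq)
    thus ?thesis using that by (simp del: index_mult_mat(1))
  qed
  show LR: "?L\<^sup>T * ?R = 0\<^sub>m (2 * m) (2 * n)"
    by (rule mat_entryI) (simp_all add: z del: index_mult_mat(1))
  have "?R\<^sup>T * ?L = (?L\<^sup>T * ?R)\<^sup>T" by (simp add: mat_transpose_mult)
  thus "?R\<^sup>T * ?L = 0\<^sub>m (2 * n) (2 * m)" by (simp add: LR)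
qed

text \<open>The two inclusions together are bijective, so a matrix is determined by its products with them.\<close>

lemma diamond_unique:
  assumes "dim_row M = 2 * m" "dim_col M = 2 * m" "dim_row N = 2 * n" "dim_col N = 2 * n"
    "dim_row D = r" "dim_col D = 2 * (m + n)"
    "dim_row E = r" "dim_col E = 2 * (m + n)"
    "D * incl_left m n = E * incl_left m n" "D * incl_right m n = E * incl_right m n"
  shows "D = E"
proof -
  let ?L = "incl_left m n" and ?R = "incl_right m n"
  have "D = D * (?L * ?L\<^sup>T + ?R * ?R\<^sup>T)" unfolding incl_complete using assms by simp
  also have "\<dots> = (D * ?L) * ?L\<^sup>T + (D * ?R) * ?R\<^sup>T" using assms(6) by (simp add: mat_ring)
  also have "\<dots> = (E * ?L) * ?L\<^sup>T + (E * ?R) * ?R\<^sup>T" using assms by simp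
  also have "\<dots> = E * (?L * ?L\<^sup>T + ?R * ?R\<^sup>T)" using assms(8) by (simp add: mat_ring)
  also have "\<dots> = E" unfolding incl_complete using assms by simp
  finally show ?thesis .
qed

lemma J_diamond: "J m \<diamondop> J n = J (m + n)"
proof -
  have "J m \<diamondop> J n = four_block_mat (four_block_mat (0\<^sub>m m m) (0\<^sub>m m n) (0\<^sub>m n m) (0\<^sub>m n n))
    (four_block_mat (- 1\<^sub>m m) (0\<^sub>m m n) (0\<^sub>m n m) (- 1\<^sub>m n))
    (four_block_mat (1\<^sub>m m) (0\<^sub>m m n) (0\<^sub>m n m) (1\<^sub>m n))
    (four_block_mat (0\<^sub>m m m) (0\<^sub>m m n) (0\<^sub>m n m) (0\<^sub>m n n))"
    unfolding symplectic_form_mat_def by (rule diamond_four_block) auto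
  also have "\<dots> = J (m + n)" unfolding symplectic_form_mat_def
    by (intro cong_four_block_mat mat_entryI) auto
  finally show ?thesis .
qed

lemma J_mult_incl:
  "J (m + n) * incl_left m n = incl_left m n * J m"
  "J (m + n) * incl_right m n = incl_right m n * J n"
  by (simp_all add: J_diamond[symmetric] diamond_mult_incl)

lemma transpose_incl_mult_diamond:
  assumes "dim_row M = 2 * m" "dim_col M = 2 * m" "dim_row N = 2 * n" "dim_col N = 2 * n"
  shows "(incl_left m n)\<^sup>T * (M \<diamondop> N) = M * (incl_left m n)\<^sup>T"
    "(incl_right m n)\<^sup>T * (M \<diamondop> N) = N * (incl_right m n)\<^sup>T"
  by (rule diamond_unique[OF assms]; use assms in \<open>simp add: mat_mult_assoc diamond_mult_incl incl_isometry incl_disjoint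
        mat_mult_assoc[symmetric, of "transpose_mat _" "incl_left m n" M]
        mat_mult_assoc[symmetric, of "transpose_mat _" "incl_right m n" N]\<close>)+

text \<open>Two partial symplectic bases \<open>V\<close> and \<open>W\<close>, merged in the order of coordinates that the diamond sum
  uses.\<close>

definition juxt :: "nat \<Rightarrow> nat \<Rightarrow> real mat \<Rightarrow> real mat \<Rightarrow> real mat" where
  "juxt m n V W = V * (incl_left m n)\<^sup>T + W * (incl_right m n)\<^sup>T"

lemma juxt_dim [simp]:
  "dim_row (juxt m n V W) = dim_row W" "dim_col (juxt m n V W) = 2 * (m + n)"
  by (auto simp: juxt_def)

lemma juxt_gram:
  assumes "dim_row V = r" "dim_col V = 2 * m" "dim_row W = r" "dim_col W = 2 * n"
    "dim_row \<Omega> = r" "dim_col \<Omega> = r"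
    "V\<^sup>T * (\<Omega> * V) = J m" "W\<^sup>T * (\<Omega> * W) = J n"
    "V\<^sup>T * (\<Omega> * W) = 0\<^sub>m (2 * m) (2 * n)" "W\<^sup>T * (\<Omega> * V) = 0\<^sub>m (2 * n) (2 * m)"
  shows "(juxt m n V W)\<^sup>T * (\<Omega> * juxt m n V W) = J (m + n)"
proof -
  let ?L = "incl_left m n" and ?R = "incl_right m n"
  have "(juxt m n V W)\<^sup>T * (\<Omega> * juxt m n V W)
    = (?L * (V\<^sup>T * (\<Omega> * V)) * ?L\<^sup>T + ?R * (W\<^sup>T * (\<Omega> * V)) * ?L\<^sup>T) +
      (?L * (V\<^sup>T * (\<Omega> * W)) * ?R\<^sup>T + ?R * (W\<^sup>T * (\<Omega> * W)) * ?R\<^sup>T)"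
    using assms(1-6) by (simp add: juxt_def mat_ring)
  also have "\<dots> = ?L * J m * ?L\<^sup>T + ?R * J n * ?R\<^sup>T"
    unfolding assms(7-10) by (simp add: right_add_zero_mat[of _ "2*(m+n)" "2*(m+n)"] left_add_zero_mat[of _ "2*(m+n)" "2*(m+n)"]
        carrier_matI)
  also have "\<dots> = J (m + n) * (?L * ?L\<^sup>T + ?R * ?R\<^sup>T)"
    by (simp add: J_mult_incl[symmetric] mat_ring)
  also have "\<dots> = J (m + n)" unfolding incl_complete by simp
  finally show ?thesis .
qed

lemma juxt_mult:
  assumes "dim_row V = r" "dim_col V = 2 * m" "dim_row W = r" "dim_col W = 2 * n"
    "dim_row X = r" "dim_col X = r"
    "dim_row M = 2 * m" "dim_col M = 2 * m" "dim_row N = 2 * n" "dim_col N = 2 * n"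
    "X * V = V * M" "X * W = W * N"
  shows "X * juxt m n V W = juxt m n V W * (M \<diamondop> N)"
proof -
  have "X * juxt m n V W = (X * V) * (incl_left m n)\<^sup>T + (X * W) * (incl_right m n)\<^sup>T"
    using assms(1-6) by (simp add: juxt_def mat_ring)
  also have "\<dots> = (V * M) * (incl_left m n)\<^sup>T + (W * N) * (incl_right m n)\<^sup>T"
    by (simp only: assms(11,12))
  also have "\<dots> = juxt m n V W * (M \<diamondop> N)"
    using assms(1-10) by (simp add: juxt_def mat_ring transpose_incl_mult_diamond)
  finally show ?thesis .
qed

lemma juxt_incl:
  assumes "dim_row M = 2 * m" "dim_col M = 2 * m" "dim_row N = 2 * n" "dim_col N = 2 * n"
  shows "juxt m n (incl_left m n * M) (incl_right m n * N) = M \<diamondop> N"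
proof -
  have "juxt m n (incl_left m n * M) (incl_right m n * N) = (M \<diamondop> N) * juxt m n (incl_left m n) (incl_right m n)"
    using assms by (simp add: juxt_def mat_ring diamond_mult_incl[symmetric])
  also have "juxt m n (incl_left m n) (incl_right m n) = 1\<^sub>m (2 * (m + n))"
    by (simp add: juxt_def incl_complete)
  finally show ?thesis using assms by simp
qed

lemma diamond_mult:
  assumes "dim_row M = 2 * m" "dim_col M = 2 * m" "dim_row N = 2 * n" "dim_col N = 2 * n"
    "dim_row M' = 2 * m" "dim_col M' = 2 * m" "dim_row N' = 2 * n" "dim_col N' = 2 * n"
  shows "(M \<diamondop> N) * (M' \<diamondop> N') = (M * M') \<diamondop> (N * N')"
proof (rule diamond_unique)
  have "(M \<diamondop> N) * (M' \<diamondop> N') * incl_left m n = ((M \<diamondop> N) * incl_left m n) * M'"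
    "(M \<diamondop> N) * (M' \<diamondop> N') * incl_right m n = ((M \<diamondop> N) * incl_right m n) * N'"
    using assms by (simp_all add: mat_ring diamond_mult_incl[of M' m N' n])
  thus "(M \<diamondop> N) * (M' \<diamondop> N') * incl_left m n = (M * M' \<diamondop> N * N') * incl_left m n"
     "(M \<diamondop> N) * (M' \<diamondop> N') * incl_right m n = (M * M' \<diamondop> N * N') * incl_right m n"
    using assms by (simp_all add: mat_ring diamond_mult_incl[of "M * M'" m "N * N'" n] diamond_mult_incl[of M m N n])
qed (use assms in simp_all)

lemma incl_gram:
  "(incl_left m n)\<^sup>T * (J (m + n) * incl_left m n) = J m"
  "(incl_right m n)\<^sup>T * (J (m + n) * incl_right m n) = J n"
  "(incl_left m n)\<^sup>T * (J (m + n) * incl_right m n) = 0\<^sub>m (2 * m) (2 * n)"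
  "(incl_right m n)\<^sup>T * (J (m + n) * incl_left m n) = 0\<^sub>m (2 * n) (2 * m)"
  by (simp_all add: J_mult_incl mat_mult_assoc[symmetric] incl_isometry incl_disjoint)

lemma gram_mult:
  fixes V W A B \<Omega> :: "real mat"
  assumes "dim_row V = r" "dim_row W = r" "dim_row \<Omega> = r" "dim_col \<Omega> = r"
    "dim_row A = dim_col V" "dim_row B = dim_col W"
  shows "(V * A)\<^sup>T * (\<Omega> * (W * B)) = A\<^sup>T * ((V\<^sup>T * (\<Omega> * W)) * B)"
  using assms by (simp add: mat_ring)

lemma symplectic_diamond:
  assumes "M \<in> symplectic_group m" "N \<in> symplectic_group n"
  shows "M \<diamondop> N \<in> symplectic_group (m + n)"
proof -
  note M = symplectic_groupD[OF assms(1)] and N = symplectic_groupD[OF assms(2)]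
  have "(juxt m n (incl_left m n * M) (incl_right m n * N))\<^sup>T *
      (J (m + n) * juxt m n (incl_left m n * M) (incl_right m n * N)) = J (m + n)"
    by (rule juxt_gram[where r = "2 * (m + n)"]; (subst gram_mult[where r = "2 * (m + n)"])?;
        (simp add: incl_gram M N)?)
  thus ?thesis using M N by (intro symplectic_groupI) (simp_all add: juxt_incl)
qed

section \<open>Symplectic conjugacy\<close>

definition symp_conj :: "nat \<Rightarrow> real mat \<Rightarrow> real mat \<Rightarrow> bool" where
  "symp_conj n M N \<longleftrightarrow> M \<in> carrier_mat (2 * n) (2 * n) \<and> N \<in> carrier_mat (2 * n) (2 * n) \<and>
     (\<exists>Q \<in> symplectic_group n. M * Q = Q * N)"

lemma symp_conj_dim:
  assumes "symp_conj n M N"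
  shows "dim_row M = 2 * n" "dim_col M = 2 * n" "dim_row N = 2 * n" "dim_col N = 2 * n"
  using assms by (auto simp: symp_conj_def)

lemma symp_conjI:
  assumes "dim_row M = 2 * n" "dim_col M = 2 * n" "dim_row N = 2 * n" "dim_col N = 2 * n"
    "Q \<in> symplectic_group n" "M * Q = Q * N"
  shows "symp_conj n M N"
  using assms by (auto simp: symp_conj_def intro: carrier_matI)

lemma symp_conj_refl: "dim_row M = 2 * n \<Longrightarrow> dim_col M = 2 * n \<Longrightarrow> symp_conj n M M"
  by (rule symp_conjI[OF _ _ _ _ one_symplectic]) auto

lemma symp_conj_sym:
  assumes "symp_conj n M N"
  shows "symp_conj n N M"
proof -
  note d = symp_conj_dim[OF assms]
  obtain Q where Q: "Q \<in> symplectic_group n" "M * Q = Q * N" using assms by (auto simp: symp_conj_def)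
  note Qd = symplectic_groupD(1,2)[OF Q(1)]
  have "N * symp_inv n Q = symp_inv n Q * (Q * (N * symp_inv n Q))"
    using Q d by (simp add: symp_inv_left_mult)
  also have "\<dots> = symp_inv n Q * ((Q * N) * symp_inv n Q)" using Qd d by (simp add: mat_mult_assoc)
  also have "\<dots> = symp_inv n Q * (M * (Q * symp_inv n Q))" using Qd d by (simp add: Q(2)[symmetric] mat_mult_assoc)
  also have "\<dots> = symp_inv n Q * M" using d by (simp add: symp_inv_right[OF Q(1)])
  finally show ?thesis using d symplectic_symp_inv[OF Q(1)] by (intro symp_conjI) auto
qed

lemma symp_conj_trans:
  assumes "symp_conj n M N" "symp_conj n N K"
  shows "symp_conj n M K"
proof -
  note d = symp_conj_dim[OF assms(1)] symp_conj_dim[OF assms(2)]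
  obtain Q where Q: "Q \<in> symplectic_group n" "M * Q = Q * N" using assms by (auto simp: symp_conj_def)
  obtain R where R: "R \<in> symplectic_group n" "N * R = R * K" using assms by (auto simp: symp_conj_def)
  note Qd = symplectic_groupD(1,2)[OF Q(1)] symplectic_groupD(1,2)[OF R(1)]
  have "M * (Q * R) = (M * Q) * R" using d Qd by (simp add: mat_mult_assoc)
  also have "\<dots> = Q * (N * R)" using d Qd by (simp add: Q(2) mat_mult_assoc)
  also have "\<dots> = (Q * R) * K" using d Qd by (simp add: R(2) mat_mult_assoc)
  finally show ?thesis using d symplectic_mult[OF Q(1) R(1)] by (intro symp_conjI) auto
qed

lemma symp_conj_square:
  assumes "symp_conj n M N"
  shows "symp_conj n (M * M) (N * N)"
proof -
  note d = symp_conj_dim[OF assms]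
  obtain Q where Q: "Q \<in> symplectic_group n" "M * Q = Q * N" using assms by (auto simp: symp_conj_def)
  note Qd = symplectic_groupD(1,2)[OF Q(1)]
  have "(M * M) * Q = M * (M * Q)" using d Qd by (simp add: mat_mult_assoc)
  also have "\<dots> = M * (Q * N)" by (simp only: Q(2))
  also have "\<dots> = (M * Q) * N" using d Qd by (simp add: mat_mult_assoc)
  also have "\<dots> = Q * (N * N)" unfolding Q(2) using d Qd by (simp add: mat_mult_assoc)
  finally show ?thesis using d Q by (intro symp_conjI) auto
qed

text \<open>An adapted symplectic basis, given by its two halves \<open>V\<close> and \<open>W\<close>, turns \<open>X\<close> into a diamond sum.\<close>

lemma symp_conj_splitting:
  assumes "dim_row V = 2 * (m + n)" "dim_col V = 2 * m" "dim_row W = 2 * (m + n)" "dim_col W = 2 * n"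
    "dim_row X = 2 * (m + n)" "dim_col X = 2 * (m + n)"
    "dim_row M = 2 * m" "dim_col M = 2 * m" "dim_row N = 2 * n" "dim_col N = 2 * n"
    "V\<^sup>T * (J (m + n) * V) = J m" "W\<^sup>T * (J (m + n) * W) = J n"
    "V\<^sup>T * (J (m + n) * W) = 0\<^sub>m (2 * m) (2 * n)"
    "X * V = V * M" "X * W = W * N"
  shows "symp_conj (m + n) X (M \<diamondop> N)"
proof (rule symp_conjI)
  have "W\<^sup>T * (J (m + n) * V) = - (V\<^sup>T * (J (m + n) * W))\<^sup>T"
    using assms(1-6) by (simp add: mat_ring J_transpose)
  also have "\<dots> = 0\<^sub>m (2 * n) (2 * m)" unfolding assms(13) by (auto intro!: mat_entryI)
  finally have WV: "W\<^sup>T * (J (m + n) * V) = 0\<^sub>m (2 * n) (2 * m)" .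
  show "juxt m n V W \<in> symplectic_group (m + n)"
    using juxt_gram[OF assms(1-4) _ _ assms(11-13) WV] assms(1-4) by (intro symplectic_groupI) auto
  show "X * juxt m n V W = juxt m n V W * (M \<diamondop> N)" by (rule juxt_mult) fact+
qed (use assms in simp_all)

lemma symp_conj_diamond:
  assumes "symp_conj m M M'" "symp_conj n N N'"
  shows "symp_conj (m + n) (M \<diamondop> N) (M' \<diamondop> N')"
proof -
  note d = symp_conj_dim[OF assms(1)] symp_conj_dim[OF assms(2)]
  obtain P where P: "P \<in> symplectic_group m" "M * P = P * M'" using assms by (auto simp: symp_conj_def)
  obtain Q where Q: "Q \<in> symplectic_group n" "N * Q = Q * N'" using assms by (auto simp: symp_conj_def)
  note Pd = symplectic_groupD(1,2)[OF P(1)] symplectic_groupD(1,2)[OF Q(1)]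
  have "(M \<diamondop> N) * (P \<diamondop> Q) = (P \<diamondop> Q) * (M' \<diamondop> N')"
    using d Pd by (simp add: diamond_mult[of _ m _ n] P Q)
  thus ?thesis using d symplectic_diamond[OF P(1) Q(1)] by (intro symp_conjI) auto
qed

lemma symp_conj_diamond_commute:
  assumes "dim_row M = 2 * m" "dim_col M = 2 * m" "dim_row N = 2 * n" "dim_col N = 2 * n"
  shows "symp_conj (m + n) (M \<diamondop> N) (N \<diamondop> M)"
  using symp_conj_splitting[of "incl_right m n" n m "incl_left m n" "M \<diamondop> N" N M] assms
  by (simp add: incl_gram add.commute[of n m] diamond_mult_incl)

section \<open>Symplectic complements\<close>

definition mat_trace :: "real mat \<Rightarrow> real" where
  "mat_trace A = (\<Sum>i<dim_row A. A $$ (i, i))"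

lemma mat_trace_mult_commute:
  assumes "dim_row A = n" "dim_col A = m" "dim_row B = m" "dim_col B = n"
  shows "mat_trace (A * B) = mat_trace (B * A)"
proof -
  have "mat_trace (A * B) = (\<Sum>i<n. \<Sum>j<m. A $$ (i, j) * B $$ (j, i))"
    using assms by (auto simp: mat_trace_def scalar_prod_def atLeast0LessThan intro!: sum.cong)
  also have "\<dots> = (\<Sum>j<m. \<Sum>i<n. B $$ (j, i) * A $$ (i, j))"
    by (subst sum.swap) (simp add: mult.commute)
  also have "\<dots> = mat_trace (B * A)"
    using assms by (auto simp: mat_trace_def scalar_prod_def atLeast0LessThan intro!: sum.cong)
  finally show ?thesis .
qed

text \<open>A left inverse of \<open>V\<close> is \<open>- J V\<^sup>T J\<close>. Were \<open>k > n\<close>, padding both matrices with zeros would give square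
  matrices that are inverse on one side but not on the other.\<close>

lemma symplectic_embedding_dim_le:
  assumes V: "dim_row V = 2 * n" "dim_col V = 2 * k" "V\<^sup>T * (J n * V) = J k"
  shows "k \<le> n"
proof (rule ccontr)
  assume "\<not> k \<le> n"
  define A where "A = - (J k * (V\<^sup>T * J n))"
  define A' where "A' = four_block_mat A (0\<^sub>m (2*k) (2*k - 2*n)) (0\<^sub>m 0 (2*n)) (0\<^sub>m 0 (2*k - 2*n))"
  define V' where "V' = four_block_mat V (0\<^sub>m (2*n) 0) (0\<^sub>m (2*k - 2*n) (2*k)) (0\<^sub>m (2*k - 2*n) 0)"
  have cV: "V \<in> carrier_mat (2*n) (2*k)" and cA: "A \<in> carrier_mat (2*k) (2*n)"
    using V by (auto simp: A_def)
  have c: "A' \<in> carrier_mat (2*k) (2*k)" "V' \<in> carrier_mat (2*k) (2*k)"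
    using cV cA \<open>\<not> k \<le> n\<close> by (auto simp: A'_def V'_def intro!: carrier_matI)
  have "A * V = - (J k * (V\<^sup>T * (J n * V)))" using V by (simp add: A_def mat_mult_assoc)
  also have "\<dots> = 1\<^sub>m (2*k)" by (simp add: V(3) J_square)
  finally have AV: "A * V = 1\<^sub>m (2*k)" .
  have "A' * V' = four_block_mat (A * V + 0\<^sub>m (2*k) (2*k - 2*n) * 0\<^sub>m (2*k - 2*n) (2*k))
     (A * 0\<^sub>m (2*n) 0 + 0\<^sub>m (2*k) (2*k - 2*n) * 0\<^sub>m (2*k - 2*n) 0)
     (0\<^sub>m 0 (2*n) * V + 0\<^sub>m 0 (2*k - 2*n) * 0\<^sub>m (2*k - 2*n) (2*k))
     (0\<^sub>m 0 (2*n) * 0\<^sub>m (2*n) 0 + 0\<^sub>m 0 (2*k - 2*n) * 0\<^sub>m (2*k - 2*n) 0)"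
    unfolding A'_def V'_def by (rule mult_four_block_mat) (use cV cA in auto)
  also have "\<dots> = 1\<^sub>m (2*k)" unfolding AV by (rule mat_entryI) auto
  finally have "V' * A' = 1\<^sub>m (2*k)" using c mat_mult_left_right_inverse by blast
  hence "(V' * A') $$ (2*n, 2*n) = 1" using \<open>\<not> k \<le> n\<close> by simp
  moreover have "(V' * A') $$ (2*n, 2*n) = 0"
  proof -
    have "row V' (2*n) = 0\<^sub>v (2*k)" using cV \<open>\<not> k \<le> n\<close> by (auto simp: V'_def intro!: eq_vecI)
    moreover have "col A' (2*n) \<in> carrier_vec (2*k)" using c(1) \<open>\<not> k \<le> n\<close> by (intro col_carrier_vec) auto
    ultimately show ?thesis using c \<open>\<not> k \<le> n\<close> by simp
  qed
  ultimately show False by simp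
qed

text \<open>The symplectic projection onto the complement of the range of \<open>V\<close> has trace \<open>2 n - 2 k\<close>, hence is not
  zero; two of its columns with a nonzero product, rescaled, are the required pair.\<close>

lemma hyperbolic_pair_in_complement:
  assumes V: "dim_row V = 2 * n" "dim_col V = 2 * k" "V\<^sup>T * (J n * V) = J k" and "k < n"
  obtains W where "dim_row W = 2 * n" "dim_col W = 2" "W\<^sup>T * (J n * W) = J 1"
    "V\<^sup>T * (J n * W) = 0\<^sub>m (2 * k) 2"
proof -
  \<comment> \<open>the symplectic projection onto the complement of the range of \<open>V\<close>\<close>
  define \<pi> where "\<pi> = 1\<^sub>m (2*n) + V * (J k * (V\<^sup>T * J n))"
  have d [simp]: "dim_row \<pi> = 2*n" "dim_col \<pi> = 2*n" using V by (auto simp: \<pi>_def)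
  have "\<pi> * V = V + V * (J k * (V\<^sup>T * (J n * V)))" using V(1,2) by (simp add: \<pi>_def mat_ring)
  also have "\<dots> = 0\<^sub>m (2*n) (2*k)" unfolding V(3) J_square using V(1,2)
    by (auto intro!: mat_entryI)
  finally have PV: "\<pi> * V = 0\<^sub>m (2*n) (2*k)" .
  have VJP: "V\<^sup>T * (J n * \<pi>) = 0\<^sub>m (2*k) (2*n)"
  proof -
    have "V\<^sup>T * (J n * \<pi>) = V\<^sup>T * J n + (V\<^sup>T * (J n * V)) * (J k * (V\<^sup>T * J n))"
      using V(1,2) by (simp add: \<pi>_def mat_ring)
    also have "\<dots> = 0\<^sub>m (2*k) (2*n)" unfolding V(3) using V(1,2) by (auto intro!: mat_entryI)
    finally show ?thesis .
  qed
  define A where "A = J n * \<pi>"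
  have dA [simp]: "dim_row A = 2*n" "dim_col A = 2*n" by (auto simp: A_def)
  have At: "A\<^sup>T = - A"
    using V(1,2) by (simp add: A_def \<pi>_def mat_ring J_transpose) (auto simp: mat_entryI intro!: mat_entryI)
  have PJP: "\<pi>\<^sup>T * (J n * \<pi>) = A"
  proof -
    have "\<pi>\<^sup>T * (J n * \<pi>) = (1\<^sub>m (2*n))\<^sup>T * (J n * \<pi>) + (J k * (V\<^sup>T * J n))\<^sup>T * (V\<^sup>T * (J n * \<pi>))"
      using V(1,2) by (subst (1) \<pi>_def) (simp add: mat_ring)
    also have "\<dots> = A" unfolding VJP using V(1,2) by (auto simp: A_def intro!: mat_entryI)
    finally show ?thesis .
  qed
  have tr: "mat_trace \<pi> = 2 * real n - 2 * real k"
  proof -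
    have "mat_trace \<pi> = 2 * real n + mat_trace (V * (J k * (V\<^sup>T * J n)))"
      using V(1,2) by (simp add: mat_trace_def \<pi>_def sum.distrib del: index_mult_mat(1))
    also have "mat_trace (V * (J k * (V\<^sup>T * J n))) = mat_trace ((J k * (V\<^sup>T * J n)) * V)"
      by (rule mat_trace_mult_commute) (use V in auto)
    also have "(J k * (V\<^sup>T * J n)) * V = J k * (V\<^sup>T * (J n * V))"
      using V(1,2) by (simp add: mat_mult_assoc)
    also have "mat_trace \<dots> = - 2 * real k" unfolding V(3) J_square by (simp add: mat_trace_def)
    finally show ?thesis by simp
  qed
  have "\<exists>i j. i < 2*n \<and> j < 2*n \<and> A $$ (i, j) < 0"
  proof (rule ccontr)
    assume *: "\<not> ?thesis"
    have "A $$ (i, j) = 0" if "i < 2*n" "j < 2*n" for i j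
    proof -
      have "A\<^sup>T $$ (j, i) = (- A) $$ (j, i)" by (simp only: At)
      hence "A $$ (i, j) = - A $$ (j, i)" using that by simp
      moreover have "A $$ (i, j) \<ge> 0" "A $$ (j, i) \<ge> 0" using * that by (meson not_less)+
      ultimately show ?thesis by linarith
    qed
    hence "A = 0\<^sub>m (2*n) (2*n)" by (intro mat_entryI) auto
    moreover have "\<pi> = - (J n * A)" by (simp add: A_def)
    ultimately have "mat_trace \<pi> = 0" by (simp add: mat_trace_def)
    thus False using tr \<open>k < n\<close> by simp
  qed
  then obtain i j where ij: "i < 2*n" "j < 2*n" "A $$ (i, j) < 0" by blast
  define c where "c = - A $$ (i, j)"
  have c: "c > 0" "A $$ (i, j) = - c" "A $$ (j, i) = c" "A $$ (i, i) = 0" "A $$ (j, j) = 0"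
  proof -
    have anti: "A $$ (b, a) = - A $$ (a, b)" if "a < 2*n" "b < 2*n" for a b
    proof -
      have "A\<^sup>T $$ (a, b) = (- A) $$ (a, b)" by (simp only: At)
      thus ?thesis using that by simp
    qed
    show "c > 0" "A $$ (i, j) = - c" "A $$ (j, i) = c" "A $$ (i, i) = 0" "A $$ (j, j) = 0"
      using ij anti[of i j] anti[of i i] anti[of j j] by (auto simp: c_def)
  qed
  define P where "P = coord_incl (2*n) 2 (\<lambda>b. if b = 0 then i else j)"
  have dP [simp]: "dim_row P = 2*n" "dim_col P = 2" by (auto simp: P_def)
  have PAP: "P\<^sup>T * (A * P) = c \<cdot>\<^sub>m J 1"
  proof (rule mat_entryI)
    fix a b assume "a < dim_row (c \<cdot>\<^sub>m J 1)" "b < dim_col (c \<cdot>\<^sub>m J 1)"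
    hence ab: "a < 2" "b < 2" by auto
    have "(P\<^sup>T * (A * P)) $$ (a, b) = A $$ (if a = 0 then i else j, if b = 0 then i else j)"
      unfolding P_def using ab ij by (simp add: transpose_coord_incl_mult mult_coord_incl del: index_mult_mat(1))
    also have "\<dots> = (c \<cdot>\<^sub>m J 1) $$ (a, b)" using ab c by (auto simp: J_index less_2_cases_iff)
    finally show "(P\<^sup>T * (A * P)) $$ (a, b) = (c \<cdot>\<^sub>m J 1) $$ (a, b)" .
  qed auto
  define W where "W = (1 / sqrt c) \<cdot>\<^sub>m (\<pi> * P)"
  show ?thesis
  proof (rule that)
    show "dim_row W = 2 * n" "dim_col W = 2" by (auto simp: W_def)
    have "W\<^sup>T * (J n * W) = (1 / sqrt c * (1 / sqrt c)) \<cdot>\<^sub>m (P\<^sup>T * ((\<pi>\<^sup>T * (J n * \<pi>)) * P))"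
      by (simp add: W_def mat_ring)
    also have "\<dots> = J 1" unfolding PJP PAP using c(1) by (simp add: mat_smult_smult)
    finally show "W\<^sup>T * (J n * W) = J 1" .
    have "V\<^sup>T * (J n * W) = (1 / sqrt c) \<cdot>\<^sub>m ((V\<^sup>T * (J n * \<pi>)) * P)"
      using V(1,2) by (simp add: W_def mat_ring)
    also have "\<dots> = 0\<^sub>m (2 * k) 2" unfolding VJP by simp
    finally show "V\<^sup>T * (J n * W) = 0\<^sub>m (2 * k) 2" .
  qed
qed

lemma juxt_mult_incl:
  assumes "dim_row V = r" "dim_col V = 2 * m" "dim_row W = r" "dim_col W = 2 * n"
  shows "juxt m n V W * incl_left m n = V" "juxt m n V W * incl_right m n = W"
proof -
  have "juxt m n V W * incl_left m n = V * ((incl_left m n)\<^sup>T * incl_left m n) + W * ((incl_right m n)\<^sup>T * incl_left m n)"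
    "juxt m n V W * incl_right m n = V * ((incl_left m n)\<^sup>T * incl_right m n) + W * ((incl_right m n)\<^sup>T * incl_right m n)"
    using assms by (simp_all add: juxt_def mat_ring)
  thus "juxt m n V W * incl_left m n = V" "juxt m n V W * incl_right m n = W"
    unfolding incl_isometry incl_disjoint using assms
    by (auto intro!: mat_entryI simp del: index_mult_mat(1))
qed

text \<open>Symplectic Gram-Schmidt: hyperbolic pairs orthogonal to everything found so far are appended one by one.\<close>

lemma symplectic_complement:
  assumes V: "dim_row V = 2 * n" "dim_col V = 2 * k" "V\<^sup>T * (J n * V) = J k"
  shows "k + r \<le> n \<Longrightarrow> \<exists>W. dim_row W = 2 * n \<and> dim_col W = 2 * r \<and> W\<^sup>T * (J n * W) = J r \<and>
    V\<^sup>T * (J n * W) = 0\<^sub>m (2 * k) (2 * r)"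
proof (induction r)
  case 0
  have "J 0 = 0\<^sub>m 0 0" by (auto intro!: mat_entryI)
  thus ?case using V(1,2) by (intro exI[of _ "0\<^sub>m (2*n) 0"]) (simp add: zero_transpose_mat)
next
  case (Suc r)
  then obtain W where W: "dim_row W = 2 * n" "dim_col W = 2 * r" "W\<^sup>T * (J n * W) = J r"
    "V\<^sup>T * (J n * W) = 0\<^sub>m (2 * k) (2 * r)" by auto
  have flip: "B\<^sup>T * (J n * A) = 0\<^sub>m b a"
    if "dim_row A = 2*n" "dim_row B = 2*n" "A\<^sup>T * (J n * B) = 0\<^sub>m a b" for A B a b
  proof -
    have "B\<^sup>T * (J n * A) = - (A\<^sup>T * (J n * B))\<^sup>T"
      using that(1,2) by (simp add: mat_ring J_transpose)
    also have "\<dots> = 0\<^sub>m b a" unfolding that(3) by (auto intro!: mat_entryI)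
    finally show ?thesis .
  qed
  have g: "(juxt k r V W)\<^sup>T * (J n * juxt k r V W) = J (k + r)"
    by (rule juxt_gram[OF V(1,2) W(1,2) _ _ V(3) W(3,4) flip[OF V(1) W(1) W(4)]]) auto
  obtain U where U: "dim_row U = 2 * n" "dim_col U = 2" "U\<^sup>T * (J n * U) = J 1"
    "(juxt k r V W)\<^sup>T * (J n * U) = 0\<^sub>m (2 * (k + r)) 2"
    using hyperbolic_pair_in_complement[OF _ _ g] W Suc.prems by auto
  have VU: "(juxt k r V W * I)\<^sup>T * (J n * U) = 0\<^sub>m (dim_col I) 2" if "dim_row I = 2 * (k + r)" for I
  proof -
    have "(juxt k r V W * I)\<^sup>T * (J n * U) = I\<^sup>T * ((juxt k r V W)\<^sup>T * (J n * U))"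
      using that U(1) W(1) by (simp add: mat_ring)
    thus ?thesis unfolding U(4) using that by simp
  qed
  have WU: "V\<^sup>T * (J n * U) = 0\<^sub>m (2*k) (2*1)" "W\<^sup>T * (J n * U) = 0\<^sub>m (2*r) (2*1)"
    using VU[of "incl_left k r"] VU[of "incl_right k r"] by (simp_all add: juxt_mult_incl[OF V(1,2) W(1,2)])
  have U2: "dim_col U = 2 * 1" using U by simp
  have "(juxt r 1 W U)\<^sup>T * (J n * juxt r 1 W U) = J (r + 1)"
    by (rule juxt_gram[OF W(1,2) U(1) U2 _ _ W(3) U(3) WU(2) flip[OF W(1) U(1) WU(2)]]) auto
  moreover have "V\<^sup>T * (J n * juxt r 1 W U) = 0\<^sub>m (2 * k) (2 * (r + 1))"
  proof -
    have "V\<^sup>T * (J n * juxt r 1 W U) = (V\<^sup>T * (J n * W)) * (incl_left r 1)\<^sup>T + (V\<^sup>T * (J n * U)) * (incl_right r 1)\<^sup>T"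
      using V(1,2) W(1,2) U(1) U2 by (simp add: juxt_def mat_ring)
    thus ?thesis unfolding W(4) WU by simp
  qed
  ultimately show ?case using U U2 by (intro exI[of _ "juxt r 1 W U"]) auto
qed

text \<open>The symplectic complement of an invariant nondegenerate subspace is invariant because \<open>X\<close> preserves
  the form and acts bijectively on the subspace.\<close>

lemma symplectic_invariant_splitting:
  assumes X: "X \<in> symplectic_group n"
    and V: "dim_row V = 2 * n" "dim_col V = 2 * k" "V\<^sup>T * (J n * V) = J k"
    and A: "dim_row A = 2 * k" "dim_col A = 2 * k" "X * V = V * A"
  obtains n' X' where "n = k + n'" "X' \<in> symplectic_group n'" "symp_conj n X (A \<diamondop> X')"
proof -
  note Xd = symplectic_groupD[OF X]
  have "k \<le> n" by (rule symplectic_embedding_dim_le[OF V])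
  then obtain n' where n: "n = k + n'" using le_Suc_ex by blast
  obtain W where W: "dim_row W = 2 * n" "dim_col W = 2 * n'" "W\<^sup>T * (J n * W) = J n'"
    "V\<^sup>T * (J n * W) = 0\<^sub>m (2 * k) (2 * n')"
    using symplectic_complement[OF V, of n'] n by auto
  have iso: "(X * B)\<^sup>T * (J n * (X * C)) = B\<^sup>T * (J n * C)"
    if "dim_row B = 2*n" "dim_row C = 2*n" for B C
  proof -
    have "(X * B)\<^sup>T * (J n * (X * C)) = B\<^sup>T * ((X\<^sup>T * (J n * X)) * C)"
      by (rule gram_mult[where r = "2*n"]) (use that Xd in auto)
    thus ?thesis unfolding Xd(4) .
  qed
  have "A\<^sup>T * (J k * A) = (V * A)\<^sup>T * (J n * (V * A))"
    using gram_mult[of V "2*n" V "J n" A A] V A by simp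
  also have "\<dots> = J k" using iso[of V V] V A by simp
  finally have A': "A \<in> symplectic_group k" using A by (intro symplectic_groupI) auto
  have VXW: "V\<^sup>T * (J n * (X * W)) = 0\<^sub>m (2*k) (2*n')"
  proof -
    have "(symp_inv k A)\<^sup>T * (A\<^sup>T * (V\<^sup>T * (J n * (X * W))))
       = (symp_inv k A)\<^sup>T * ((X * V)\<^sup>T * (J n * (X * W)))"
      unfolding A(3) using A(1,2) V(1,2) Xd(1,2) W(1,2) by (simp add: mat_ring)
    also have "\<dots> = 0\<^sub>m (2*k) (2*n')" using iso[OF V(1) W(1)] W(4) by simp
    also have "(symp_inv k A)\<^sup>T * (A\<^sup>T * (V\<^sup>T * (J n * (X * W))))
      = (A * symp_inv k A)\<^sup>T * (V\<^sup>T * (J n * (X * W)))"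
      using A(1,2) V(1,2) by (simp add: mat_transpose_mult mat_mult_assoc)
    also have "\<dots> = V\<^sup>T * (J n * (X * W))"
      unfolding symp_inv_right[OF A'] using V by simp
    finally show ?thesis .
  qed
  define X' where "X' = - (J n' * (W\<^sup>T * (J n * (X * W))))"
  have X'd: "dim_row X' = 2*n'" "dim_col X' = 2*n'" using W by (auto simp: X'_def)
  have WV: "W\<^sup>T * (J n * V) = 0\<^sub>m (2*n') (2*k)"
  proof -
    have "W\<^sup>T * (J n * V) = - (V\<^sup>T * (J n * W))\<^sup>T"
      using W(1,2) V(1,2) by (simp add: mat_ring J_transpose)
    also have "\<dots> = 0\<^sub>m (2*n') (2*k)" unfolding W(4) by (auto intro!: mat_entryI)
    finally show ?thesis .
  qed
  let ?Q = "juxt k n' V W" and ?L = "incl_left k n'" and ?R = "incl_right k n'"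
  have Q: "?Q \<in> symplectic_group n"
    using juxt_gram[OF V(1,2) W(1,2) _ _ V(3) W(3,4) WV] n W(1) by (intro symplectic_groupI) auto
  have "X * W = ?Q * (symp_inv n ?Q * (X * W))" using symp_inv_left_mult(2)[OF Q] Xd by simp
  also have "\<dots> = ?Q * - (J n * (?L * (V\<^sup>T * (J n * (X * W))) + ?R * (W\<^sup>T * (J n * (X * W)))))"
    using V(1,2) W(1,2) Xd(1,2) n by (simp add: symp_inv_def mat_ring juxt_def)
  also have "?L * (V\<^sup>T * (J n * (X * W))) + ?R * (W\<^sup>T * (J n * (X * W)))
      = ?R * (W\<^sup>T * (J n * (X * W)))"
    by (rule mat_entryI) (simp_all add: VXW W(1,2) del: index_mult_mat(1))
  also have "?Q * - (J n * \<dots>) = ?Q * - ((J (k + n') * ?R) * (W\<^sup>T * (J n * (X * W))))"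
    unfolding n[symmetric] using W(1,2) n by (subst mat_mult_assoc) auto
  also have "\<dots> = (?Q * ?R) * X'"
    unfolding J_mult_incl X'_def using W(1,2) by (simp add: mat_mult_assoc)
  also have "\<dots> = W * X'" by (simp add: juxt_mult_incl[OF V(1,2) W(1,2)])
  finally have XW: "X * W = W * X'" .
  have "X'\<^sup>T * (J n' * X') = (W * X')\<^sup>T * (J n * (W * X'))"
    using gram_mult[of W "2*n" W "J n" X' X'] W X'd by simp
  also have "\<dots> = J n'" using iso[OF W(1) W(1)] W by (simp add: XW)
  finally have X': "X' \<in> symplectic_group n'" using X'd by (intro symplectic_groupI) auto
  have "symp_conj (k + n') X (A \<diamondop> X')"
    by (rule symp_conj_splitting[of V _ _ W]) (use V W n Xd(1,2) A X'd XW in simp_all)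
  thus ?thesis using that n X' by blast
qed

section \<open>Wonenburger matrices\<close>

lemma wonenburger_dims:
  assumes "wonenburger_relations k A B C"
  shows "dim_row A = k" "dim_col A = k" "dim_row B = k" "dim_col B = k" "dim_row C = k" "dim_col C = k"
  using assms by (auto simp: wonenburger_relations_def)

lemma wonenburger_relationsD:
  assumes "wonenburger_relations k A B C"
  shows "B\<^sup>T = B" "C\<^sup>T = C" "A * B = B * A\<^sup>T"
    "A\<^sup>T * C = C * A" "B * C = A * A - 1\<^sub>m k"
    "C * B = A\<^sup>T * A\<^sup>T - 1\<^sub>m k"
proof -
  note d = wonenburger_dims[OF assms]
  have r: "B = B\<^sup>T" "C = C\<^sup>T" "A * B = B * A\<^sup>T"
    "A\<^sup>T * C = C * A" "A * A - B * C = 1\<^sub>m k"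
    using assms by (auto simp: wonenburger_relations_def)
  show BC: "B * C = A * A - 1\<^sub>m k" unfolding r(5)[symmetric] using d by (auto intro!: mat_entryI simp del: index_mult_mat(1))
  have "C * B = (B * C)\<^sup>T" using d by (simp add: mat_transpose_mult r(1,2)[symmetric])
  also have "\<dots> = A\<^sup>T * A\<^sup>T - 1\<^sub>m k" unfolding BC using d by (simp add: mat_ring)
  finally show "C * B = A\<^sup>T * A\<^sup>T - 1\<^sub>m k" .
qed (use assms in \<open>auto simp: wonenburger_relations_def\<close>)

lemma wonenburger_mat_dim [simp]:
  "dim_row A = k \<Longrightarrow> dim_col A = k \<Longrightarrow> dim_row (wonenburger_mat A B C) = 2 * k"
  "dim_row A = k \<Longrightarrow> dim_col A = k \<Longrightarrow> dim_col (wonenburger_mat A B C) = 2 * k"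
  by (auto simp: wonenburger_mat_def)

lemma four_block_mult:
  fixes A1 B1 C1 D1 A2 B2 C2 D2 :: "real mat"
  assumes "dim_row A1 = k" "dim_col A1 = k" "dim_row B1 = k" "dim_col B1 = k"
    "dim_row C1 = k" "dim_col C1 = k" "dim_row D1 = k" "dim_col D1 = k"
    "dim_row A2 = k" "dim_col A2 = k" "dim_row B2 = k" "dim_col B2 = k"
    "dim_row C2 = k" "dim_col C2 = k" "dim_row D2 = k" "dim_col D2 = k"
  shows "four_block_mat A1 B1 C1 D1 * four_block_mat A2 B2 C2 D2
  = four_block_mat (A1 * A2 + B1 * C2) (A1 * B2 + B1 * D2) (C1 * A2 + D1 * C2) (C1 * B2 + D1 * D2)"
  by (rule mult_four_block_mat[of _ k k _ k _ k]) (use assms in auto)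

lemma wonenburger_symplectic:
  assumes "wonenburger_relations k A B C"
  shows "wonenburger_mat A B C \<in> symplectic_group k"
proof (rule symplectic_groupI)
  note d = wonenburger_dims[OF assms] and r = wonenburger_relationsD[OF assms]
  have t: "(wonenburger_mat A B C)\<^sup>T = four_block_mat A\<^sup>T C B A"
    unfolding wonenburger_mat_def using d r
    by (subst transpose_four_block_mat[of _ k k _ k _ k]) (auto intro: carrier_matI)
  have "J k * wonenburger_mat A B C = four_block_mat (0\<^sub>m k k * A + - 1\<^sub>m k * C) (0\<^sub>m k k * B + - 1\<^sub>m k * A\<^sup>T)
      (1\<^sub>m k * A + 0\<^sub>m k k * C) (1\<^sub>m k * B + 0\<^sub>m k k * A\<^sup>T)"
    unfolding symplectic_form_mat_def wonenburger_mat_def by (rule four_block_mult) (use d in simp_all)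
  also have "\<dots> = four_block_mat (- C) (- A\<^sup>T) A B"
    using d by (intro cong_four_block_mat) (auto intro!: mat_entryI)
  finally have J: "J k * wonenburger_mat A B C = \<dots>" .
  have "(wonenburger_mat A B C)\<^sup>T * (J k * wonenburger_mat A B C)
    = four_block_mat (A\<^sup>T * (- C) + C * A) (A\<^sup>T * (- A\<^sup>T) + C * B)
       (B * (- C) + A * A) (B * (- A\<^sup>T) + A * B)"
    unfolding t J by (rule four_block_mult) (use d in simp_all)
  also have "\<dots> = J k" unfolding symplectic_form_mat_def using d
    by (intro cong_four_block_mat) (auto intro!: mat_entryI simp: r(3-6) simp del: index_mult_mat(1))
  finally show "(wonenburger_mat A B C)\<^sup>T * (J k * wonenburger_mat A B C) = J k" .
qed (use wonenburger_dims[OF assms] in auto)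

lemma wonenburger_square:
  assumes "wonenburger_relations k A B C"
  shows "wonenburger_mat A B C * wonenburger_mat A B C
     = wonenburger_mat (2 \<cdot>\<^sub>m (A * A) - 1\<^sub>m k) (2 \<cdot>\<^sub>m (A * B)) (2 \<cdot>\<^sub>m (C * A))"
proof -
  note d = wonenburger_dims[OF assms] and r = wonenburger_relationsD[OF assms]
  have "wonenburger_mat A B C * wonenburger_mat A B C
    = four_block_mat (A * A + B * C) (A * B + B * A\<^sup>T) (C * A + A\<^sup>T * C) (C * B + A\<^sup>T * A\<^sup>T)"
    unfolding wonenburger_mat_def by (rule four_block_mult) (use d in simp_all)
  also have "\<dots> = wonenburger_mat (2 \<cdot>\<^sub>m (A * A) - 1\<^sub>m k) (2 \<cdot>\<^sub>m (A * B)) (2 \<cdot>\<^sub>m (C * A))"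
    unfolding r(4-6) r(3)[symmetric] wonenburger_mat_def using d
    by (intro cong_four_block_mat) (auto intro!: mat_entryI simp: mat_ring simp del: index_mult_mat(1))
  finally show ?thesis .
qed

section \<open>The anti-diagonal matrix and the nilpotent shift\<close>

abbreviation F :: "nat \<Rightarrow> real mat" where "F \<equiv> anti_diag_mat"
abbreviation S :: "nat \<Rightarrow> real mat" where "S k \<equiv> jordan_block k 0"

lemma F_dim [simp]: "dim_row (F k) = k" "dim_col (F k) = k"
  by (auto simp: anti_diag_mat_def)

lemma F_index: "i < k \<Longrightarrow> j < k \<Longrightarrow> F k $$ (i, j) = (if i + j + 1 = k then 1 else 0)"
  by (auto simp: anti_diag_mat_def)

lemma F_transpose [simp]: "(F k)\<^sup>T = F k"
  by (rule mat_entryI) (auto simp: anti_diag_mat_def add.commute)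

lemma F_coord_incl: "F k = coord_incl k k (\<lambda>j. k - 1 - j)"
  by (rule mat_entryI) (auto simp: anti_diag_mat_def coord_incl_def)

lemma mult_F:
  assumes "dim_col A = k" "i < dim_row A" "j < k"
  shows "(A * F k) $$ (i, j) = A $$ (i, k - 1 - j)"
  unfolding F_coord_incl using assms by (intro mult_coord_incl) auto

lemma F_mult:
  assumes "dim_row A = k" "i < k" "j < dim_col A"
  shows "(F k * A) $$ (i, j) = A $$ (k - 1 - i, j)"
proof -
  have "(F k * A) $$ (i, j) = ((F k)\<^sup>T * A) $$ (i, j)" by (simp only: F_transpose)
  also have "\<dots> = A $$ (k - 1 - i, j)"
    unfolding F_coord_incl using assms by (intro transpose_coord_incl_mult) auto
  finally show ?thesis .
qed

lemma F_square: "F k * F k = 1\<^sub>m k"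
  by (rule mat_entryI) (auto simp: mult_F F_index simp del: index_mult_mat(1))

lemma F_F_mult [simp]: "dim_row A = k \<Longrightarrow> F k * (F k * A) = A"
  by (simp add: mat_mult_assoc[symmetric] F_square)

lemma jordan_block_F: "jordan_block k a * F k = F k * (jordan_block k (a::real))\<^sup>T"
  by (rule mat_entryI) (auto simp: mult_F F_mult simp del: index_mult_mat(1))

text \<open>When \<open>B\<close> is invertible the relations determine \<open>C = B\<^sup>-\<^sup>1 (A\<^sup>2 - 1)\<close>, and the remaining ones follow from
  \<open>A F = F A\<^sup>T\<close>.\<close>

lemma wonenburger_anti_diag:
  assumes A: "dim_row A = k" "dim_col A = k" "A * F k = F k * A\<^sup>T" and "b * c = 1"
  shows "wonenburger_relations k A (b \<cdot>\<^sub>m F k) (c \<cdot>\<^sub>m (F k * (A * A - 1\<^sub>m k)))"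
proof -
  have F: "A\<^sup>T * F k = F k * A"
  proof -
    have "F k * ((A * F k) * F k) = F k * ((F k * A\<^sup>T) * F k)" by (simp only: A(3))
    thus ?thesis using A(1,2) by (simp add: mat_mult_assoc F_square)
  qed
  have F': "A\<^sup>T * (F k * Z) = F k * (A * Z)" if "dim_row Z = k" for Z
    using that A(1,2) by (simp add: mat_mult_assoc[symmetric] F)
  have "(F k * (A * A - 1\<^sub>m k))\<^sup>T = F k * (A * A - 1\<^sub>m k)"
    using A(1,2) by (simp add: mat_ring F F')
  moreover have "A * A - (b \<cdot>\<^sub>m F k) * (c \<cdot>\<^sub>m (F k * (A * A - 1\<^sub>m k))) = 1\<^sub>m k"
    using A(1,2) \<open>b * c = 1\<close> mult.commute[of b c] by (simp add: mat_ring F_square) (auto intro!: mat_entryI simp del: index_mult_mat(1))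
  ultimately show ?thesis
    unfolding wonenburger_relations_def using A
    by (auto simp: mat_ring F F' intro!: carrier_matI)
qed

text \<open>The matrix of a symplectic operator in its Krylov basis. The off-diagonal lower block is forced by the
  relation \<open>A\<^sup>2 - B C = 1\<close>.\<close>

definition cyclic_root :: "nat \<Rightarrow> real \<Rightarrow> real mat" where
  "cyclic_root k s = wonenburger_mat ((1 / sqrt 2) \<cdot>\<^sub>m S k) ((s / sqrt 2) \<cdot>\<^sub>m F k)
     ((sqrt 2 * s) \<cdot>\<^sub>m (F k * (((1 / sqrt 2) \<cdot>\<^sub>m S k) * ((1 / sqrt 2) \<cdot>\<^sub>m S k) - 1\<^sub>m k)))"

lemma cyclic_root_relations:
  assumes "s \<in> {-1, 1}"
  shows "wonenburger_relations k ((1 / sqrt 2) \<cdot>\<^sub>m S k) ((s / sqrt 2) \<cdot>\<^sub>m F k)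
     ((sqrt 2 * s) \<cdot>\<^sub>m (F k * (((1 / sqrt 2) \<cdot>\<^sub>m S k) * ((1 / sqrt 2) \<cdot>\<^sub>m S k) - 1\<^sub>m k)))"
  by (rule wonenburger_anti_diag) (use assms in \<open>auto simp: mat_ring jordan_block_F\<close>)

lemma cyclic_root_dim [simp]:
  "dim_row (cyclic_root k s) = 2 * k" "dim_col (cyclic_root k s) = 2 * k"
  by (auto simp: cyclic_root_def)

lemma cyclic_root_symplectic: "s \<in> {-1, 1} \<Longrightarrow> cyclic_root k s \<in> symplectic_group k"
  unfolding cyclic_root_def by (rule wonenburger_symplectic[OF cyclic_root_relations])

section \<open>Powers of matrices\<close>

lemma mat_pow_add:
  assumes "dim_row A = n" "dim_col A = (n::nat)"
  shows "A ^\<^sub>m (i + j) = (A :: real mat) ^\<^sub>m i * A ^\<^sub>m j"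
proof (induction j)
  case (Suc j)
  have "A ^\<^sub>m (i + Suc j) = (A ^\<^sub>m i * A ^\<^sub>m j) * A" using Suc by simp
  also have "\<dots> = A ^\<^sub>m i * A ^\<^sub>m Suc j" using assms by (simp add: mat_mult_assoc)
  finally show ?case .
qed (use assms in simp)

lemma mat_pow_Suc_left:
  assumes "dim_row A = n" "dim_col A = (n::nat)"
  shows "A * A ^\<^sub>m j = (A :: real mat) ^\<^sub>m Suc j"
  using mat_pow_add[OF assms, of 1 j] assms by simp

lemma mat_pow_eq_0_mono:
  assumes "dim_row A = n" "dim_col A = (n::nat)" "(A :: real mat) ^\<^sub>m k = 0\<^sub>m n n" "k \<le> j"
  shows "A ^\<^sub>m j = 0\<^sub>m n n"
  using mat_pow_add[OF assms(1,2), of k "j - k"] assms by simp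

lemma mat_pow_mult_commuting:
  assumes "dim_row A = n" "dim_col A = n" "dim_row B = n" "dim_col B = (n::nat)" "A * B = B * (A :: real mat)"
  shows "(A * B) ^\<^sub>m j = A ^\<^sub>m j * B ^\<^sub>m j"
proof (induction j)
  case (Suc j)
  have c: "B ^\<^sub>m j * A = A * B ^\<^sub>m j"
  proof (induction j)
    case (Suc j)
    have "B ^\<^sub>m Suc j * A = B ^\<^sub>m j * (A * B)" using assms by (simp add: mat_mult_assoc)
    also have "\<dots> = (B ^\<^sub>m j * A) * B" using assms(1-4) by (simp add: mat_mult_assoc)
    also have "\<dots> = A * B ^\<^sub>m Suc j" unfolding Suc using assms(1-4) by (simp add: mat_mult_assoc)
    finally show ?case .
  qed (use assms in simp)
  have "(A * B) ^\<^sub>m Suc j = A ^\<^sub>m j * ((B ^\<^sub>m j * A) * B)" using assms(1-4) Suc by (simp add: mat_mult_assoc)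
  also have "\<dots> = A ^\<^sub>m Suc j * B ^\<^sub>m Suc j" unfolding c using assms(1-4) by (simp add: mat_mult_assoc)
  finally show ?case .
qed (use assms in simp)

lemma mat_pow_smult:
  assumes "dim_row A = n" "dim_col A = (n::nat)"
  shows "(c \<cdot>\<^sub>m A) ^\<^sub>m j = c ^ j \<cdot>\<^sub>m (A :: real mat) ^\<^sub>m j"
  by (induction j) (use assms in \<open>simp_all add: mat_ring mult.commute\<close>)

section \<open>Krylov bases of a symplectic matrix\<close>

definition hcat :: "real mat \<Rightarrow> real mat \<Rightarrow> real mat" where
  "hcat A B = mat (dim_row A) (dim_col A + dim_col B)
     (\<lambda>(i, j). if j < dim_col A then A $$ (i, j) else B $$ (i, j - dim_col A))"

lemma hcat_dim [simp]: "dim_row (hcat A B) = dim_row A" "dim_col (hcat A B) = dim_col A + dim_col B"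
  by (auto simp: hcat_def)

lemma mult_hcat:
  assumes "dim_row A = dim_row B" "dim_col Z = dim_row B"
  shows "Z * hcat A B = hcat (Z * A) (Z * B)"
proof (rule mat_entryI)
  fix i j assume "i < dim_row (hcat (Z * A) (Z * B))" "j < dim_col (hcat (Z * A) (Z * B))"
  hence ij: "i < dim_row Z" "j < dim_col A + dim_col B" by auto
  have "col (hcat A B) j = (if j < dim_col A then col A j else col B (j - dim_col A))"
    using ij assms by (auto simp: hcat_def intro!: eq_vecI)
  thus "(Z * hcat A B) $$ (i, j) = hcat (Z * A) (Z * B) $$ (i, j)"
    using ij by (auto simp: hcat_def)
qed auto

lemma hcat_transpose_mult:
  assumes "dim_row A = dim_row B" "dim_row C = dim_row B" "dim_row D = dim_row B"
  shows "(hcat A B)\<^sup>T * hcat C D = four_block_mat (A\<^sup>T * C) (A\<^sup>T * D)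
    (B\<^sup>T * C) (B\<^sup>T * D)"
proof (rule mat_entryI)
  fix i j assume "i < dim_row (four_block_mat (A\<^sup>T * C) (A\<^sup>T * D) (B\<^sup>T * C) (B\<^sup>T * D))"
     "j < dim_col (four_block_mat (A\<^sup>T * C) (A\<^sup>T * D) (B\<^sup>T * C) (B\<^sup>T * D))"
  hence ij: "i < dim_col A + dim_col B" "j < dim_col C + dim_col D" by auto
  have c: "col (hcat C D) j = (if j < dim_col C then col C j else col D (j - dim_col C))"
     "col (hcat A B) i = (if i < dim_col A then col A i else col B (i - dim_col A))"
    using ij assms by (auto simp: hcat_def intro!: eq_vecI)
  show "((hcat A B)\<^sup>T * hcat C D) $$ (i, j) = four_block_mat (A\<^sup>T * C) (A\<^sup>T * D)
    (B\<^sup>T * C) (B\<^sup>T * D) $$ (i, j)"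
    using ij assms by (auto simp: c)
qed auto

lemma hcat_mult_four_block:
  assumes "dim_row A = r" "dim_row B = r" "dim_col A = k" "dim_col B = k"
    "dim_row a = k" "dim_col a = k" "dim_row b = k" "dim_col b = k" "dim_row c = k" "dim_col c = k"
    "dim_row d = k" "dim_col d = k"
  shows "hcat A B * four_block_mat a b c d = hcat (A * a + B * c) (A * b + B * d)"
proof -
  have e: "hcat X Y = four_block_mat X Y (0\<^sub>m 0 k) (0\<^sub>m 0 k)"
    if "dim_row X = r" "dim_row Y = r" "dim_col X = k" "dim_col Y = k" for X Y
    using that by (auto simp: hcat_def intro!: mat_entryI)
  have "hcat A B * four_block_mat a b c d = four_block_mat (A * a + B * c) (A * b + B * d)
     (0\<^sub>m 0 k * a + 0\<^sub>m 0 k * c) (0\<^sub>m 0 k * b + 0\<^sub>m 0 k * d)"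
    unfolding e[OF assms(1-4)] by (rule mult_four_block_mat) (use assms in \<open>auto intro!: carrier_matI\<close>)
  also have "\<dots> = hcat (A * a + B * c) (A * b + B * d)"
    using assms by (simp add: e)
  finally show ?thesis .
qed

text \<open>Polarisation: a symmetric form that vanishes on the unit vectors and on their pairwise sums is zero.\<close>

lemma exists_nonisotropic:
  fixes A :: "real mat"
  assumes A: "dim_row A = n" "dim_col A = n" "A\<^sup>T = A" "A \<noteq> 0\<^sub>m n n"
  obtains v where "dim_row v = n" "dim_col v = 1" "(v\<^sup>T * (A * v)) $$ (0, 0) \<noteq> 0"
proof -
  have sym: "A $$ (i, j) = A $$ (j, i)" if "i < n" "j < n" for i j
  proof -
    have "A $$ (i, j) = A\<^sup>T $$ (i, j)" by (simp only: A(3))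
    thus ?thesis using that A(1,2) by simp
  qed
  have "\<exists>i j. i < n \<and> j < n \<and> A $$ (i, j) \<noteq> 0"
  proof (rule ccontr)
    assume "\<not> ?thesis"
    hence "A = 0\<^sub>m n n" using A by (intro mat_entryI) auto
    thus False using A(4) by simp
  qed
  then obtain i j where ij: "i < n" "j < n" "A $$ (i, j) \<noteq> 0" by blast
  let ?e = "\<lambda>i. coord_incl n 1 (\<lambda>_. i)"
  have e: "((?e a)\<^sup>T * (A * ?e b)) $$ (0, 0) = A $$ (a, b)" if "a < n" "b < n" for a b
    using that A by (simp add: transpose_coord_incl_mult mult_coord_incl del: index_mult_mat(1))
  show ?thesis
  proof (cases "A $$ (i, i) = 0 \<and> A $$ (j, j) = 0")
    case False
    thus ?thesis using that[of "?e i"] that[of "?e j"] ij e[of i i] e[of j j] by auto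
  next
    case True
    have "(?e i + ?e j)\<^sup>T * (A * (?e i + ?e j)) =
      ((?e i)\<^sup>T * (A * ?e i) + (?e j)\<^sup>T * (A * ?e i)) +
      ((?e i)\<^sup>T * (A * ?e j) + (?e j)\<^sup>T * (A * ?e j))"
      using A(1,2) by (simp add: mat_ring)
    hence "((?e i + ?e j)\<^sup>T * (A * (?e i + ?e j))) $$ (0, 0) = 2 * A $$ (i, j)"
      using True ij sym[of i j] A(1,2) by (simp add: e del: index_mult_mat(1) One_nat_def)
    thus ?thesis using that[of "?e i + ?e j"] ij by simp
  qed
qed

text \<open>The matrices \<open>A j\<close> are the symmetric forms \<open>\<omega>(u, K T\<^sup>j v)\<close>, abstracted to the properties that matter: \<open>T\<close> is
  self-adjoint for each of them and shifts the index. Replacing \<open>v\<close> by \<open>v + a T\<^sup>r v\<close> leaves the values with index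
  above \<open>k - 1 - r\<close> alone and moves the value at \<open>k - 1 - r\<close> by \<open>2 a\<close> times the top value, so the values
  are cleared in the order of decreasing index.\<close>

lemma cyclic_generator:
  fixes A :: "nat \<Rightarrow> real mat"
  assumes T: "dim_row T = n" "dim_col T = n"
    and A: "\<And>j. dim_row (A j) = n" "\<And>j. dim_col (A j) = n" "\<And>j. (A j)\<^sup>T = A j"
    and AT: "\<And>i j. A j * T ^\<^sub>m i = A (j + i)" "\<And>i j. (T ^\<^sub>m i)\<^sup>T * A j = A (j + i)"
    and zero: "\<And>j. k \<le> j \<Longrightarrow> A j = 0\<^sub>m n n" and nz: "A (k - 1) \<noteq> 0\<^sub>m n n" and k: "k \<ge> 1"
  obtains s v where "s \<in> {-1, 1::real}" "dim_row v = n" "dim_col v = 1"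
    "\<And>j. (v\<^sup>T * (A j * v)) $$ (0, 0) = (if j + 1 = k then s / sqrt 2 else 0)"
proof -
  define q where "q j v = (v\<^sup>T * (A j * v)) $$ (0, 0)" for j v
  have qz: "q j v = 0" if "k \<le> j" "dim_row v = n" "dim_col v = 1" for j v
    using that zero[OF that(1)] by (simp add: q_def del: index_mult_mat(1))
  have q_smult: "q j (c \<cdot>\<^sub>m v) = c * c * q j v" if "dim_row v = n" "dim_col v = 1" for j c v
    using that A by (simp add: q_def mat_ring del: index_mult_mat(1))
  have q_shift: "q j (v + a \<cdot>\<^sub>m (T ^\<^sub>m r * v)) = q j v + 2 * a * q (j + r) v + a * a * q (j + 2 * r) v"
    if v: "dim_row v = n" "dim_col v = 1" for j a r v
  proof -
    let ?w = "T ^\<^sub>m r * v"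
    have Tr: "dim_row (T ^\<^sub>m r) = n" "dim_col (T ^\<^sub>m r) = n" using T by auto
    have 1: "v\<^sup>T * (A j * ?w) = v\<^sup>T * (A (j + r) * v)"
      unfolding AT(1)[of j r, symmetric] using v A Tr by (simp add: mat_mult_assoc)
    have 2: "?w\<^sup>T * (A j * v) = v\<^sup>T * (A (j + r) * v)"
      unfolding AT(2)[of r j, symmetric] using v A Tr by (simp add: mat_ring)
    have 3: "?w\<^sup>T * (A j * ?w) = v\<^sup>T * (A (j + 2 * r) * v)"
    proof -
      have "?w\<^sup>T * (A j * ?w) = v\<^sup>T * (((T ^\<^sub>m r)\<^sup>T * (A j * T ^\<^sub>m r)) * v)"
        using v A Tr by (simp add: mat_ring)
      also have "(T ^\<^sub>m r)\<^sup>T * (A j * T ^\<^sub>m r) = A (j + 2 * r)"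
        unfolding AT by (simp add: mult_2 add.assoc)
      finally show ?thesis .
    qed
    have "(v + a \<cdot>\<^sub>m ?w)\<^sup>T * (A j * (v + a \<cdot>\<^sub>m ?w)) =
       (v\<^sup>T * (A j * v) + a \<cdot>\<^sub>m (?w\<^sup>T * (A j * v))) +
       (a \<cdot>\<^sub>m (v\<^sup>T * (A j * ?w)) + (a * a) \<cdot>\<^sub>m (?w\<^sup>T * (A j * ?w)))"
      using v A Tr by (simp add: mat_ring)
    thus ?thesis unfolding q_def 1 2 3 using v A by (simp del: index_mult_mat(1))
  qed
  obtain v0 where v0: "dim_row v0 = n" "dim_col v0 = 1" "q (k - 1) v0 \<noteq> 0"
    using exists_nonisotropic[OF A(1-3) nz] unfolding q_def by blast
  define s where "s = sgn (q (k - 1) v0)"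
  have s: "s \<in> {-1, 1}" using v0(3) by (auto simp: s_def sgn_if)
  have "\<exists>v. dim_row v = n \<and> dim_col v = 1 \<and> q (k - 1) v = s / sqrt 2 \<and> (\<forall>j. k - 1 - r \<le> j \<and> j < k - 1 \<longrightarrow> q j v = 0)" if "r \<le> k - 1" for r
    using that
  proof (induction r)
    case 0
    \<comment> \<open>scaling by \<open>c\<close> multiplies the form by \<open>c\<^sup>2\<close>, so only the sign of the top value survives\<close>
    define c where "c = 1 / sqrt (sqrt 2 * \<bar>q (k - 1) v0\<bar>)"
    have "c * c = 1 / (sqrt 2 * \<bar>q (k - 1) v0\<bar>)" by (simp add: c_def)
    hence "q (k - 1) (c \<cdot>\<^sub>m v0) = s / sqrt 2" using v0 by (simp add: q_smult s_def sgn_if)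
    thus ?case using v0 by (intro exI[of _ "c \<cdot>\<^sub>m v0"]) auto
  next
    case (Suc r)
    then obtain v where v: "dim_row v = n" "dim_col v = 1" "q (k - 1) v = s / sqrt 2"
      "\<And>j. k - 1 - r \<le> j \<Longrightarrow> j < k - 1 \<Longrightarrow> q j v = 0" by auto
    define i where "i = k - 1 - Suc r"
    have i: "i + Suc r = k - 1" using Suc.prems by (simp add: i_def)
    \<comment> \<open>chosen so that the linear term cancels the value at \<open>i\<close>; the quadratic term has index at least \<open>k\<close>\<close>
    define a where "a = - q i v / (2 * (s / sqrt 2))"
    let ?v = "v + a \<cdot>\<^sub>m (T ^\<^sub>m Suc r * v)"
    have d: "dim_row ?v = n" "dim_col ?v = 1" using v T by auto
    have top: "q (k - 1) ?v = s / sqrt 2" unfolding q_shift[OF v(1,2)] using v k by (simp add: qz)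
    have "q j ?v = 0" if j: "k - 1 - Suc r \<le> j" "j < k - 1" for j
    proof (cases "j = i")
      case True
      have "q (i + 2 * Suc r) v = 0" using i v by (intro qz) auto
      moreover have "2 * a * (s / sqrt 2) = - q i v" using s by (auto simp: a_def field_simps)
      ultimately show ?thesis unfolding True q_shift[OF v(1,2)] i v(3) by simp
    next
      case False
      hence "k - 1 - r \<le> j" "k \<le> j + Suc r" using j i by auto
      thus ?thesis unfolding q_shift[OF v(1,2)] using v j by (simp add: qz)
    qed
    thus ?case using d top by blast
  qed
  from this[of "k - 1"] obtain v where v: "dim_row v = n" "dim_col v = 1" "q (k - 1) v = s / sqrt 2"
    "\<And>j. j < k - 1 \<Longrightarrow> q j v = 0" by auto
  have "q j v = (if j + 1 = k then s / sqrt 2 else 0)" for j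
  proof -
    consider "j < k - 1" | "j = k - 1" | "k \<le> j" by linarith
    thus ?thesis using v k qz[of j v] by cases auto
  qed
  thus ?thesis using that[OF s v(1,2)] by (simp add: q_def)
qed

text \<open>The columns of \<open>L\<close> are \<open>v, T v, \<dots>\<close>; they span one isotropic half. The other half consists of the
  vectors \<open>K T\<^sup>j v\<close> in reversed order, scaled so as to be dual to the first half.\<close>

lemma krylov_embedding:
  assumes X: "X \<in> symplectic_group n"
    and T: "T = (1 / sqrt 2) \<cdot>\<^sub>m (X + symp_inv n X)"
    and nil: "T ^\<^sub>m k = 0\<^sub>m (2 * n) (2 * n)" "T ^\<^sub>m (k - 1) \<noteq> 0\<^sub>m (2 * n) (2 * n)" "k \<ge> 1"
  obtains s V where "s \<in> {-1, 1}" "dim_row V = 2 * n" "dim_col V = 2 * k" "V\<^sup>T * (J n * V) = J k"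
    "X * V = V * cyclic_root k s"
proof -
  note Xd = symplectic_groupD[OF X]
  let ?N = "2 * n"
  define Xi where "Xi = symp_inv n X"
  define K where "K = (1 / 2) \<cdot>\<^sub>m (X - Xi)"
  have Xid: "dim_row Xi = ?N" "dim_col Xi = ?N" by (auto simp: Xi_def)
  have inv: "Xi * X = 1\<^sub>m ?N" "X * Xi = 1\<^sub>m ?N"
    using symp_inv_left[OF X] symp_inv_right[OF X] by (simp_all add: Xi_def)
  have Td [simp]: "dim_row T = ?N" "dim_col T = ?N" and Kd [simp]: "dim_row K = ?N" "dim_col K = ?N"
    using Xd Xid by (auto simp: T K_def Xi_def)
  have adj: "X\<^sup>T * J n = J n * Xi" "Xi\<^sup>T * J n = J n * X"
  proof -
    show "X\<^sup>T * J n = J n * Xi" using Xd(1,2) by (simp add: Xi_def symp_inv_def mat_mult_assoc)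
    have "Xi\<^sup>T * (J n * Xi) = J n"
      using symplectic_groupD(4)[OF symplectic_symp_inv[OF X]] by (simp add: Xi_def)
    hence "(Xi\<^sup>T * (J n * Xi)) * X = J n * X" by simp
    thus "Xi\<^sup>T * J n = J n * X" using Xd(1,2) Xid by (simp add: mat_mult_assoc inv)
  qed
  have TJ: "T\<^sup>T * J n = J n * T"
    using Xd(1,2) Xid by (simp add: T Xi_def[symmetric] mat_ring adj) (auto intro!: mat_entryI simp del: index_mult_mat(1))
  have KJ: "K\<^sup>T * J n = - (J n * K)"
    using Xd(1,2) Xid by (simp add: K_def mat_ring adj) (auto intro!: mat_entryI simp del: index_mult_mat(1))
  have KT: "K * T = T * K"
    using Xd(1,2) Xid by (simp add: K_def T Xi_def[symmetric] mat_ring inv) (auto intro!: mat_entryI simp del: index_mult_mat(1))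
  have KK: "K * K = (1 / 2) \<cdot>\<^sub>m (T * T) - 1\<^sub>m ?N"
    using Xd(1,2) Xid by (simp add: K_def T Xi_def[symmetric] mat_ring inv) (auto intro!: mat_entryI simp del: index_mult_mat(1))
  have XTK: "X = (1 / sqrt 2) \<cdot>\<^sub>m T + K"
    using Xd(1,2) Xid by (simp add: K_def T Xi_def[symmetric] mat_ring) (auto intro!: mat_entryI simp: field_simps)
  have Tp [simp]: "dim_row (T ^\<^sub>m j) = ?N" "dim_col (T ^\<^sub>m j) = ?N" for j by simp_all
  have TpT: "T * T ^\<^sub>m j = T ^\<^sub>m Suc j" for j using mat_pow_Suc_left[OF Td] .
  have TJp: "(T ^\<^sub>m j)\<^sup>T * J n = J n * T ^\<^sub>m j" for j
  proof (induction j)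
    case (Suc j)
    have "(T ^\<^sub>m Suc j)\<^sup>T * J n = T\<^sup>T * ((T ^\<^sub>m j)\<^sup>T * J n)" by (simp add: mat_ring)
    also have "\<dots> = (T\<^sup>T * J n) * T ^\<^sub>m j" unfolding Suc by (simp add: mat_mult_assoc)
    also have "\<dots> = J n * (T * T ^\<^sub>m j)" unfolding TJ by (simp add: mat_mult_assoc)
    finally show ?case unfolding TpT .
  qed simp
  have KTp: "K * T ^\<^sub>m j = T ^\<^sub>m j * K" for j
  proof (induction j)
    case (Suc j)
    have "K * T ^\<^sub>m Suc j = (K * T ^\<^sub>m j) * T" by (simp add: mat_mult_assoc)
    also have "\<dots> = T ^\<^sub>m j * (K * T)" unfolding Suc by (simp add: mat_mult_assoc)
    also have "\<dots> = T ^\<^sub>m Suc j * K" unfolding KT by (simp add: mat_mult_assoc)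
    finally show ?case .
  qed simp
  define A where "A j = J n * (K * T ^\<^sub>m j)" for j
  have Ad: "dim_row (A j) = ?N" "dim_col (A j) = ?N" for j by (simp_all add: A_def)
  have At: "(A j)\<^sup>T = A j" for j
  proof -
    have "(A j)\<^sup>T = - ((T ^\<^sub>m j)\<^sup>T * (K\<^sup>T * J n))"
      by (simp add: A_def mat_ring J_transpose)
    also have "\<dots> = ((T ^\<^sub>m j)\<^sup>T * J n) * K" unfolding KJ by (simp add: mat_mult_assoc)
    also have "\<dots> = A j" unfolding TJp A_def KTp by (simp add: mat_mult_assoc)
    finally show ?thesis .
  qed
  have AT: "A j * T ^\<^sub>m i = A (j + i)" for i j
    by (simp add: A_def mat_mult_assoc mat_pow_add[OF Td])
  have AT': "(T ^\<^sub>m i)\<^sup>T * A j = A (j + i)" for i j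
  proof -
    have "(T ^\<^sub>m i)\<^sup>T * A j = (A j * T ^\<^sub>m i)\<^sup>T" using Ad At by (simp add: mat_transpose_mult)
    thus ?thesis unfolding AT At .
  qed
  have Tz: "T ^\<^sub>m j = 0\<^sub>m ?N ?N" if "k \<le> j" for j using mat_pow_eq_0_mono[OF Td nil(1) that] .
  have Az: "A j = 0\<^sub>m ?N ?N" if "k \<le> j" for j unfolding A_def Tz[OF that] by simp
  \<comment> \<open>\<open>K\<close> is invertible modulo \<open>T\<close>, since \<open>K\<^sup>2 = T\<^sup>2 / 2 - 1\<close>\<close>
  have Anz: "A (k - 1) \<noteq> 0\<^sub>m ?N ?N"
  proof
    assume "A (k - 1) = 0\<^sub>m ?N ?N"
    hence "- (K * (J n * A (k - 1))) = 0\<^sub>m ?N ?N" by (auto intro!: mat_entryI)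
    hence "K * (K * T ^\<^sub>m (k - 1)) = 0\<^sub>m ?N ?N" by (simp add: A_def)
    moreover have "K * (K * T ^\<^sub>m (k - 1)) = - (T ^\<^sub>m (k - 1))"
    proof -
      have "K * (K * T ^\<^sub>m (k - 1)) = (K * K) * T ^\<^sub>m (k - 1)" by (simp add: mat_mult_assoc)
      also have "\<dots> = (1 / 2) \<cdot>\<^sub>m (T * (T * T ^\<^sub>m (k - 1))) - (T ^\<^sub>m (k - 1))" unfolding KK by (simp add: mat_ring)
      also have "T * (T * T ^\<^sub>m (k - 1)) = 0\<^sub>m ?N ?N" unfolding TpT by (rule Tz) simp
      also have "(1 / 2) \<cdot>\<^sub>m 0\<^sub>m ?N ?N - T ^\<^sub>m (k - 1) = - (T ^\<^sub>m (k - 1))"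
        by (rule mat_entryI) (simp_all add: Tp del: pow_mat_dim)
      finally show ?thesis .
    qed
    ultimately have "- (- (T ^\<^sub>m (k - 1))) = - 0\<^sub>m ?N ?N" by simp
    hence "T ^\<^sub>m (k - 1) = - 0\<^sub>m ?N ?N" by simp
    also have "\<dots> = 0\<^sub>m ?N ?N" by (auto intro!: mat_entryI)
    finally show False using nil(2) by simp
  qed
  obtain s v where s: "s \<in> {-1, 1}" and v: "dim_row v = ?N" "dim_col v = 1"
    and q: "\<And>j. (v\<^sup>T * (A j * v)) $$ (0, 0) = (if j + 1 = k then s / sqrt 2 else 0)"
    using cyclic_generator[of T ?N A k, OF Td Ad At AT AT' Az Anz nil(3)] by blast
  define L where "L = mat ?N k (\<lambda>(r, j). (T ^\<^sub>m j * v) $$ (r, 0))"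
  have Ld [simp]: "dim_row L = ?N" "dim_col L = k" by (auto simp: L_def)
  have colL: "col L j = col (T ^\<^sub>m j * v) 0" if "j < k" for j
    using that v by (auto simp: L_def intro!: eq_vecI)
  have ZL: "(Z * L) $$ (i, j) = (Z * (T ^\<^sub>m j * v)) $$ (i, 0)" if "i < dim_row Z" "j < k" for Z i j
    using that v by (simp add: colL)
  have LZ: "(L\<^sup>T * Z) $$ (i, j) = ((T ^\<^sub>m i * v)\<^sup>T * Z) $$ (0, j)"
    if "j < dim_col Z" "i < k" for Z i j
    using that v by (simp add: colL)
  have TL: "T * L = L * (S k)\<^sup>T"
  proof (rule mat_entryI)
    fix i j assume "i < dim_row (L * (S k)\<^sup>T)" "j < dim_col (L * (S k)\<^sup>T)"
    hence ij: "i < ?N" "j < k" by auto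
    have "T * (T ^\<^sub>m j * v) = (T * T ^\<^sub>m j) * v" using v by (simp add: mat_mult_assoc)
    hence l: "(T * L) $$ (i, j) = (T ^\<^sub>m Suc j * v) $$ (i, 0)" unfolding TpT using ij by (simp add: ZL del: index_mult_mat(1))
    have "(L * (S k)\<^sup>T) $$ (i, j) = (\<Sum>a<k. L $$ (i, a) * S k $$ (j, a))"
      using ij by (auto simp: scalar_prod_def atLeast0LessThan intro!: sum.cong)
    also have "\<dots> = (\<Sum>a<k. if a = Suc j then L $$ (i, a) else 0)"
      using ij by (intro sum.cong) auto
    also have "\<dots> = (if Suc j < k then L $$ (i, Suc j) else 0)" by simp
    also have "\<dots> = (T ^\<^sub>m Suc j * v) $$ (i, 0)"
    proof (cases "Suc j < k")
      case False
      hence "T ^\<^sub>m Suc j = 0\<^sub>m ?N ?N" using ij by (intro Tz) auto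
      thus ?thesis using False ij v by (simp del: index_mult_mat(1) pow_mat.simps)
    qed (use ij in \<open>simp add: L_def del: index_mult_mat(1)\<close>)
    finally show "(T * L) $$ (i, j) = (L * (S k)\<^sup>T) $$ (i, j)" using l by simp
  qed auto
  have gram: "(L\<^sup>T * (Z * L)) $$ (i, j) = (v\<^sup>T * ((T ^\<^sub>m i)\<^sup>T * (Z * T ^\<^sub>m j) * v)) $$ (0, 0)"
    if "dim_row Z = ?N" "dim_col Z = ?N" "i < k" "j < k" for Z i j
  proof -
    have "(L\<^sup>T * (Z * L)) $$ (i, j) = (((T ^\<^sub>m i * v)\<^sup>T * Z) * L) $$ (0, j)"
      using that v by (subst LZ) (simp_all add: mat_mult_assoc del: index_mult_mat(1))
    also have "\<dots> = (((T ^\<^sub>m i * v)\<^sup>T * Z) * (T ^\<^sub>m j * v)) $$ (0, 0)"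
      using that v by (subst ZL) (simp_all del: index_mult_mat(1))
    also have "((T ^\<^sub>m i * v)\<^sup>T * Z) * (T ^\<^sub>m j * v) = v\<^sup>T * ((T ^\<^sub>m i)\<^sup>T * (Z * T ^\<^sub>m j) * v)"
      using that v by (simp add: mat_ring)
    finally show ?thesis .
  qed
  have LJL: "L\<^sup>T * (J n * L) = 0\<^sub>m k k"
  proof (rule mat_entryI)
    fix i j assume "i < dim_row (0\<^sub>m k k :: real mat)" "j < dim_col (0\<^sub>m k k :: real mat)"
    hence ij: "i < k" "j < k" by auto
    define Z where "Z = J n * T ^\<^sub>m (i + j)"
    have Zd: "dim_row Z = ?N" "dim_col Z = ?N" by (auto simp: Z_def)
    \<comment> \<open>a skew-symmetric form vanishes on the diagonal\<close>
    have Zt: "Z\<^sup>T = - Z" using TJp[of "i + j"] by (simp add: Z_def mat_transpose_mult J_transpose)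
    have "(T ^\<^sub>m i)\<^sup>T * (J n * T ^\<^sub>m j) = ((T ^\<^sub>m i)\<^sup>T * J n) * T ^\<^sub>m j" by (simp add: mat_mult_assoc)
    also have "\<dots> = Z" unfolding TJp Z_def by (simp add: mat_mult_assoc mat_pow_add[OF Td])
    finally have l: "(L\<^sup>T * (J n * L)) $$ (i, j) = (v\<^sup>T * (Z * v)) $$ (0, 0)"
      using gram[of "J n" i j] ij by simp
    have "v\<^sup>T * (Z * v) = (v\<^sup>T * (Z\<^sup>T * v))\<^sup>T"
      using v Zd by (simp add: mat_ring)
    also have "\<dots> = - (v\<^sup>T * (Z * v))\<^sup>T" unfolding Zt using v Zd by (simp add: mat_ring)
    finally have "(v\<^sup>T * (Z * v)) $$ (0, 0) = (- (v\<^sup>T * (Z * v))\<^sup>T) $$ (0, 0)" by simp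
    also have "\<dots> = - (v\<^sup>T * (Z * v)) $$ (0, 0)" using v by (simp del: index_mult_mat(1))
    finally show "(L\<^sup>T * (J n * L)) $$ (i, j) = 0\<^sub>m k k $$ (i, j)" using l ij by simp
  qed auto
  have LJKL: "L\<^sup>T * (J n * (K * L)) = (s / sqrt 2) \<cdot>\<^sub>m F k"
  proof (rule mat_entryI)
    fix i j assume "i < dim_row ((s / sqrt 2) \<cdot>\<^sub>m F k)" "j < dim_col ((s / sqrt 2) \<cdot>\<^sub>m F k)"
    hence ij: "i < k" "j < k" by auto
    have "J n * K * T ^\<^sub>m j = A j" by (simp add: A_def mat_mult_assoc)
    hence "(L\<^sup>T * ((J n * K) * L)) $$ (i, j) = (v\<^sup>T * (A (j + i) * v)) $$ (0, 0)"
      using gram[of "J n * K" i j] ij by (simp add: AT' del: index_mult_mat(1))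
    also have "\<dots> = (if j + i + 1 = k then s / sqrt 2 else 0)" by (rule q)
    also have "\<dots> = ((s / sqrt 2) \<cdot>\<^sub>m F k) $$ (i, j)" using ij by (simp add: F_index add.commute)
    finally show "(L\<^sup>T * (J n * (K * L))) $$ (i, j) = ((s / sqrt 2) \<cdot>\<^sub>m F k) $$ (i, j)"
      by (simp add: mat_mult_assoc)
  qed auto
  have ss: "s * s = 1" using s by auto
  define U where "U = (sqrt 2 * s) \<cdot>\<^sub>m (K * (L * F k))"
  have Ud [simp]: "dim_row U = ?N" "dim_col U = k" by (auto simp: U_def)
  have KKL: "K * (K * L) = (1 / 2) \<cdot>\<^sub>m (L * ((S k)\<^sup>T * (S k)\<^sup>T)) - L"
  proof -
    have "K * (K * L) = (K * K) * L" by (simp add: mat_mult_assoc)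
    also have "\<dots> = (1 / 2) \<cdot>\<^sub>m (T * (T * L)) - L" unfolding KK by (simp add: mat_ring)
    also have "T * (T * L) = T * (L * (S k)\<^sup>T)" by (simp only: TL)
    also have "\<dots> = (T * L) * (S k)\<^sup>T" by (simp add: mat_mult_assoc)
    also have "\<dots> = L * ((S k)\<^sup>T * (S k)\<^sup>T)" unfolding TL by (simp add: mat_mult_assoc)
    finally show ?thesis .
  qed
  have KtJ: "K\<^sup>T * (J n * Z) = - (J n * (K * Z))" if "dim_row Z = ?N" for Z
  proof -
    have "K\<^sup>T * (J n * Z) = (K\<^sup>T * J n) * Z" using that by (simp add: mat_mult_assoc)
    thus ?thesis unfolding KJ using that by (simp add: mat_mult_assoc)
  qed
  have UL: "U\<^sup>T * (J n * L) = - 1\<^sub>m k"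
  proof -
    have "U\<^sup>T * (J n * L) = (sqrt 2 * s) \<cdot>\<^sub>m (F k * - (L\<^sup>T * (J n * (K * L))))"
      by (simp add: U_def mat_ring KtJ)
    also have "\<dots> = - 1\<^sub>m k" unfolding LJKL using ss by (simp add: mat_ring F_square mat_smult_uminus)
       (auto intro!: mat_entryI)
    finally show ?thesis .
  qed
  have LU: "L\<^sup>T * (J n * U) = 1\<^sub>m k"
  proof -
    have "L\<^sup>T * (J n * U) = (sqrt 2 * s) \<cdot>\<^sub>m ((L\<^sup>T * (J n * (K * L))) * F k)"
      by (simp add: U_def mat_ring)
    also have "\<dots> = 1\<^sub>m k" unfolding LJKL using ss by (simp add: mat_ring F_square)
    finally show ?thesis .
  qed
  have UU: "U\<^sup>T * (J n * U) = 0\<^sub>m k k"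
  proof -
    have a: "L\<^sup>T * (J n * (K * (K * L))) = 0\<^sub>m k k"
    proof -
      have "L\<^sup>T * (J n * (K * (K * L))) = (1 / 2) \<cdot>\<^sub>m ((L\<^sup>T * (J n * L)) * ((S k)\<^sup>T * (S k)\<^sup>T)) - L\<^sup>T * (J n * L)"
        unfolding KKL by (simp add: mat_ring)
      also have "\<dots> = 0\<^sub>m k k" unfolding LJL by (auto intro!: mat_entryI simp del: index_mult_mat(1))
      finally show ?thesis .
    qed
    have "U\<^sup>T * (J n * U) = (sqrt 2 * s * (sqrt 2 * s)) \<cdot>\<^sub>m (F k * - ((L\<^sup>T * (J n * (K * (K * L)))) * F k))"
      by (simp add: U_def mat_ring KtJ)
    also have "\<dots> = 0\<^sub>m k k" unfolding a by (auto intro!: mat_entryI simp del: index_mult_mat(1))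
    finally show ?thesis .
  qed
  let ?a = "(1 / sqrt 2) \<cdot>\<^sub>m S k"
  let ?c = "(sqrt 2 * s) \<cdot>\<^sub>m (F k * (?a * ?a - 1\<^sub>m k))"
  have XL: "X * L = U * ((s / sqrt 2) \<cdot>\<^sub>m F k) + L * ?a\<^sup>T"
  proof -
    have "X * L = (1 / sqrt 2) \<cdot>\<^sub>m (T * L) + K * L" by (subst XTK) (simp add: mat_ring)
    also have "K * L = U * ((s / sqrt 2) \<cdot>\<^sub>m F k)" using ss by (simp add: U_def mat_ring F_square)
    finally show ?thesis unfolding TL by (auto intro!: mat_entryI simp: mat_ring simp del: index_mult_mat(1))
  qed
  have FSt: "(S k)\<^sup>T * (F k * Z) = F k * (S k * Z)" if "dim_row Z = k" for Z
  proof -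
    have "F k * ((S k * F k) * F k) = F k * ((F k * (S k)\<^sup>T) * F k)" by (simp only: jordan_block_F)
    hence "F k * S k = (S k)\<^sup>T * F k" by (simp add: mat_mult_assoc F_square)
    hence "((S k)\<^sup>T * F k) * Z = (F k * S k) * Z" by simp
    thus ?thesis using that by (simp add: mat_mult_assoc)
  qed
  have FSt': "(S k)\<^sup>T * F k = F k * S k" using FSt[of "1\<^sub>m k"] by simp
  have XU: "X * U = U * ?a + L * ?c"
  proof -
    have "X * U = (sqrt 2 * s) \<cdot>\<^sub>m ((1 / sqrt 2) \<cdot>\<^sub>m (T * (K * (L * F k))) + (K * (K * L)) * F k)"
      by (subst XTK) (simp add: U_def mat_ring)
    also have "T * (K * (L * F k)) = K * ((T * L) * F k)"
    proof -
      have "T * (K * (L * F k)) = (T * K) * (L * F k)" by (simp add: mat_mult_assoc)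
      thus ?thesis unfolding KT[symmetric] by (simp add: mat_mult_assoc)
    qed
    finally show ?thesis unfolding TL KKL
      by (simp add: U_def mat_ring FSt FSt')
  qed
  show ?thesis
  proof (rule that[OF s])
    show "dim_row (hcat U L) = 2 * n" "dim_col (hcat U L) = 2 * k" by simp_all
    have "J n * hcat U L = hcat (J n * U) (J n * L)" by (rule mult_hcat) simp_all
    thus "(hcat U L)\<^sup>T * (J n * hcat U L) = J k"
      by (simp add: hcat_transpose_mult UU UL LU LJL symplectic_form_mat_def[of k])
    show "X * hcat U L = hcat U L * cyclic_root k s"
      unfolding cyclic_root_def wonenburger_mat_def
      by (subst hcat_mult_four_block[where r = ?N and k = k]) (simp_all add: mult_hcat Xd XL XU)
  qed
qed

section \<open>Splitting off a cyclic root\<close>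

lemma symplectic_pow: "M \<in> symplectic_group n \<Longrightarrow> M ^\<^sub>m j \<in> symplectic_group n"
  by (induction j) (auto intro: symplectic_mult simp: symplectic_groupD(1) one_symplectic)

lemma mult_symplectic_eq_0:
  assumes "M \<in> symplectic_group n" "dim_row A = r" "dim_col A = 2 * n" "A * M = 0\<^sub>m r (2 * n)"
  shows "A = 0\<^sub>m r (2 * n)"
proof -
  have "A = (A * M) * symp_inv n M"
    using assms(1-3) symplectic_groupD(1,2)[OF assms(1)] by (simp add: mat_mult_assoc symp_inv_right)
  also have "\<dots> = 0\<^sub>m r (2 * n)" unfolding assms(4) by simp
  finally show ?thesis .
qed

lemma symplectic_mult_eq_0:
  assumes "M \<in> symplectic_group n" "dim_row A = 2 * n" "dim_col A = r" "M * A = 0\<^sub>m (2 * n) r"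
  shows "A = 0\<^sub>m (2 * n) r"
proof -
  have "A = symp_inv n M * (M * A)" using assms(1,2) by (simp add: symp_inv_left_mult)
  also have "\<dots> = 0\<^sub>m (2 * n) r" unfolding assms(4) by simp
  finally show ?thesis .
qed

text \<open>By \<open>X\<^sup>2 + 1 = (X + X\<^sup>-\<^sup>1) X\<close> with commuting factors, of which the second is invertible.\<close>

lemma root_trace_pow_eq_0_iff:
  assumes X: "X \<in> symplectic_group n"
  shows "((1 / sqrt 2) \<cdot>\<^sub>m (X + symp_inv n X)) ^\<^sub>m j = 0\<^sub>m (2 * n) (2 * n)
     \<longleftrightarrow> (X * X + 1\<^sub>m (2 * n)) ^\<^sub>m j = 0\<^sub>m (2 * n) (2 * n)"
proof -
  note Xd = symplectic_groupD(1,2)[OF X]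
  let ?N = "2 * n" and ?Y = "X + symp_inv n X"
  have c: "?Y * X = X * X + 1\<^sub>m ?N" "X * ?Y = X * X + 1\<^sub>m ?N"
    using Xd by (simp_all add: mat_ring symp_inv_left[OF X] symp_inv_right[OF X])
  have "(X * X + 1\<^sub>m ?N) ^\<^sub>m j = ?Y ^\<^sub>m j * X ^\<^sub>m j"
    unfolding c(1)[symmetric] by (rule mat_pow_mult_commuting[where n = ?N]) (use Xd c in simp_all)
  moreover have "(?Y ^\<^sub>m j * X ^\<^sub>m j = 0\<^sub>m ?N ?N) \<longleftrightarrow> ?Y ^\<^sub>m j = 0\<^sub>m ?N ?N"
    using mult_symplectic_eq_0[OF symplectic_pow[OF X, of j], of "?Y ^\<^sub>m j" ?N] Xd by auto
  moreover have "((1 / sqrt 2) \<cdot>\<^sub>m ?Y) ^\<^sub>m j = 0\<^sub>m ?N ?N \<longleftrightarrow> ?Y ^\<^sub>m j = 0\<^sub>m ?N ?N"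
  proof -
    have e: "((1 / sqrt 2) \<cdot>\<^sub>m ?Y) ^\<^sub>m j = (1 / sqrt 2) ^ j \<cdot>\<^sub>m ?Y ^\<^sub>m j"
      by (rule mat_pow_smult[where n = ?N]) (use Xd in auto)
    have "?Y ^\<^sub>m j = sqrt 2 ^ j \<cdot>\<^sub>m ((1 / sqrt 2) ^ j \<cdot>\<^sub>m ?Y ^\<^sub>m j)"
      by (simp add: mat_smult_smult power_mult_distrib[symmetric])
    thus ?thesis unfolding e by (metis smult_zero_mat)
  qed
  ultimately show ?thesis by simp
qed

lemma krylov_embedding_of_square:
  assumes X: "X \<in> symplectic_group n"
    and nil: "(X * X + 1\<^sub>m (2 * n)) ^\<^sub>m k = 0\<^sub>m (2 * n) (2 * n)"
      "(X * X + 1\<^sub>m (2 * n)) ^\<^sub>m (k - 1) \<noteq> 0\<^sub>m (2 * n) (2 * n)" "k \<ge> 1"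
  obtains s V where "s \<in> {-1, 1}" "dim_row V = 2 * n" "dim_col V = 2 * k" "V\<^sup>T * (J n * V) = J k"
    "X * V = V * cyclic_root k s"
  using krylov_embedding[OF X refl, of k] nil unfolding root_trace_pow_eq_0_iff[OF X] by blast

text \<open>The summand is the Krylov space for \<open>k\<close> the nilpotency index of \<open>X\<^sup>2 + 1\<close>.\<close>

lemma cyclic_root_splits_off:
  assumes X: "X \<in> symplectic_group n" and nil: "(X * X + 1\<^sub>m (2 * n)) ^\<^sub>m N = 0\<^sub>m (2 * n) (2 * n)" and n: "n \<ge> 1"
  obtains s k n' X' where "s \<in> {-1, 1}" "k \<ge> 1" "n = k + n'" "X' \<in> symplectic_group n'"
    "symp_conj n X (cyclic_root k s \<diamondop> X')"
proof -
  let ?A = "X * X + 1\<^sub>m (2 * n)"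
  define k where "k = (LEAST k. ?A ^\<^sub>m k = 0\<^sub>m (2 * n) (2 * n))"
  have k: "?A ^\<^sub>m k = 0\<^sub>m (2 * n) (2 * n)" unfolding k_def by (rule LeastI[of _ N]) (rule nil)
  have "k \<noteq> 0"
  proof
    assume "k = 0"
    hence "(1\<^sub>m (2 * n) :: real mat) = 0\<^sub>m (2 * n) (2 * n)" using k symplectic_groupD[OF X] by simp
    hence "(1\<^sub>m (2 * n) :: real mat) $$ (0, 0) = 0\<^sub>m (2 * n) (2 * n) $$ (0, 0)" by simp
    thus False using n by simp
  qed
  moreover have "?A ^\<^sub>m (k - 1) \<noteq> 0\<^sub>m (2 * n) (2 * n)"
    using not_less_Least[of "k - 1" "\<lambda>k. ?A ^\<^sub>m k = 0\<^sub>m (2 * n) (2 * n)"] \<open>k \<noteq> 0\<close> unfolding k_def by simp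
  ultimately obtain s V where V: "s \<in> {-1, 1}" "dim_row V = 2 * n" "dim_col V = 2 * k"
     "V\<^sup>T * (J n * V) = J k" "X * V = V * cyclic_root k s"
    using krylov_embedding_of_square[OF X k] by (metis One_nat_def Suc_leI bot_nat_0.not_eq_extremum)
  obtain n' X' where "n = k + n'" "X' \<in> symplectic_group n'" "symp_conj n X (cyclic_root k s \<diamondop> X')"
    using symplectic_invariant_splitting[OF X V(2-4), of "cyclic_root k s"] V(5) by auto
  moreover have "k \<ge> 1" using \<open>k \<noteq> 0\<close> by simp
  ultimately show ?thesis using that[OF V(1)] by blast
qed

section \<open>The root of a doubled matrix\<close>

text \<open>The root sends \<open>(x, y)\<close> to \<open>(M y, x)\<close>.\<close>

lemma symplectic_root_of_double:
  assumes M: "M \<in> symplectic_group m"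
  obtains X where "X \<in> symplectic_group (m + m)" "X * X = M \<diamondop> M"
proof -
  note Md = symplectic_groupD[OF M]
  let ?L = "incl_left m m" and ?R = "incl_right m m"
  define X where "X = juxt m m ?R (?L * M)"
  have Xd: "dim_row X = 2 * (m + m)" "dim_col X = 2 * (m + m)" by (simp_all add: X_def)
  have "X\<^sup>T * (J (m + m) * X) = J (m + m)"
    unfolding X_def
  proof (rule juxt_gram[where r = "2 * (m + m)"])
    show "(?L * M)\<^sup>T * (J (m + m) * (?L * M)) = J m"
      using gram_mult[of ?L "2 * (m + m)" ?L "J (m + m)" M M] Md by (simp add: incl_gram)
    show "?R\<^sup>T * (J (m + m) * (?L * M)) = 0\<^sub>m (2 * m) (2 * m)"
      using gram_mult[of ?R "2 * (m + m)" ?L "J (m + m)" "1\<^sub>m (2 * m)" M] Md by (simp add: incl_gram)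
    show "(?L * M)\<^sup>T * (J (m + m) * ?R) = 0\<^sub>m (2 * m) (2 * m)"
      using gram_mult[of ?L "2 * (m + m)" ?R "J (m + m)" M "1\<^sub>m (2 * m)"] Md by (simp add: incl_gram)
  qed (use Md in \<open>simp_all add: incl_gram\<close>)
  hence X: "X \<in> symplectic_group (m + m)" using Xd by (intro symplectic_groupI) auto
  have XI: "X * ?L = ?R" "X * ?R = ?L * M"
    unfolding X_def using Md by (simp_all add: juxt_mult_incl[where r = "2 * (m + m)"])
  have XX: "X * X * ?L = X * (X * ?L)" "X * X * ?R = X * (X * ?R)" "X * (?L * M) = (X * ?L) * M"
    using Xd Md(1) by (simp_all add: mat_mult_assoc)
  have "X * X = M \<diamondop> M"
    by (rule diamond_unique[OF Md(1,2) Md(1,2), where r = "2 * (m + m)"])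
       (use Xd Md(1,2) in \<open>simp_all add: XX XI diamond_mult_incl\<close>)
  thus ?thesis using that X by blast
qed

lemma diamond_add_one:
  assumes "dim_row M = 2 * m" "dim_col M = 2 * m" "dim_row N = 2 * n" "dim_col N = 2 * n"
  shows "(M \<diamondop> N) + 1\<^sub>m (2 * (m + n)) = (M + 1\<^sub>m (2 * m)) \<diamondop> (N + 1\<^sub>m (2 * n))"
  by (rule diamond_unique[OF assms, where r = "2 * (m + n)"])
     (use assms diamond_mult_incl[of "M + 1\<^sub>m (2 * m)" m "N + 1\<^sub>m (2 * n)" n] in \<open>simp_all add: mat_add_mult mat_mult_add diamond_mult_incl\<close>)

lemma one_diamond_one: "1\<^sub>m (2 * m) \<diamondop> 1\<^sub>m (2 * n) = 1\<^sub>m (2 * (m + n))"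
  by (rule diamond_unique[of "1\<^sub>m (2 * m)" m "1\<^sub>m (2 * n)" n, where r = "2 * (m + n)"])
     (simp_all add: diamond_mult_incl)

lemma diamond_pow:
  assumes "dim_row M = 2 * m" "dim_col M = 2 * m" "dim_row N = 2 * n" "dim_col N = 2 * n"
  shows "(M \<diamondop> N) ^\<^sub>m j = (M ^\<^sub>m j) \<diamondop> (N ^\<^sub>m j)"
  by (induction j) (use assms in \<open>simp_all add: one_diamond_one diamond_mult[of _ m _ n]\<close>)

lemma diamond_eq_0_iff:
  assumes "dim_row M = 2 * m" "dim_col M = 2 * m" "dim_row N = 2 * n" "dim_col N = 2 * n"
  shows "M \<diamondop> N = 0\<^sub>m (2 * (m + n)) (2 * (m + n)) \<longleftrightarrow> M = 0\<^sub>m (2 * m) (2 * m) \<and> N = 0\<^sub>m (2 * n) (2 * n)"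
proof
  assume 0: "M \<diamondop> N = 0\<^sub>m (2 * (m + n)) (2 * (m + n))"
  have "(incl_left m n)\<^sup>T * ((M \<diamondop> N) * incl_left m n) = M"
    "(incl_right m n)\<^sup>T * ((M \<diamondop> N) * incl_right m n) = N"
    using assms unfolding diamond_mult_incl[OF assms]
    by (simp_all add: mat_mult_assoc[symmetric] incl_isometry)
  thus "M = 0\<^sub>m (2 * m) (2 * m) \<and> N = 0\<^sub>m (2 * n) (2 * n)" unfolding 0 by simp
next
  assume *: "M = 0\<^sub>m (2 * m) (2 * m) \<and> N = 0\<^sub>m (2 * n) (2 * n)"
  show "M \<diamondop> N = 0\<^sub>m (2 * (m + n)) (2 * (m + n))"
    by (rule diamond_unique[OF assms, where r = "2 * (m + n)"])
       (use assms * diamond_mult_incl[OF assms] in simp_all)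
qed

section \<open>Reversing the signs\<close>

definition reflection :: "nat \<Rightarrow> real mat" where
  "reflection n = four_block_mat (1\<^sub>m n) (0\<^sub>m n n) (0\<^sub>m n n) (- 1\<^sub>m n)"

definition reflect :: "nat \<Rightarrow> real mat \<Rightarrow> real mat" where
  "reflect n M = reflection n * (M * reflection n)"

lemma reflection_dim [simp]: "dim_row (reflection n) = 2 * n" "dim_col (reflection n) = 2 * n"
  by (auto simp: reflection_def)

lemma reflect_dim [simp]: "dim_row (reflect n M) = 2 * n" "dim_col (reflect n M) = 2 * n"
  by (auto simp: reflect_def)

lemma reflection_transpose: "(reflection n)\<^sup>T = reflection n"
  by (rule mat_entryI) (auto simp: reflection_def)

lemma reflection_square: "reflection n * reflection n = 1\<^sub>m (2 * n)"
  unfolding reflection_def by (subst four_block_mult[where k = n]) (auto intro!: mat_entryI)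

lemma reflection_J: "reflection n * (J n * reflection n) = - J n"
  unfolding reflection_def symplectic_form_mat_def
  by (subst four_block_mult[where k = n], simp_all)+ (auto intro!: mat_entryI)

lemma reflection_reflection_mult: "dim_row A = 2 * n \<Longrightarrow> reflection n * (reflection n * A) = A"
  by (simp add: mat_mult_assoc[symmetric] reflection_square)

lemma reflection_J_mult: "dim_row A = 2 * n \<Longrightarrow> reflection n * (J n * (reflection n * A)) = - (J n * A)"
proof -
  assume "dim_row A = 2 * n"
  hence "reflection n * (J n * (reflection n * A)) = (reflection n * (J n * reflection n)) * A" "dim_col (J n) = dim_row A"
    by (simp_all add: mat_mult_assoc)
  thus ?thesis unfolding reflection_J by (simp only: uminus_mult_left_mat)
qed

lemma reflect_mult:
  assumes "dim_row M = 2 * n" "dim_col M = 2 * n" "dim_row N = 2 * n" "dim_col N = 2 * n"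
  shows "reflect n (M * N) = reflect n M * reflect n N"
  using assms by (simp add: reflect_def mat_mult_assoc reflection_reflection_mult)

lemma reflect_symplectic:
  assumes "M \<in> symplectic_group n"
  shows "reflect n M \<in> symplectic_group n"
proof (rule symplectic_groupI)
  note M = symplectic_groupD[OF assms]
  have "(reflect n M)\<^sup>T * (J n * reflect n M) = - (reflection n * ((M\<^sup>T * (J n * M)) * reflection n))"
    using M(1,2) by (simp add: reflect_def mat_ring reflection_transpose reflection_J_mult)
  also have "\<dots> = J n" unfolding M(4) by (simp add: reflection_J)
  finally show "(reflect n M)\<^sup>T * (J n * reflect n M) = J n" .
qed simp_all

text \<open>The reflection changes the sign of the symplectic form, so conjugation with it preserves the
  symplectic group although the reflection itself is not symplectic.\<close>

lemma symp_conj_reflect: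
  assumes "symp_conj n M N"
  shows "symp_conj n (reflect n M) (reflect n N)"
proof -
  note d = symp_conj_dim[OF assms]
  obtain Q where Q: "Q \<in> symplectic_group n" "M * Q = Q * N" using assms by (auto simp: symp_conj_def)
  have "reflect n M * reflect n Q = reflect n Q * reflect n N"
    using d symplectic_groupD[OF Q(1)] by (simp add: reflect_mult[symmetric] Q(2))
  thus ?thesis using reflect_symplectic[OF Q(1)] by (intro symp_conjI) simp_all
qed

lemma reflect_wonenburger:
  assumes "dim_row A = n" "dim_col A = n" "dim_row B = n" "dim_col B = n" "dim_row C = n" "dim_col C = n"
  shows "reflect n (wonenburger_mat A B C) = wonenburger_mat A (- B) (- C)"
proof -
  have "wonenburger_mat A B C * reflection n = four_block_mat A (- B) C (- A\<^sup>T)"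
    unfolding wonenburger_mat_def reflection_def
    by (subst four_block_mult[where k = n], use assms in simp_all)
       (auto intro!: cong_four_block_mat mat_entryI simp: assms)
  thus ?thesis unfolding reflect_def wonenburger_mat_def
    unfolding reflection_def by (simp, subst four_block_mult[where k = n], use assms in simp_all)
       (auto intro!: cong_four_block_mat mat_entryI simp: assms)
qed

lemma reflection_diamond: "reflection m \<diamondop> reflection n = reflection (m + n)"
proof -
  have "reflection m \<diamondop> reflection n = four_block_mat (four_block_mat (1\<^sub>m m) (0\<^sub>m m n) (0\<^sub>m n m) (1\<^sub>m n))
    (four_block_mat (0\<^sub>m m m) (0\<^sub>m m n) (0\<^sub>m n m) (0\<^sub>m n n))
    (four_block_mat (0\<^sub>m m m) (0\<^sub>m m n) (0\<^sub>m n m) (0\<^sub>m n n))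
    (four_block_mat (- 1\<^sub>m m) (0\<^sub>m m n) (0\<^sub>m n m) (- 1\<^sub>m n))"
    unfolding reflection_def by (rule diamond_four_block) auto
  also have "\<dots> = reflection (m + n)" unfolding reflection_def
    by (intro cong_four_block_mat mat_entryI) auto
  finally show ?thesis .
qed

lemma reflect_diamond:
  assumes "dim_row M = 2 * m" "dim_col M = 2 * m" "dim_row N = 2 * n" "dim_col N = 2 * n"
  shows "reflect (m + n) (M \<diamondop> N) = reflect m M \<diamondop> reflect n N"
  unfolding reflect_def reflection_diamond[symmetric] using assms by (simp add: diamond_mult[of _ m _ n])

lemma reflect_cyclic_root: "reflect k (cyclic_root k s) = cyclic_root k (- s)"
  unfolding cyclic_root_def by (subst reflect_wonenburger) (simp_all add: mat_smult_uminus)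

section \<open>Doubled even blocks are squares of cyclic roots\<close>

lemma even_block_exists:
  assumes "1 \<le> m" "s \<in> {-1, 1}"
  obtains D where "even_block_data m s D"
proof -
  have "wonenburger_relations m (jordan_block m (- 1)) (s \<cdot>\<^sub>m F m)
     (s \<cdot>\<^sub>m (F m * (jordan_block m (- 1) * jordan_block m (- 1) - 1\<^sub>m m)))"
    by (rule wonenburger_anti_diag) (use assms in \<open>auto simp: jordan_block_F\<close>)
  thus ?thesis using that assms unfolding even_block_data_def by blast
qed

lemma jordan_block_minus_one: "jordan_block m (- 1 :: real) = S m - 1\<^sub>m m"
  by (rule mat_entryI) auto

lemma transpose_pow: "dim_row A = n \<Longrightarrow> dim_col A = n \<Longrightarrow> A\<^sup>T ^\<^sub>m j = ((A :: real mat) ^\<^sub>m j)\<^sup>T"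
proof (induction j)
  case (Suc j)
  have "(A ^\<^sub>m Suc j)\<^sup>T = (A * A ^\<^sub>m j)\<^sup>T" using Suc by (simp only: mat_pow_Suc_left)
  also have "\<dots> = A\<^sup>T ^\<^sub>m Suc j" using Suc by (simp add: mat_transpose_mult)
  finally show ?case by simp
qed simp

text \<open>For a Wonenburger matrix \<open>M + M\<^sup>-\<^sup>1 = 2 diag(A, A\<^sup>T)\<close>. With \<open>A = S - 1\<close> this gives
  \<open>(M + 1)\<^sup>2 = 2 M \<Delta>\<close> for \<open>\<Delta> = diag(S, S\<^sup>T)\<close>, which commutes with \<open>M\<close>; so even powers of \<open>M + 1\<close> are powers
  of \<open>\<Delta>\<close> up to invertible factors. One more factor \<open>M + 1\<close> does not kill \<open>\<Delta>\<^sup>m\<^sup>-\<^sup>1\<close>, as its upper right block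
  \<open>s F\<close> shows.\<close>

lemma even_block_nilpotent:
  assumes data: "even_block_data m s D"
  defines "M \<equiv> wonenburger_mat (jordan_block m (- 1)) (s \<cdot>\<^sub>m F m) D"
  shows "(M + 1\<^sub>m (2 * m)) ^\<^sub>m (2 * m) = 0\<^sub>m (2 * m) (2 * m)"
    and "(M + 1\<^sub>m (2 * m)) ^\<^sub>m (2 * m - 1) \<noteq> 0\<^sub>m (2 * m) (2 * m)"
proof -
  let ?N = "2 * m" and ?A = "jordan_block m (- 1 :: real)" and ?B = "s \<cdot>\<^sub>m F m"
  have m: "1 \<le> m" and s: "s \<in> {-1, 1}" and rel: "wonenburger_relations m ?A ?B D"
    using data by (auto simp: even_block_data_def)
  note d = wonenburger_dims[OF rel] and r = wonenburger_relationsD[OF rel]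
  have M: "M \<in> symplectic_group m" unfolding M_def by (rule wonenburger_symplectic[OF rel])
  note Md = symplectic_groupD(1,2)[OF M]
  let ?S = "S m" and ?St = "(S m)\<^sup>T"
  have A: "?A = ?S - 1\<^sub>m m" by (rule jordan_block_minus_one)
  have BS: "?B * ?St = ?S * ?B"
    using jordan_block_F[of m 0] by (simp add: mat_ring)
  have DS: "?St * D = D * ?S"
  proof (rule mat_entryI)
    fix i j assume "i < dim_row (D * ?S)" "j < dim_col (D * ?S)"
    hence ij: "i < m" "j < m" using d by auto
    have "(?A\<^sup>T * D) $$ (i, j) = (D * ?A) $$ (i, j)" by (simp only: r(4))
    thus "(?St * D) $$ (i, j) = (D * ?S) $$ (i, j)" using ij d
      by (simp add: A mat_ring del: index_mult_mat(1))
  qed (use d in simp_all)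
  define \<Delta> where "\<Delta> = four_block_mat ?S (0\<^sub>m m m) (0\<^sub>m m m) ?St"
  have \<Delta>d [simp]: "dim_row \<Delta> = ?N" "dim_col \<Delta> = ?N" by (auto simp: \<Delta>_def)
  have M1: "M + 1\<^sub>m ?N = four_block_mat ?S ?B D ?St"
    unfolding M_def wonenburger_mat_def A using d by (auto intro!: mat_entryI)
  have MD: "M * \<Delta> = four_block_mat (?A * ?S) (?B * ?St) (D * ?S) (?A\<^sup>T * ?St)"
    unfolding M_def wonenburger_mat_def \<Delta>_def
    by (subst four_block_mult[where k = m], use d in simp_all)
       (auto intro!: cong_four_block_mat mat_entryI simp: d simp del: index_mult_mat(1))
  have DM: "\<Delta> * M = four_block_mat (?S * ?A) (?S * ?B) (?St * D) (?St * ?A\<^sup>T)"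
    unfolding M_def wonenburger_mat_def \<Delta>_def
    by (subst four_block_mult[where k = m], use d in simp_all)
       (auto intro!: cong_four_block_mat mat_entryI simp: d simp del: index_mult_mat(1))
  have comm: "M * \<Delta> = \<Delta> * M"
    unfolding MD DM BS DS by (intro cong_four_block_mat) (simp_all add: A mat_ring)
  have sq: "(M + 1\<^sub>m ?N) * (M + 1\<^sub>m ?N) = 2 \<cdot>\<^sub>m (M * \<Delta>)"
  proof -
    have "(M + 1\<^sub>m ?N) * (M + 1\<^sub>m ?N) = four_block_mat (?S * ?S + ?B * D) (?S * ?B + ?B * ?St)
        (D * ?S + ?St * D) (D * ?B + ?St * ?St)"
      unfolding M1 by (rule four_block_mult) (use d in simp_all)
    also have "\<dots> = 2 \<cdot>\<^sub>m (M * \<Delta>)"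
      unfolding MD BS DS r(5,6)
      by (rule mat_entryI) (auto simp: d A mat_ring simp del: index_mult_mat(1))
    finally show ?thesis .
  qed
  let ?K = "M + 1\<^sub>m ?N"
  have K: "dim_row ?K = ?N" "dim_col ?K = ?N" by simp_all
  have even_pow: "?K ^\<^sub>m (2 * j) = 2 ^ j \<cdot>\<^sub>m (M ^\<^sub>m j * \<Delta> ^\<^sub>m j)" for j
  proof -
    have "?K ^\<^sub>m (2 * j) = ?K ^\<^sub>m j * ?K ^\<^sub>m j" using mat_pow_add[OF K, of j j] by (simp add: mult_2)
    also have "\<dots> = (?K * ?K) ^\<^sub>m j" using mat_pow_mult_commuting[OF K K refl] by simp
    also have "\<dots> = 2 ^ j \<cdot>\<^sub>m (M * \<Delta>) ^\<^sub>m j" unfolding sq using Md by (intro mat_pow_smult) auto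
    also have "(M * \<Delta>) ^\<^sub>m j = M ^\<^sub>m j * \<Delta> ^\<^sub>m j"
      by (rule mat_pow_mult_commuting[OF Md \<Delta>d comm])
    finally show ?thesis .
  qed
  have \<Delta>p: "\<Delta> ^\<^sub>m j = four_block_mat (?S ^\<^sub>m j) (0\<^sub>m m m) (0\<^sub>m m m) ((?S ^\<^sub>m j)\<^sup>T)" for j
    unfolding \<Delta>_def by (subst pow_four_block_mat) (simp_all add: transpose_pow)
  have "\<Delta> ^\<^sub>m m = 0\<^sub>m ?N ?N" unfolding \<Delta>p jordan_block_zero_pow by (rule mat_entryI) auto
  thus "?K ^\<^sub>m ?N = 0\<^sub>m ?N ?N" unfolding even_pow using Md by (auto intro!: mat_entryI)
  show "?K ^\<^sub>m (?N - 1) \<noteq> 0\<^sub>m ?N ?N"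
  proof
    assume z: "?K ^\<^sub>m (?N - 1) = 0\<^sub>m ?N ?N"
    define j where "j = m - 1"
    have "?N - 1 = Suc (2 * j)" using m by (simp add: j_def)
    hence "(2 ^ j \<cdot>\<^sub>m (M ^\<^sub>m j * \<Delta> ^\<^sub>m j)) * ?K = 0\<^sub>m ?N ?N" using z by (simp add: even_pow)
    hence "(1 / 2 ^ j) \<cdot>\<^sub>m (2 ^ j \<cdot>\<^sub>m (M ^\<^sub>m j * (\<Delta> ^\<^sub>m j * ?K))) = (1 / 2 ^ j) \<cdot>\<^sub>m 0\<^sub>m ?N ?N"
      using Md by (simp add: mat_smult_mult mat_mult_assoc)
    hence "M ^\<^sub>m j * (\<Delta> ^\<^sub>m j * ?K) = 0\<^sub>m ?N ?N" by (simp add: mat_smult_smult)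
    from symplectic_mult_eq_0[OF symplectic_pow[OF M, of j] _ _ this]
    have "\<Delta> ^\<^sub>m j * ?K = 0\<^sub>m ?N ?N" by simp
    moreover have "\<Delta> ^\<^sub>m j * ?K = four_block_mat (?S ^\<^sub>m j * ?S + 0\<^sub>m m m * D) (?S ^\<^sub>m j * ?B + 0\<^sub>m m m * ?St)
       (0\<^sub>m m m * ?S + (?S ^\<^sub>m j)\<^sup>T * D) (0\<^sub>m m m * ?B + (?S ^\<^sub>m j)\<^sup>T * ?St)"
      unfolding \<Delta>p M1 by (rule four_block_mult) (use d in simp_all)
    ultimately have "four_block_mat (?S ^\<^sub>m j * ?S + 0\<^sub>m m m * D) (?S ^\<^sub>m j * ?B + 0\<^sub>m m m * ?St)
       (0\<^sub>m m m * ?S + (?S ^\<^sub>m j)\<^sup>T * D) (0\<^sub>m m m * ?B + (?S ^\<^sub>m j)\<^sup>T * ?St) $$ (0, m) = 0"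
      using m by simp
    hence "(?S ^\<^sub>m j * ?B) $$ (0, 0) = 0" using m d by (simp del: index_mult_mat(1))
    moreover have "(?S ^\<^sub>m j * ?B) $$ (0, 0) = s * (?S ^\<^sub>m j * F m) $$ (0, 0)"
      using m by (simp add: mat_mult_smult del: index_mult_mat(1))
    moreover have "(?S ^\<^sub>m j * F m) $$ (0, 0) = 1"
      using m by (subst mult_F) (auto simp: jordan_block_zero_pow j_def)
    ultimately show False using s by auto
  qed
qed

lemma reflect_even_block:
  assumes "even_block_data m s D"
  shows "even_block_data m (- s) (- D)"
    "reflect m (wonenburger_mat (jordan_block m (- 1)) (s \<cdot>\<^sub>m F m) D)
       = wonenburger_mat (jordan_block m (- 1)) ((- s) \<cdot>\<^sub>m F m) (- D)"
proof -
  have rel: "wonenburger_relations m (jordan_block m (- 1)) (s \<cdot>\<^sub>m F m) D"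
    using assms by (simp add: even_block_data_def)
  note d = wonenburger_dims[OF rel] and r = wonenburger_relationsD[OF rel]
  show e: "reflect m (wonenburger_mat (jordan_block m (- 1)) (s \<cdot>\<^sub>m F m) D)
       = wonenburger_mat (jordan_block m (- 1)) ((- s) \<cdot>\<^sub>m F m) (- D)"
    using d by (subst reflect_wonenburger) (simp_all add: mat_smult_uminus)
  have "wonenburger_relations m (jordan_block m (- 1)) (- (s \<cdot>\<^sub>m F m)) (- D)"
    using rel d r unfolding wonenburger_relations_def by (auto simp: transpose_uminus)
  thus "even_block_data m (- s) (- D)" using assms by (auto simp: even_block_data_def mat_smult_uminus)
qed

text \<open>The Krylov basis has as many vectors as the space has dimensions, so the swap root is conjugate to a
  cyclic root. Which sign it has need not be computed: if it is the wrong one, the block with the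
  opposite sign does.\<close>

lemma double_even_block_conj_cyclic_root_square:
  assumes m: "1 \<le> m" and s: "s \<in> {-1, 1}"
  obtains s' D where "even_block_data m s' D"
    "symp_conj (m + m) (wonenburger_mat (jordan_block m (- 1)) (s' \<cdot>\<^sub>m F m) D \<diamondop> wonenburger_mat (jordan_block m (- 1)) (s' \<cdot>\<^sub>m F m) D)
       (cyclic_root (m + m) s * cyclic_root (m + m) s)"
proof -
  obtain D where D: "even_block_data m 1 D" using even_block_exists[OF m, of 1] by auto
  define M where "M = wonenburger_mat (jordan_block m (- 1)) (1 \<cdot>\<^sub>m F m) D"
  have M: "M \<in> symplectic_group m"
    unfolding M_def using D by (intro wonenburger_symplectic) (simp add: even_block_data_def)
  note Md = symplectic_groupD(1,2)[OF M]
  obtain X where X: "X \<in> symplectic_group (m + m)" "X * X = M \<diamondop> M" using symplectic_root_of_double[OF M] by blast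
  note Xd = symplectic_groupD(1,2)[OF X(1)]
  let ?K = "M + 1\<^sub>m (2 * m)"
  have K: "dim_row ?K = 2 * m" "dim_col ?K = 2 * m" by simp_all
  have p: "(X * X + 1\<^sub>m (2 * (m + m))) ^\<^sub>m j = ?K ^\<^sub>m j \<diamondop> ?K ^\<^sub>m j" for j
    unfolding X(2) diamond_add_one[OF Md Md] diamond_pow[OF K K] ..
  have iff: "(X * X + 1\<^sub>m (2 * (m + m))) ^\<^sub>m j = 0\<^sub>m (2 * (m + m)) (2 * (m + m)) \<longleftrightarrow> ?K ^\<^sub>m j = 0\<^sub>m (2 * m) (2 * m)" for j
    unfolding p using K by (subst diamond_eq_0_iff) auto
  have nil: "?K ^\<^sub>m (m + m) = 0\<^sub>m (2 * m) (2 * m)" "?K ^\<^sub>m (m + m - 1) \<noteq> 0\<^sub>m (2 * m) (2 * m)"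
    using even_block_nilpotent[OF D] by (simp_all add: M_def mult_2)
  obtain s1 V where V: "s1 \<in> {-1, 1}" "dim_row V = 2 * (m + m)" "dim_col V = 2 * (m + m)"
    "V\<^sup>T * (J (m + m) * V) = J (m + m)" "X * V = V * cyclic_root (m + m) s1"
    using krylov_embedding_of_square[OF X(1), of "m + m"] nil m unfolding iff by auto
  have "symp_conj (m + m) X (cyclic_root (m + m) s1)"
    using Xd V by (intro symp_conjI[of _ _ _ V] symplectic_groupI) simp_all
  from symp_conj_square[OF this] have c: "symp_conj (m + m) (M \<diamondop> M) (cyclic_root (m + m) s1 * cyclic_root (m + m) s1)"
    unfolding X(2) .
  show ?thesis
  proof (cases "s = s1")
    case True
    thus ?thesis using that[OF D] c by (simp add: M_def)
  next
    case False
    hence "s = - s1" using V(1) s by auto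
    moreover have "symp_conj (m + m) (reflect m M \<diamondop> reflect m M) (cyclic_root (m + m) (- s1) * cyclic_root (m + m) (- s1))"
      using symp_conj_reflect[OF c] Md by (simp add: reflect_diamond reflect_mult reflect_cyclic_root)
    ultimately show ?thesis using that[OF reflect_even_block(1)[OF D]] unfolding M_def reflect_even_block(2)[OF D] by simp
  qed
qed

section \<open>Odd blocks are squares of cyclic roots\<close>

text \<open>Conjugation with the symplectic matrix \<open>diag(g, h\<^sup>T)\<close>.\<close>

lemma wonenburger_conj:
  assumes d: "dim_row A = k" "dim_col A = k" "dim_row B = k" "dim_col B = k" "dim_row C = k" "dim_col C = k"
    "dim_row A' = k" "dim_col A' = k" "dim_row B' = k" "dim_col B' = k" "dim_row C' = k" "dim_col C' = k"
    and g: "dim_row g = k" "dim_col g = k" "dim_row h = k" "dim_col h = k" "g * h = 1\<^sub>m k"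
    and AB: "A * g = g * A'" "B * h\<^sup>T = g * B'" "C * g = h\<^sup>T * C'"
  shows "symp_conj k (wonenburger_mat A B C) (wonenburger_mat A' B' C')"
proof (rule symp_conjI)
  let ?ht = "h\<^sup>T"
  let ?Q = "four_block_mat g (0\<^sub>m k k) (0\<^sub>m k k) ?ht"
  have hg: "h * g = 1\<^sub>m k" by (rule mat_mult_left_right_inverse[OF _ _ g(5)]) (use g in auto)
  have gt: "?ht * g\<^sup>T = 1\<^sub>m k" "g\<^sup>T * ?ht = 1\<^sub>m k"
  proof -
    have "(g * h)\<^sup>T = 1\<^sub>m k" "(h * g)\<^sup>T = 1\<^sub>m k" unfolding g(5) hg by simp_all
    thus "?ht * g\<^sup>T = 1\<^sub>m k" "g\<^sup>T * ?ht = 1\<^sub>m k" using g(1-4) by (simp_all add: mat_transpose_mult)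
  qed
  have A't: "A\<^sup>T * ?ht = ?ht * A'\<^sup>T"
  proof -
    have "h * A = h * (A * (g * h))" using d g by simp
    also have "\<dots> = h * ((A * g) * h)" using d g(1-4) by (simp add: mat_mult_assoc)
    also have "\<dots> = (h * g) * (A' * h)" unfolding AB using d g(1-4) by (simp add: mat_mult_assoc)
    also have "\<dots> = A' * h" unfolding hg using d g by simp
    finally have "(h * A)\<^sup>T = (A' * h)\<^sup>T" by simp
    thus ?thesis using d g(1-4) by (simp add: mat_transpose_mult)
  qed
  have "wonenburger_mat A B C * ?Q = four_block_mat (A * g) (B * ?ht) (C * g) (A\<^sup>T * ?ht)"
    unfolding wonenburger_mat_def
    by (subst four_block_mult[where k = k], use d g in simp_all)
       (auto intro!: cong_four_block_mat mat_entryI simp: d g simp del: index_mult_mat(1))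
  moreover have "?Q * wonenburger_mat A' B' C' = four_block_mat (g * A') (g * B') (?ht * C') (?ht * A'\<^sup>T)"
    unfolding wonenburger_mat_def
    by (subst four_block_mult[where k = k], use d g in simp_all)
       (auto intro!: cong_four_block_mat mat_entryI simp: d g simp del: index_mult_mat(1))
  ultimately show "wonenburger_mat A B C * ?Q = ?Q * wonenburger_mat A' B' C'" unfolding AB A't by simp
  show "?Q \<in> symplectic_group k"
  proof (rule symplectic_groupI)
    have t: "?Q\<^sup>T = four_block_mat g\<^sup>T (0\<^sub>m k k) (0\<^sub>m k k) h"
      using g by (subst transpose_four_block_mat[of _ k k _ k _ k]) (auto intro: carrier_matI)
    have JQ: "J k * ?Q = four_block_mat (0\<^sub>m k k) (- ?ht) g (0\<^sub>m k k)"
      unfolding symplectic_form_mat_def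
      by (subst four_block_mult[where k = k], use g in simp_all)
         (auto intro!: cong_four_block_mat mat_entryI simp: g)
    have "?Q\<^sup>T * (J k * ?Q) = four_block_mat (0\<^sub>m k k) (- (g\<^sup>T * ?ht)) (h * g) (0\<^sub>m k k)"
      unfolding t JQ
      by (subst four_block_mult[where k = k], use g(1-4) in simp_all)
         (auto intro!: cong_four_block_mat mat_entryI simp: g(1-4) simp del: index_mult_mat(1))
    thus "?Q\<^sup>T * (J k * ?Q) = J k" unfolding gt hg symplectic_form_mat_def .
  qed (use g in simp_all)
qed (use d in simp_all)

lemma S_mult:
  assumes "dim_row Z = k" "i < k" "j < dim_col Z"
  shows "(S k * Z) $$ (i, j) = (if Suc i < k then Z $$ (Suc i, j) else 0)"
proof -
  have "(S k * Z) $$ (i, j) = (\<Sum>a<k. S k $$ (i, a) * Z $$ (a, j))"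
    using assms by (auto simp: scalar_prod_def atLeast0LessThan intro!: sum.cong)
  also have "\<dots> = (\<Sum>a<k. if a = Suc i then Z $$ (a, j) else 0)"
    using assms by (intro sum.cong) auto
  also have "\<dots> = (if Suc i < k then Z $$ (Suc i, j) else 0)" by simp
  finally show ?thesis .
qed

text \<open>The blocks \<open>A\<close>, \<open>B\<close>, \<open>C\<close> of the square of a cyclic root, entry by entry.\<close>

definition shift_A :: "nat \<Rightarrow> real mat" where
  "shift_A k = mat k k (\<lambda>(i, j). (if j = i + 2 then 1 else 0) - (if i = j then 1 else 0))"

definition shift_B :: "nat \<Rightarrow> real \<Rightarrow> real mat" where
  "shift_B k t = mat k k (\<lambda>(i, j). if i + j + 2 = k then t else 0)"

definition shift_C :: "nat \<Rightarrow> real \<Rightarrow> real mat" where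
  "shift_C k t = mat k k (\<lambda>(i, j). (if i + j = k + 2 then t else 0) - (if i + j = k then 2 * t else 0))"

lemma shift_dim [simp]:
  "dim_row (shift_A k) = k" "dim_col (shift_A k) = k" "dim_row (shift_B k t) = k" "dim_col (shift_B k t) = k"
  "dim_row (shift_C k t) = k" "dim_col (shift_C k t) = k"
  by (auto simp: shift_A_def shift_B_def shift_C_def)

lemma shift_index:
  "i < k \<Longrightarrow> j < k \<Longrightarrow> shift_A k $$ (i, j) = (if j = i + 2 then 1 else 0) - (if i = j then 1 else 0)"
  "i < k \<Longrightarrow> j < k \<Longrightarrow> shift_B k t $$ (i, j) = (if i + j + 2 = k then t else 0)"
  "i < k \<Longrightarrow> j < k \<Longrightarrow> shift_C k t $$ (i, j) = (if i + j = k + 2 then t else 0) - (if i + j = k then 2 * t else 0)"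
  by (simp_all add: shift_A_def shift_B_def shift_C_def)

lemma shift_A_eq: "shift_A k = S k * S k - 1\<^sub>m k"
  by (rule mat_entryI) (auto simp: S_mult shift_index simp del: index_mult_mat(1))

lemma shift_B_eq: "shift_B k t = t \<cdot>\<^sub>m (S k * F k)"
  by (rule mat_entryI) (auto simp: S_mult F_index shift_index simp del: index_mult_mat(1))

lemma shift_C_eq: "shift_C k t = t \<cdot>\<^sub>m (F k * (S k * (S k * S k)) - 2 \<cdot>\<^sub>m (F k * S k))"
  by (rule mat_entryI) (auto simp: S_mult F_mult shift_index simp del: index_mult_mat(1))

lemma wonenburger_square_relations:
  assumes "wonenburger_relations k A B C"
  shows "wonenburger_relations k (2 \<cdot>\<^sub>m (A * A) - 1\<^sub>m k) (2 \<cdot>\<^sub>m (A * B)) (2 \<cdot>\<^sub>m (C * A))"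
proof -
  note d = wonenburger_dims[OF assms] and r = wonenburger_relationsD[OF assms]
  have BA: "B * A\<^sup>T = A * B" "A\<^sup>T * C = C * A" using r by simp_all
  have BA': "B * (A\<^sup>T * Z) = A * (B * Z)" "A\<^sup>T * (C * Z) = C * (A * Z)"
    "B * (C * Z) = A * (A * Z) - Z" if "dim_row Z = k" for Z
  proof -
    have "(B * A\<^sup>T) * Z = (A * B) * Z" "(A\<^sup>T * C) * Z = (C * A) * Z" "(B * C) * Z = (A * A - 1\<^sub>m k) * Z"
      using r by simp_all
    thus "B * (A\<^sup>T * Z) = A * (B * Z)" "A\<^sup>T * (C * Z) = C * (A * Z)" "B * (C * Z) = A * (A * Z) - Z"
      using that d by (simp_all add: mat_ring)
  qed
  have "(2 \<cdot>\<^sub>m (A * A) - 1\<^sub>m k) * (2 \<cdot>\<^sub>m (A * A) - 1\<^sub>m k) - (2 \<cdot>\<^sub>m (A * B)) * (2 \<cdot>\<^sub>m (C * A)) = 1\<^sub>m k"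
    using d by (simp add: mat_ring BA BA') (rule mat_entryI; simp del: index_mult_mat(1))
  thus ?thesis
    unfolding wonenburger_relations_def using d r(1,2)
    by (auto simp: mat_ring BA BA' intro!: carrier_matI)
qed

lemma cyclic_root_square:
  assumes "s \<in> {-1, 1}"
  shows "cyclic_root k s * cyclic_root k s = wonenburger_mat (shift_A k) (shift_B k s) (shift_C k s)"
    "wonenburger_relations k (shift_A k) (shift_B k s) (shift_C k s)"
proof -
  let ?a = "(1 / sqrt 2) \<cdot>\<^sub>m S k" and ?b = "(s / sqrt 2) \<cdot>\<^sub>m F k"
  let ?c = "(sqrt 2 * s) \<cdot>\<^sub>m (F k * (?a * ?a - 1\<^sub>m k))"
  note rel = cyclic_root_relations[OF assms, of k]
  have A: "2 \<cdot>\<^sub>m (?a * ?a) - 1\<^sub>m k = shift_A k" by (simp add: mat_ring shift_A_eq)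
  have B: "2 \<cdot>\<^sub>m (?a * ?b) = shift_B k s" by (simp add: mat_ring shift_B_eq)
  have C: "2 \<cdot>\<^sub>m (?c * ?a) = shift_C k s" by (simp add: mat_ring shift_C_eq)
    (rule mat_entryI; simp add: field_simps del: index_mult_mat(1))
  show "cyclic_root k s * cyclic_root k s = wonenburger_mat (shift_A k) (shift_B k s) (shift_C k s)"
    unfolding cyclic_root_def wonenburger_square[OF rel] A B C ..
  show "wonenburger_relations k (shift_A k) (shift_B k s) (shift_C k s)"
    using wonenburger_square_relations[OF rel] unfolding A B C .
qed

text \<open>A shear \<open>1 + R\<close>, with \<open>R\<close> supported at position \<open>(1, k - 1)\<close>, commutes with \<open>A\<close> and fixes \<open>B\<close>, because \<open>R\<close>
  meets only rows and columns that \<open>A + 1\<close> and \<open>B\<close> annihilate. On \<open>C\<close> it changes only the last diagonal entry, by a multiple of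
  the entry \<open>- 2 t\<close> of \<open>C\<close> at position \<open>(k - 1, 1)\<close>.\<close>

lemma shear_conj:
  assumes k: "k \<ge> 3" and t: "t \<noteq> 0"
    and G: "dim_row G = k" "dim_col G = k" "\<And>i j. i < k \<Longrightarrow> j < k \<Longrightarrow> G $$ (i, j) = shift_C k t $$ (i, j) + (if i + 1 = k \<and> j + 1 = k then c else 0)"
  shows "symp_conj k (wonenburger_mat (shift_A k) (shift_B k t) G) (wonenburger_mat (shift_A k) (shift_B k t) (shift_C k t))"
proof (rule wonenburger_conj)
  define \<alpha> where "\<alpha> = c / (4 * t)"
  define R where "R = mat k k (\<lambda>(i, j). if i = 1 \<and> j = k - 1 then \<alpha> else 0)"
  have Rd [simp]: "dim_row R = k" "dim_col R = k" by (auto simp: R_def)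
  have Ri: "R $$ (i, j) = (if i = 1 \<and> j = k - 1 then \<alpha> else 0)" if "i < k" "j < k" for i j
    using that by (simp add: R_def)
  have RZ: "(R * Z) $$ (i, j) = (if i = 1 then \<alpha> * Z $$ (k - 1, j) else 0)"
    if "dim_row Z = k" "i < k" "j < dim_col Z" for Z i j
  proof -
    have "(R * Z) $$ (i, j) = (\<Sum>a<k. (if i = 1 \<and> a = k - 1 then \<alpha> else 0) * Z $$ (a, j))"
      using that by (auto simp: scalar_prod_def R_def atLeast0LessThan intro!: sum.cong)
    also have "\<dots> = (\<Sum>a<k. if a = k - 1 then (if i = 1 then \<alpha> * Z $$ (a, j) else 0) else 0)"
      by (intro sum.cong) auto
    finally show ?thesis using k by simp
  qed
  have ZR: "(Z * R) $$ (i, j) = (if j = k - 1 then \<alpha> * Z $$ (i, 1) else 0)"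
    if "dim_col Z = k" "i < dim_row Z" "j < k" for Z i j
  proof -
    have "(Z * R) $$ (i, j) = (\<Sum>a<k. Z $$ (i, a) * (if a = 1 \<and> j = k - 1 then \<alpha> else 0))"
      using that by (auto simp: scalar_prod_def R_def atLeast0LessThan intro!: sum.cong)
    also have "\<dots> = (\<Sum>a<k. if a = 1 then (if j = k - 1 then \<alpha> * Z $$ (i, a) else 0) else 0)"
      by (intro sum.cong) auto
    finally show ?thesis using k by simp
  qed
  have RtZ: "(R\<^sup>T * Z) $$ (i, j) = (if i = k - 1 then \<alpha> * Z $$ (1, j) else 0)"
    if "dim_row Z = k" "i < k" "j < dim_col Z" for Z i j
  proof -
    have "R\<^sup>T * Z = (Z\<^sup>T * R)\<^sup>T" using that by (simp add: mat_transpose_mult)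
    thus ?thesis using that k by (simp add: ZR del: index_mult_mat(1))
  qed
  have ZRt: "(Z * R\<^sup>T) $$ (i, j) = (if j = 1 then \<alpha> * Z $$ (i, k - 1) else 0)"
    if "dim_col Z = k" "i < dim_row Z" "j < k" for Z i j
  proof -
    have "Z * R\<^sup>T = (R * Z\<^sup>T)\<^sup>T" using that by (simp add: mat_transpose_mult)
    thus ?thesis using that k by (simp add: RZ del: index_mult_mat(1))
  qed
  have "R * R = 0\<^sub>m k k" using k by (intro mat_entryI) (auto simp: RZ Ri simp del: index_mult_mat(1))
  thus "(1\<^sub>m k + R) * (1\<^sub>m k - R) = 1\<^sub>m k" by (simp add: mat_ring) (auto intro!: mat_entryI)
  show "shift_A k * (1\<^sub>m k + R) = (1\<^sub>m k + R) * shift_A k"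
    using k by (intro mat_entryI) (auto simp: mat_ring RZ ZR shift_index simp del: index_mult_mat(1))
  show "shift_B k t * (1\<^sub>m k - R)\<^sup>T = (1\<^sub>m k + R) * shift_B k t"
    using k by (intro mat_entryI) (auto simp: mat_ring RZ ZRt shift_index simp del: index_mult_mat(1))
  show "G * (1\<^sub>m k + R) = (1\<^sub>m k - R)\<^sup>T * shift_C k t"
  proof (rule mat_entryI)
    fix i j assume "i < dim_row ((1\<^sub>m k - R)\<^sup>T * shift_C k t)" "j < dim_col ((1\<^sub>m k - R)\<^sup>T * shift_C k t)"
    hence ij: "i < k" "j < k" by auto
    have "4 * t * \<alpha> = c" using t by (simp add: \<alpha>_def)
    thus "(G * (1\<^sub>m k + R)) $$ (i, j) = ((1\<^sub>m k - R)\<^sup>T * shift_C k t) $$ (i, j)"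
      using ij k by (auto simp: G mat_ring ZR RtZ shift_index algebra_simps simp del: index_mult_mat(1))
  qed (use G in auto)
qed (simp_all add: G)

text \<open>In the square of a cyclic root of size \<open>2 l + 1\<close> the shift moves by two. The even positions then form
  a Jordan chain of length \<open>l + 1\<close> and the odd ones a chain of length \<open>l\<close>, as in the odd blocks.\<close>

definition interleave :: "nat \<Rightarrow> nat \<Rightarrow> nat" where
  "interleave l i = (if i \<le> l then 2 * i else 2 * (i - l) - 1)"

definition interleave_mat :: "nat \<Rightarrow> real mat" where
  "interleave_mat l = (coord_incl (2 * l + 1) (2 * l + 1) (interleave l))\<^sup>T"

lemma interleave_less: "i < 2 * l + 1 \<Longrightarrow> interleave l i < 2 * l + 1"
  by (auto simp: interleave_def)

lemma interleave_arith:
  assumes "i < 2 * l + 1" "j < 2 * l + 1"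
  shows "interleave l i = interleave l j \<longleftrightarrow> i = j"
    "interleave l j = interleave l i + 2 \<longleftrightarrow> j = i + 1 \<and> i \<noteq> l"
    "interleave l i + interleave l j + 2 = 2 * l + 1 \<longleftrightarrow> i + j = 2 * l \<and> i \<noteq> j"
proof -
  have ge: "\<exists>b. i = l + 1 + b" if "\<not> i \<le> l" for i using that by (auto simp: not_le less_iff_Suc_add)
  have hi: "interleave l (Suc (l + b)) = 2 * b + 1" for b by (simp add: interleave_def)
  have lo: "interleave l i = 2 * i" if "i \<le> l" for i using that by (simp add: interleave_def)
  consider "i \<le> l" "j \<le> l" | b where "i = l + 1 + b" "j \<le> l" | b where "i \<le> l" "j = l + 1 + b"
    | b c where "i = l + 1 + b" "j = l + 1 + c"
  proof (cases "i \<le> l")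
    case i: True
    show ?thesis by (cases "j \<le> l") (use that(1,3) i ge[of j] in metis)+
  next
    case i: False
    then obtain b where "i = l + 1 + b" using ge by metis
    thus ?thesis by (cases "j \<le> l") (use that(2,4) ge[of j] in metis)+
  qed
  hence "(interleave l i = interleave l j \<longleftrightarrow> i = j) \<and>
    (interleave l j = interleave l i + 2 \<longleftrightarrow> j = i + 1 \<and> i \<noteq> l) \<and>
    (interleave l i + interleave l j + 2 = 2 * l + 1 \<longleftrightarrow> i + j = 2 * l \<and> i \<noteq> j)"
  proof cases
    case 1
    have "2 * i + 2 * j + 2 \<noteq> 2 * l + 1" "i + j = 2 * l \<longrightarrow> i = j" using 1 by presburger+
    thus ?thesis using 1 by (auto simp: lo)
  next
    case 2
    have "2 * b + 1 \<noteq> 2 * j" "2 * j \<noteq> 2 * b + 1 + 2" by presburger+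
    thus ?thesis using 2 by (simp add: hi lo) presburger
  next
    case 3
    have "2 * i \<noteq> 2 * b + 1" "2 * b + 1 \<noteq> 2 * i + 2" by presburger+
    thus ?thesis using 3 by (simp add: hi lo) presburger
  next
    case 4
    have "2 * b + 1 + (2 * c + 1) + 2 \<noteq> 2 * l + 1" by presburger
    thus ?thesis using 4 by (simp add: hi) presburger
  qed
  thus "interleave l i = interleave l j \<longleftrightarrow> i = j"
    "interleave l j = interleave l i + 2 \<longleftrightarrow> j = i + 1 \<and> i \<noteq> l"
    "interleave l i + interleave l j + 2 = 2 * l + 1 \<longleftrightarrow> i + j = 2 * l \<and> i \<noteq> j" by blast+
qed

lemma interleave_mat_dim [simp]: "dim_row (interleave_mat l) = 2 * l + 1" "dim_col (interleave_mat l) = 2 * l + 1"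
  by (auto simp: interleave_mat_def)

lemma interleave_mat_orthogonal:
  "interleave_mat l * (interleave_mat l)\<^sup>T = 1\<^sub>m (2 * l + 1)"
  "(interleave_mat l)\<^sup>T * interleave_mat l = 1\<^sub>m (2 * l + 1)"
proof -
  have inj: "inj_on (interleave l) {..<2 * l + 1}" 
    by (auto simp: inj_on_def interleave_arith)
  show 1: "interleave_mat l * (interleave_mat l)\<^sup>T = 1\<^sub>m (2 * l + 1)"
    unfolding interleave_mat_def using coord_incl_isometry[OF interleave_less inj] by simp
  show "(interleave_mat l)\<^sup>T * interleave_mat l = 1\<^sub>m (2 * l + 1)"
    by (rule mat_mult_left_right_inverse[OF _ _ 1]) auto
qed

lemma interleave_conj_index:
  assumes "dim_row A = 2 * l + 1" "dim_col A = 2 * l + 1" "i < 2 * l + 1" "j < 2 * l + 1"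
  shows "(interleave_mat l * (A * (interleave_mat l)\<^sup>T)) $$ (i, j) = A $$ (interleave l i, interleave l j)"
  unfolding interleave_mat_def transpose_transpose
  using assms interleave_less[of i l] interleave_less[of j l]
  by (simp add: transpose_coord_incl_mult mult_coord_incl del: index_mult_mat(1))

lemma odd_A_index:
  assumes "i < 2 * l + 1" "j < 2 * l + 1"
  shows "odd_A l $$ (i, j) = (if j = i + 1 \<and> i \<noteq> l then 1 else 0) - (if i = j then 1 else 0)"
proof (cases "i \<le> l")
  case i: True
  show ?thesis
  proof (cases "j \<le> l")
    case True
    thus ?thesis using i assms unfolding odd_A_def diag_block_two by (simp add: less_Suc_eq_le)
  next
    case False
    thus ?thesis using i assms unfolding odd_A_def diag_block_two by (simp add: less_Suc_eq_le)
  qed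
next
  case i: False
  then obtain b where b: "i = Suc (l + b)" by (auto simp: not_le less_iff_Suc_add)
  show ?thesis
  proof (cases "j \<le> l")
    case True
    thus ?thesis using i assms unfolding odd_A_def diag_block_two by (simp add: less_Suc_eq_le)
  next
    case False
    then obtain c where c: "j = Suc (l + c)" by (auto simp: not_le less_iff_Suc_add)
    show ?thesis using assms unfolding odd_A_def diag_block_two b c by simp
  qed
qed

lemma odd_B_index:
  assumes "i < 2 * l + 1" "j < 2 * l + 1"
  shows "odd_B l t $$ (i, j) = (if i + j = 2 * l \<and> i \<noteq> j then t else 0)"
proof (cases "i \<le> l")
  case i: True
  show ?thesis
  proof (cases "j \<le> l")
    case True
    hence "\<not> (i + j = 2 * l \<and> i \<noteq> j)" using i by linarith
    thus ?thesis using True i assms unfolding odd_B_def append_rows_def by (simp add: less_Suc_eq_le)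
  next
    case False
    then obtain c where c: "j = Suc (l + c)" by (auto simp: not_le less_iff_Suc_add)
    show ?thesis using i assms unfolding odd_B_def append_rows_def c by (simp add: less_Suc_eq_le F_index)
  qed
next
  case i: False
  then obtain b where b: "i = Suc (l + b)" by (auto simp: not_le less_iff_Suc_add)
  show ?thesis
  proof (cases "j \<le> l")
    case True
    thus ?thesis using assms unfolding odd_B_def append_rows_def b by (simp add: less_Suc_eq_le F_index)
  next
    case False
    hence "i + j \<noteq> 2 * l" using i by linarith
    thus ?thesis using i False assms unfolding odd_B_def append_rows_def by (simp add: less_Suc_eq_le)
  qed
qed

lemma odd_A_interleave:
  "odd_A l = interleave_mat l * (shift_A (2 * l + 1) * (interleave_mat l)\<^sup>T)"
proof (rule mat_entryI)
  fix i j assume "i < dim_row (interleave_mat l * (shift_A (2 * l + 1) * (interleave_mat l)\<^sup>T))"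
     "j < dim_col (interleave_mat l * (shift_A (2 * l + 1) * (interleave_mat l)\<^sup>T))"
  hence ij: "i < 2 * l + 1" "j < 2 * l + 1" by auto
  have il: "interleave l i < 2 * l + 1" "interleave l j < 2 * l + 1" using ij interleave_less by auto
  have "(interleave_mat l * (shift_A (2 * l + 1) * (interleave_mat l)\<^sup>T)) $$ (i, j)
     = (if j = i + 1 \<and> i \<noteq> l then 1 else 0) - (if i = j then 1 else 0)"
    using ij by (subst interleave_conj_index) (simp_all only: shift_index(1)[OF il] interleave_arith[OF ij] shift_dim)
  moreover have "odd_A l $$ (i, j) = (if j = i + 1 \<and> i \<noteq> l then 1 else 0) - (if i = j then 1 else 0)"
    by (rule odd_A_index[OF ij])
  ultimately show "odd_A l $$ (i, j) = (interleave_mat l * (shift_A (2 * l + 1) * (interleave_mat l)\<^sup>T)) $$ (i, j)"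
    by simp
qed (auto simp: odd_A_def diag_block_two)

lemma odd_B_interleave:
  "odd_B l t = interleave_mat l * (shift_B (2 * l + 1) t * (interleave_mat l)\<^sup>T)"
proof (rule mat_entryI)
  fix i j assume "i < dim_row (interleave_mat l * (shift_B (2 * l + 1) t * (interleave_mat l)\<^sup>T))"
     "j < dim_col (interleave_mat l * (shift_B (2 * l + 1) t * (interleave_mat l)\<^sup>T))"
  hence ij: "i < 2 * l + 1" "j < 2 * l + 1" by auto
  have il: "interleave l i < 2 * l + 1" "interleave l j < 2 * l + 1" using ij interleave_less by auto
  have "(interleave_mat l * (shift_B (2 * l + 1) t * (interleave_mat l)\<^sup>T)) $$ (i, j)
     = (if i + j = 2 * l \<and> i \<noteq> j then t else 0)"
    using ij by (subst interleave_conj_index) (simp_all only: shift_index(2)[OF il] interleave_arith[OF ij] shift_dim)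
  moreover have "odd_B l t $$ (i, j) = (if i + j = 2 * l \<and> i \<noteq> j then t else 0)"
    by (rule odd_B_index[OF ij])
  ultimately show "odd_B l t $$ (i, j) = (interleave_mat l * (shift_B (2 * l + 1) t * (interleave_mat l)\<^sup>T)) $$ (i, j)"
    by simp
qed (auto simp: odd_B_def append_rows_def)

lemma wonenburger_relations_orthogonal_conj:
  assumes rel: "wonenburger_relations k A B C"
    and g: "dim_row g = k" "dim_col g = k" "g\<^sup>T * g = 1\<^sub>m k" "g * g\<^sup>T = 1\<^sub>m k"
  shows "wonenburger_relations k (g * (A * g\<^sup>T)) (g * (B * g\<^sup>T)) (g * (C * g\<^sup>T))"
proof -
  note d = wonenburger_dims[OF rel] and r = wonenburger_relationsD[OF rel]
  have gg: "g\<^sup>T * (g * Z) = Z" if "dim_row Z = k" for Z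
    using g that by (simp add: mat_mult_assoc[symmetric])
  have AB: "A * (B * g\<^sup>T) = B * (A\<^sup>T * g\<^sup>T)"
    "A\<^sup>T * (C * g\<^sup>T) = C * (A * g\<^sup>T)"
    "B * (C * g\<^sup>T) = A * (A * g\<^sup>T) - g\<^sup>T"
  proof -
    have "(A * B) * g\<^sup>T = (B * A\<^sup>T) * g\<^sup>T"
      "(A\<^sup>T * C) * g\<^sup>T = (C * A) * g\<^sup>T"
      "(B * C) * g\<^sup>T = (A * A - 1\<^sub>m k) * g\<^sup>T" by (simp_all only: r)
    thus "A * (B * g\<^sup>T) = B * (A\<^sup>T * g\<^sup>T)"
      "A\<^sup>T * (C * g\<^sup>T) = C * (A * g\<^sup>T)"
      "B * (C * g\<^sup>T) = A * (A * g\<^sup>T) - g\<^sup>T"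
      using d g(1,2) by (simp_all add: mat_ring)
  qed
  have "g * (A * g\<^sup>T) * (g * (A * g\<^sup>T)) - g * (B * g\<^sup>T) * (g * (C * g\<^sup>T)) = 1\<^sub>m k"
    using d g(1,2) by (simp add: mat_ring gg AB g(4)) (rule mat_entryI; simp del: index_mult_mat(1))
  thus ?thesis unfolding wonenburger_relations_def
    using d g(1,2) r(1,2) by (auto simp: mat_ring gg AB intro!: carrier_matI)
qed

text \<open>The square of a cyclic root satisfies the Wonenburger relations, and an orthogonal change of
  coordinates preserves them.\<close>

lemma odd_block_exists:
  assumes "t \<in> {-1, 1}"
  obtains E where "odd_block_data l t E" "l = 0 \<longrightarrow> E = 0\<^sub>m 1 1"
proof
  let ?k = "2 * l + 1" and ?g = "interleave_mat l"
  let ?E = "?g * (shift_C ?k t * ?g\<^sup>T)"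
  show "odd_block_data l t ?E"
    unfolding odd_block_data_def odd_A_interleave odd_B_interleave
    by (intro conjI assms wonenburger_relations_orthogonal_conj[OF cyclic_root_square(2)[OF assms]]
        interleave_mat_dim interleave_mat_orthogonal)
  show "l = 0 \<longrightarrow> ?E = 0\<^sub>m 1 1"
  proof
    assume l: "l = 0"
    have "shift_C ?k t = 0\<^sub>m 1 1" unfolding l by (rule mat_entryI) (auto simp: shift_index)
    thus "?E = 0\<^sub>m 1 1" using l by simp
  qed
qed

text \<open>In interleaved coordinates the relation \<open>B C = A\<^sup>2 - 1\<close> determines all rows of \<open>C\<close> except the last one,
  and symmetry then all entries except the last diagonal one, which the shear adjusts. A shear exists
  only for \<open>l \<ge> 1\<close>, whence the assumption for \<open>l = 0\<close>.\<close>

lemma odd_block_conj_cyclic_root_square: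
  assumes data: "odd_block_data l t E" and l0: "l = 0 \<Longrightarrow> E = 0\<^sub>m 1 1"
  shows "symp_conj (2 * l + 1) (wonenburger_mat (odd_A l) (odd_B l t) E)
     (cyclic_root (2 * l + 1) t * cyclic_root (2 * l + 1) t)"
proof -
  define k where "k = 2 * l + 1"
  define g where "g = interleave_mat l"
  define A where "A = shift_A k"
  define B where "B = shift_B k t"
  have t: "t \<in> {-1, 1}" and rel: "wonenburger_relations k (odd_A l) (odd_B l t) E"
    using data by (auto simp: odd_block_data_def k_def)
  note d = wonenburger_dims[OF rel] and r = wonenburger_relationsD[OF rel]
  have gd [simp]: "dim_row g = k" "dim_col g = k" by (simp_all add: g_def k_def)
  have g: "g\<^sup>T * g = 1\<^sub>m k" "g * g\<^sup>T = 1\<^sub>m k"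
    using interleave_mat_orthogonal[of l] by (simp_all only: g_def k_def)
  have gg: "g\<^sup>T * (g * Z) = Z" "g * (g\<^sup>T * Z) = Z" if "dim_row Z = k" for Z
    using g that by (simp_all add: mat_mult_assoc[symmetric])
  have ABd [simp]: "dim_row A = k" "dim_col A = k" "dim_row B = k" "dim_col B = k" by (simp_all add: A_def B_def)
  have AB: "odd_A l = g * (A * g\<^sup>T)" "odd_B l t = g * (B * g\<^sup>T)"
    unfolding odd_A_interleave odd_B_interleave g_def A_def B_def k_def by simp_all
  \<comment> \<open>the block \<open>E\<close> in interleaved coordinates\<close>
  define G where "G = g\<^sup>T * (E * g)"
  have Gd [simp]: "dim_row G = k" "dim_col G = k" by (simp_all add: G_def)
  have G_sym: "G\<^sup>T = G" using d r(2) by (simp add: G_def mat_ring)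
  note rel' = cyclic_root_square(2)[OF t, of k]
  note r' = wonenburger_relationsD[OF rel']
  have "B * G = g\<^sup>T * ((odd_B l t * E) * g)"
    unfolding AB G_def using d by (simp add: mat_mult_assoc gg)
  also have "\<dots> = g\<^sup>T * ((odd_A l * odd_A l - 1\<^sub>m k) * g)" by (simp only: r(5))
  also have "\<dots> = A * A - 1\<^sub>m k" unfolding AB by (simp add: mat_ring gg g)
  also have "\<dots> = B * shift_C k t" unfolding A_def B_def by (rule r'(5)[symmetric])
  finally have BG: "B * G = B * shift_C k t" .
  have Bi: "(B * Z) $$ (i, j) = t * Z $$ (k - 2 - i, j)" if "dim_row Z = k" "i + 2 \<le> k" "j < dim_col Z" for Z i j
    using that unfolding B_def shift_B_eq
    by (simp add: mat_smult_mult mat_mult_assoc S_mult F_mult del: index_mult_mat(1))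
  have row: "G $$ (i, j) = shift_C k t $$ (i, j)" if "i + 2 \<le> k" "j < k" for i j
  proof -
    have "(B * G) $$ (k - 2 - i, j) = (B * shift_C k t) $$ (k - 2 - i, j)" by (simp only: BG)
    moreover have "k - 2 - (k - 2 - i) = i" using that(1) by simp
    ultimately show ?thesis using that t by (auto simp: Bi simp del: index_mult_mat(1))
  qed
  have sym: "G $$ (i, j) = G $$ (j, i)" if "i < k" "j < k" for i j
  proof -
    have "G $$ (i, j) = G\<^sup>T $$ (i, j)" by (simp only: G_sym)
    thus ?thesis using that by simp
  qed
  define c where "c = G $$ (k - 1, k - 1) - shift_C k t $$ (k - 1, k - 1)"
  have Gi: "G $$ (i, j) = shift_C k t $$ (i, j) + (if i + 1 = k \<and> j + 1 = k then c else 0)" if "i < k" "j < k" for i j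
  proof -
    have "i + 2 \<le> k \<or> j + 2 \<le> k \<or> (i = k - 1 \<and> j = k - 1)" using that by arith
    then consider "i + 2 \<le> k" | "j + 2 \<le> k" | "i = k - 1" "j = k - 1" by blast
    thus ?thesis
    proof cases
      case 1 thus ?thesis using row[of i j] that by simp
    next
      case 2
      have "shift_C k t $$ (i, j) = shift_C k t $$ (j, i)" using that by (auto simp: shift_index add.commute)
      thus ?thesis using 2 row[of j i] sym[OF that] that by simp
    next
      case 3 thus ?thesis using that by (simp add: c_def)
    qed
  qed
  have "symp_conj k (wonenburger_mat A B G) (wonenburger_mat A B (shift_C k t))"
  proof (cases "l = 0")
    case True
    have "G = 0\<^sub>m 1 1" unfolding G_def l0[OF True] using True by (auto simp: k_def intro!: mat_entryI)
    moreover have "shift_C k t = 0\<^sub>m 1 1" using True by (intro mat_entryI) (auto simp: shift_index k_def)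
    ultimately have "shift_C k t = G" by simp
    moreover have "symp_conj k (wonenburger_mat A B G) (wonenburger_mat A B G)"
      by (rule symp_conj_refl) simp_all
    ultimately show ?thesis by simp
  next
    case False
    thus ?thesis unfolding A_def B_def using t by (intro shear_conj[OF _ _ _ _ Gi]) (auto simp: k_def)
  qed
  moreover have "symp_conj k (wonenburger_mat (odd_A l) (odd_B l t) E) (wonenburger_mat A B G)"
    by (rule wonenburger_conj[where g = g and h = "g\<^sup>T"])
       (use d in \<open>simp_all add: g AB mat_mult_assoc gg G_def\<close>)
  ultimately show ?thesis
    unfolding cyclic_root_square(1)[OF t] A_def B_def k_def[symmetric] by (rule symp_conj_trans[rotated])
qed

section \<open>From the spectrum to nilpotency\<close>

text \<open>The complexification of \<open>M + 1\<close> has no eigenvalue but 0, so every block of its Jordan form is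
  nilpotent.\<close>

lemma nilpotent_of_spectrum:
  assumes M: "(M :: real mat) \<in> carrier_mat n n" and sp: "spectrum (map_mat complex_of_real M) = {-1}"
  obtains N where "(M + 1\<^sub>m n) ^\<^sub>m N = 0\<^sub>m n n"
proof -
  define A where "A = map_mat complex_of_real M"
  define B where "B = A + 1\<^sub>m n"
  have A: "A \<in> carrier_mat n n" and B: "B \<in> carrier_mat n n" using M by (auto simp: A_def B_def)
  have BM: "B = map_mat complex_of_real (M + 1\<^sub>m n)" using M by (auto simp: A_def B_def intro!: eq_matI)
  obtain as where "char_poly B = (\<Prod>a\<leftarrow>as. [:- a, 1:])" using char_poly_factorized[OF B] by blast
  from jordan_nf_exists[OF B this] obtain n_as where nf: "jordan_nf B n_as" by blast
  obtain P Q where PQ: "P \<in> carrier_mat n n" "Q \<in> carrier_mat n n"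
    "char_poly B = (\<Prod>(na, a)\<leftarrow>n_as. [:- a, 1:] ^ na)" "\<And>k. B ^\<^sub>m k = P * jordan_matrix n_as ^\<^sub>m k * Q"
    using jordan_nf_powE[OF B nf] by blast
  have dim: "jordan_matrix n_as \<in> carrier_mat n n"
  proof -
    have "similar_mat B (jordan_matrix n_as)" using nf by (simp add: jordan_nf_def)
    from similar_matD[OF this] show ?thesis using B by (metis carrier_matD(1) carrier_matI insert_subset carrier_matD(2))
  qed
  have zero: "a = 0" if "(na, a) \<in> set n_as" for na a
  proof -
    have "na \<noteq> 0" using nf that by (force simp: jordan_nf_def)
    have "poly (char_poly B) a = 0"
      unfolding PQ(3) poly_prod_list prod_list_zero_iff using that \<open>na \<noteq> 0\<close> by (force simp: poly_power)
    hence "eigenvalue B a" using eigenvalue_root_char_poly[OF B] by simp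
    then obtain v where v: "v \<in> carrier_vec n" "v \<noteq> 0\<^sub>v n" "B *\<^sub>v v = a \<cdot>\<^sub>v v"
      using B by (auto simp: eigenvalue_def eigenvector_def)
    have "A *\<^sub>v v + v = a \<cdot>\<^sub>v v" using v A by (simp add: B_def add_mult_distrib_mat_vec[of _ n n])
    hence "A *\<^sub>v v = (a - 1) \<cdot>\<^sub>v v"
    proof -
      assume e: "A *\<^sub>v v + v = a \<cdot>\<^sub>v v"
      show ?thesis
      proof (rule eq_vecI)
        fix i assume "i < dim_vec ((a - 1) \<cdot>\<^sub>v v)"
        hence i: "i < n" using v by simp
        have "(A *\<^sub>v v + v) $ i = (a \<cdot>\<^sub>v v) $ i" by (simp only: e)
        thus "(A *\<^sub>v v) $ i = ((a - 1) \<cdot>\<^sub>v v) $ i" using i v A by (simp add: algebra_simps del: index_mult_mat_vec)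
      qed (use v A in auto)
    qed
    hence "eigenvalue A (a - 1)" using v A by (auto simp: eigenvalue_def eigenvector_def)
    hence "a - 1 \<in> spectrum A" by (simp add: spectrum_def)
    thus "a = 0" using sp by (simp add: A_def)
  qed
  define N where "N = sum_list (map fst n_as)"
  have diag0: "diag_block_mat Ms = 0\<^sub>m (sum_list (map dim_row Ms)) (sum_list (map dim_col Ms))"
    if "\<forall>M\<in>set Ms. M = 0\<^sub>m (dim_row M) (dim_col M)" for Ms :: "complex mat list"
    using that
  proof (induction Ms)
    case (Cons M Ms)
    then obtain a b where M0: "M = 0\<^sub>m a b" by (meson list.set_intros(1))
    have "diag_block_mat Ms = 0\<^sub>m (sum_list (map dim_row Ms)) (sum_list (map dim_col Ms))"
      using Cons by simp
    thus ?case by (simp add: M0)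
  qed simp
  have "jordan_matrix n_as ^\<^sub>m N = 0\<^sub>m n n"
  proof -
    have "jordan_matrix n_as ^\<^sub>m N = diag_block_mat (map (\<lambda>(k, a). jordan_block k a ^\<^sub>m N) n_as)"
      by (rule jordan_matrix_pow)
    also have "\<dots> = 0\<^sub>m (sum_list (map dim_row (map (\<lambda>(k, a). jordan_block k a ^\<^sub>m N) n_as)))
        (sum_list (map dim_col (map (\<lambda>(k, a). jordan_block k a ^\<^sub>m N) n_as)))" (is "_ = 0\<^sub>m ?r ?c")
    proof (rule diag0, intro ballI)
      fix K assume "K \<in> set (map (\<lambda>(k, a). jordan_block k a ^\<^sub>m N) n_as)"
      then obtain k a where ka: "(k, a) \<in> set n_as" "K = jordan_block k a ^\<^sub>m N" by auto
      have "k \<le> N" unfolding N_def using ka(1) by (intro member_le_sum_list) (force, simp)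
      have "K = 0\<^sub>m k k" unfolding ka(2) zero[OF ka(1)] jordan_block_zero_pow
        using \<open>k \<le> N\<close> by (intro eq_matI) auto
      thus "K = 0\<^sub>m (dim_row K) (dim_col K)" by simp
    qed
    finally have e: "jordan_matrix n_as ^\<^sub>m N = 0\<^sub>m ?r ?c" .
    have "dim_row (jordan_matrix n_as ^\<^sub>m N) = n" "dim_col (jordan_matrix n_as ^\<^sub>m N) = n" using dim by auto
    thus ?thesis unfolding e by simp
  qed
  hence "B ^\<^sub>m N = 0\<^sub>m n n" unfolding PQ(4) using PQ(1,2) by simp
  hence "map_mat complex_of_real ((M + 1\<^sub>m n) ^\<^sub>m N) = map_mat complex_of_real (0\<^sub>m n n)"
    unfolding BM using M by (subst of_real_hom.mat_hom_pow[of _ n]) (auto intro!: eq_matI)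
  hence "(M + 1\<^sub>m n) ^\<^sub>m N = 0\<^sub>m n n" by (rule of_real_hom.mat_hom_inj)
  thus ?thesis by (rule that)
qed

section \<open>Sums of even and of odd blocks\<close>

abbreviation even_block :: "nat \<times> real \<times> real mat \<Rightarrow> real mat" where
  "even_block b \<equiv> case b of (m, s, D) \<Rightarrow> wonenburger_mat (jordan_block m (- 1)) (s \<cdot>\<^sub>m F m) D"

abbreviation odd_block :: "nat \<times> real \<times> real mat \<Rightarrow> real mat" where
  "odd_block b \<equiv> case b of (l, t, E) \<Rightarrow> wonenburger_mat (odd_A l) (odd_B l t) E"

definition even_blocks :: "nat \<Rightarrow> real mat \<Rightarrow> bool" where
  "even_blocks n K \<longleftrightarrow> K \<in> symplectic_group n \<and>
     (\<exists>bs. (\<forall>(m, s, D) \<in> set bs. even_block_data m s D) \<and> K = diamond_list (map even_block bs))"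

definition odd_blocks :: "nat \<Rightarrow> real mat \<Rightarrow> bool" where
  "odd_blocks n K \<longleftrightarrow> K \<in> symplectic_group n \<and>
     (\<exists>bs. (\<forall>(l, t, E) \<in> set bs. odd_block_data l t E \<and> (l = 0 \<longrightarrow> E = 0\<^sub>m 1 1)) \<and>
        K = diamond_list (map odd_block bs))"

lemma zero_symplectic: "0\<^sub>m 0 0 \<in> symplectic_group 0"
  by (rule symplectic_groupI) (auto intro!: mat_entryI)

lemma even_blocks_Nil: "even_blocks 0 (0\<^sub>m 0 0)"
  unfolding even_blocks_def diamond_list_def using zero_symplectic by (auto intro!: exI[of _ "[]"])

lemma odd_blocks_Nil: "odd_blocks 0 (0\<^sub>m 0 0)"
  unfolding odd_blocks_def diamond_list_def using zero_symplectic by (auto intro!: exI[of _ "[]"])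

lemma even_block_symplectic: "even_block_data m s D \<Longrightarrow> even_block (m, s, D) \<in> symplectic_group m"
  by (auto simp: even_block_data_def intro: wonenburger_symplectic)

lemma odd_block_symplectic: "odd_block_data l t E \<Longrightarrow> odd_block (l, t, E) \<in> symplectic_group (2 * l + 1)"
  by (auto simp: odd_block_data_def intro: wonenburger_symplectic)

lemma even_blocks_Cons:
  assumes "even_block_data m s D" "even_blocks n K"
  shows "even_blocks (m + n) (even_block (m, s, D) \<diamondop> K)"
proof -
  obtain bs where bs: "\<forall>(m, s, D) \<in> set bs. even_block_data m s D" "K = diamond_list (map even_block bs)"
    using assms(2) by (auto simp: even_blocks_def)
  have "even_block (m, s, D) \<diamondop> K \<in> symplectic_group (m + n)"
    using assms by (intro symplectic_diamond even_block_symplectic) (auto simp: even_blocks_def)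
  thus ?thesis unfolding even_blocks_def
    using bs assms(1) by (intro conjI exI[of _ "(m, s, D) # bs"]) (auto simp: diamond_list_def)
qed

lemma odd_blocks_Cons:
  assumes "odd_block_data l t E" "l = 0 \<longrightarrow> E = 0\<^sub>m 1 1" "odd_blocks n K"
  shows "odd_blocks (2 * l + 1 + n) (odd_block (l, t, E) \<diamondop> K)"
proof -
  obtain bs where bs: "\<forall>(l, t, E) \<in> set bs. odd_block_data l t E \<and> (l = 0 \<longrightarrow> E = 0\<^sub>m 1 1)"
    "K = diamond_list (map odd_block bs)"
    using assms(3) by (auto simp: odd_blocks_def)
  have "odd_block (l, t, E) \<diamondop> K \<in> symplectic_group (2 * l + 1 + n)"
    using assms by (intro symplectic_diamond odd_block_symplectic) (auto simp: odd_blocks_def)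
  thus ?thesis unfolding odd_blocks_def
    using bs assms(1,2) by (intro conjI exI[of _ "(l, t, E) # bs"]) (auto simp: diamond_list_def)
qed

lemma symp_conj_diamond_exchange:
  assumes "dim_row M = 2 * m" "dim_col M = 2 * m" "dim_row N = 2 * n" "dim_col N = 2 * n"
    "dim_row K = 2 * k" "dim_col K = 2 * k"
  shows "symp_conj (m + n + k) (M \<diamondop> (N \<diamondop> K)) (N \<diamondop> (M \<diamondop> K))"
  using symp_conj_diamond[OF symp_conj_diamond_commute[OF assms(1-4)] symp_conj_refl[OF assms(5,6)]]
  unfolding diamond_assoc[OF assms] diamond_assoc[OF assms(3,4,1,2,5,6)] .

text \<open>The diamond sum is strictly associative, so only the two middle summands have to be exchanged.\<close>

lemma symp_conj_double_cons:
  assumes "dim_row M = 2 * m" "dim_col M = 2 * m" "dim_row N = 2 * n" "dim_col N = 2 * n"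
    "dim_row K = 2 * k" "dim_col K = 2 * k"
  shows "symp_conj (m + m + (n + n + k)) ((M \<diamondop> M) \<diamondop> ((N \<diamondop> N) \<diamondop> K)) (((M \<diamondop> N) \<diamondop> (M \<diamondop> N)) \<diamondop> K)"
proof -
  have dNK: "dim_row (N \<diamondop> K) = 2 * (n + k)" "dim_col (N \<diamondop> K) = 2 * (n + k)"
    and dMN: "dim_row (M \<diamondop> N) = 2 * (m + n)" "dim_col (M \<diamondop> N) = 2 * (m + n)"
    and dNNK: "dim_row (N \<diamondop> (N \<diamondop> K)) = 2 * (n + (n + k))" "dim_col (N \<diamondop> (N \<diamondop> K)) = 2 * (n + (n + k))"
    and dMNK: "dim_row (M \<diamondop> (N \<diamondop> K)) = 2 * (m + (n + k))" "dim_col (M \<diamondop> (N \<diamondop> K)) = 2 * (m + (n + k))"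
    using assms by (simp_all add: diamond_dim[of _ n _ "n + k"] diamond_dim[of _ m _ "n + k"])
  have "symp_conj (m + (m + n + (n + k))) (M \<diamondop> (M \<diamondop> (N \<diamondop> (N \<diamondop> K)))) (M \<diamondop> (N \<diamondop> (M \<diamondop> (N \<diamondop> K))))"
    by (rule symp_conj_diamond[OF symp_conj_refl[OF assms(1,2)] symp_conj_diamond_exchange[OF assms(1-4) dNK]])
  moreover have "m + (m + n + (n + k)) = m + m + (n + n + k)" by simp
  moreover have "(M \<diamondop> M) \<diamondop> ((N \<diamondop> N) \<diamondop> K) = M \<diamondop> (M \<diamondop> (N \<diamondop> (N \<diamondop> K)))"
    unfolding diamond_assoc[OF assms(3,4,3-6)] by (rule diamond_assoc[OF assms(1,2,1,2) dNNK])
  moreover have "((M \<diamondop> N) \<diamondop> (M \<diamondop> N)) \<diamondop> K = M \<diamondop> (N \<diamondop> (M \<diamondop> (N \<diamondop> K)))"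
    unfolding diamond_assoc[OF dMN dMN assms(5,6)] diamond_assoc[OF assms]
    by (rule diamond_assoc[OF assms(1-4) dMNK])
  ultimately show ?thesis by simp
qed

lemma symp_conj_nilpotent:
  assumes c: "symp_conj n M N" and z: "(M + 1\<^sub>m (2 * n)) ^\<^sub>m j = 0\<^sub>m (2 * n) (2 * n)"
  shows "(N + 1\<^sub>m (2 * n)) ^\<^sub>m j = 0\<^sub>m (2 * n) (2 * n)"
proof -
  note d = symp_conj_dim[OF c]
  obtain Q where Q: "Q \<in> symplectic_group n" "M * Q = Q * N" using c by (auto simp: symp_conj_def)
  note Qd = symplectic_groupD(1,2)[OF Q(1)]
  let ?M = "M + 1\<^sub>m (2 * n)" and ?N = "N + 1\<^sub>m (2 * n)"
  have 1: "?M * Q = Q * ?N" using d Qd Q(2) by (simp add: mat_ring)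
  have "?M ^\<^sub>m i * Q = Q * ?N ^\<^sub>m i" for i
  proof (induction i)
    case (Suc i)
    have "?M ^\<^sub>m Suc i * Q = ?M ^\<^sub>m i * (?M * Q)" using d Qd by (simp add: mat_mult_assoc)
    also have "\<dots> = ?M ^\<^sub>m i * (Q * ?N)" by (simp only: 1)
    also have "\<dots> = (?M ^\<^sub>m i * Q) * ?N" using d Qd by (simp add: mat_mult_assoc)
    also have "\<dots> = (Q * ?N ^\<^sub>m i) * ?N" by (simp only: Suc)
    also have "\<dots> = Q * ?N ^\<^sub>m Suc i" using d Qd by (simp add: mat_mult_assoc)
    finally show ?case .
  qed (use d Qd in simp)
  from this[of j] have "Q * ?N ^\<^sub>m j = 0\<^sub>m (2 * n) (2 * n)" unfolding z using Qd by simp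
  from symplectic_mult_eq_0[OF Q(1) _ _ this] show ?thesis by simp
qed

text \<open>Induction on the dimension. Each cyclic root that splits off contributes to the square one odd block
  or a doubled even block, according to the parity of its size.\<close>

lemma square_conj_blocks:
  assumes "X \<in> symplectic_group n" "(X * X + 1\<^sub>m (2 * n)) ^\<^sub>m N = 0\<^sub>m (2 * n) (2 * n)"
  shows "\<exists>p q K L. even_blocks p K \<and> odd_blocks q L \<and> n = p + p + q \<and>
    symp_conj n (X * X) ((K \<diamondop> K) \<diamondop> L)"
  using assms
proof (induction n arbitrary: X rule: less_induct)
  case (less n X)
  note X = less.prems(1) and nil = less.prems(2)
  note Xd = symplectic_groupD(1,2)[OF X]
  show ?case
  proof (cases "n = 0")
    case True
    have "(0\<^sub>m 0 0 \<diamondop> 0\<^sub>m 0 0) \<diamondop> 0\<^sub>m 0 0 = X * X"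
    proof (rule mat_entryI)
      show "dim_row ((0\<^sub>m 0 0 \<diamondop> 0\<^sub>m 0 0) \<diamondop> 0\<^sub>m 0 0) = dim_row (X * X)"
        "dim_col ((0\<^sub>m 0 0 \<diamondop> 0\<^sub>m 0 0) \<diamondop> 0\<^sub>m 0 0) = dim_col (X * X)"
        using Xd True by (simp_all add: diamond_dim[where m = 0 and n = 0])
    qed (use Xd True in simp)
    hence "symp_conj n (X * X) ((0\<^sub>m 0 0 \<diamondop> 0\<^sub>m 0 0) \<diamondop> 0\<^sub>m 0 0)"
      using Xd by (simp add: symp_conj_refl)
    thus ?thesis using even_blocks_Nil odd_blocks_Nil True by (metis add_0)
  next
    case False
    hence "1 \<le> n" by simp
    obtain s k n' X' where s: "s \<in> {-1, 1}" and k: "k \<ge> 1" and n: "n = k + n'"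
      and X': "X' \<in> symplectic_group n'" and c: "symp_conj n X (cyclic_root k s \<diamondop> X')"
      by (rule cyclic_root_splits_off[OF X nil \<open>1 \<le> n\<close>])
    note X'd = symplectic_groupD(1,2)[OF X']
    let ?C = "cyclic_root k s * cyclic_root k s"
    have c2: "symp_conj (k + n') (X * X) (?C \<diamondop> (X' * X'))"
      using symp_conj_square[OF c] X'd unfolding n by (simp add: diamond_mult[of _ k _ n'])
    have dC: "dim_row ?C = 2 * k" "dim_col ?C = 2 * k" "dim_row (X' * X') = 2 * n'" "dim_col (X' * X') = 2 * n'"
      using X'd by simp_all
    have "(X' * X' + 1\<^sub>m (2 * n')) ^\<^sub>m N = 0\<^sub>m (2 * n') (2 * n')"
    proof -
      have d1: "dim_row (?C + 1\<^sub>m (2 * k)) = 2 * k" "dim_col (?C + 1\<^sub>m (2 * k)) = 2 * k"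
        "dim_row (X' * X' + 1\<^sub>m (2 * n')) = 2 * n'" "dim_col (X' * X' + 1\<^sub>m (2 * n')) = 2 * n'" by simp_all
      have "((?C \<diamondop> (X' * X')) + 1\<^sub>m (2 * (k + n'))) ^\<^sub>m N = 0\<^sub>m (2 * (k + n')) (2 * (k + n'))"
        using symp_conj_nilpotent[OF c2] nil unfolding n by blast
      thus ?thesis unfolding diamond_add_one[OF dC] diamond_pow[OF d1]
        by (subst (asm) diamond_eq_0_iff) simp_all
    qed
    with less.IH[of n' X'] X' n k obtain p q K L where KL: "even_blocks p K" "odd_blocks q L" "n' = p + p + q"
      "symp_conj n' (X' * X') ((K \<diamondop> K) \<diamondop> L)" by auto
    have Kd: "dim_row K = 2 * p" "dim_col K = 2 * p" and Ld: "dim_row L = 2 * q" "dim_col L = 2 * q"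
      using KL symplectic_groupD(1,2) by (auto simp: even_blocks_def odd_blocks_def)
    have dKK: "dim_row (K \<diamondop> K) = 2 * (p + p)" "dim_col (K \<diamondop> K) = 2 * (p + p)"
      using Kd by (intro diamond_dim; simp)+
    show ?thesis
    proof (cases "even k")
      case True
      then obtain m where m: "k = m + m" by (metis evenE mult_2)
      obtain s' D where D: "even_block_data m s' D"
        and cb: "symp_conj (m + m) (even_block (m, s', D) \<diamondop> even_block (m, s', D)) ?C"
        using double_even_block_conj_cyclic_root_square[of m s] s k m by auto
      let ?E = "even_block (m, s', D)"
      have dE: "dim_row ?E = 2 * m" "dim_col ?E = 2 * m"
        using symplectic_groupD(1,2)[OF even_block_symplectic[OF D]] by simp_all
      have "symp_conj (m + m + n') (?C \<diamondop> (X' * X')) ((?E \<diamondop> ?E) \<diamondop> ((K \<diamondop> K) \<diamondop> L))"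
        by (rule symp_conj_diamond[OF symp_conj_sym[OF cb] KL(4)])
      from symp_conj_trans[OF this symp_conj_double_cons[OF dE Kd Ld, folded KL(3)]]
      have "symp_conj n (X * X) (((?E \<diamondop> K) \<diamondop> (?E \<diamondop> K)) \<diamondop> L)"
        using symp_conj_trans[OF c2] unfolding n m by blast
      moreover have "n = (m + p) + (m + p) + q" using n m KL(3) by simp
      ultimately show ?thesis
        by (intro exI[of _ "m + p"] exI[of _ q] exI[of _ "?E \<diamondop> K"] exI[of _ L] conjI even_blocks_Cons[OF D KL(1)] KL(2))
    next
      case False
      then obtain l where l: "k = 2 * l + 1" by (auto elim: oddE)
      obtain E where E: "odd_block_data l s E" "l = 0 \<longrightarrow> E = 0\<^sub>m 1 1" using odd_block_exists[OF s] by blast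
      let ?O = "odd_block (l, s, E)"
      have co: "symp_conj k ?O ?C" using odd_block_conj_cyclic_root_square[OF E(1)] E(2) unfolding l by simp
      note dO = symp_conj_dim(1,2)[OF co]
      have "symp_conj (k + n') (?C \<diamondop> (X' * X')) (?O \<diamondop> ((K \<diamondop> K) \<diamondop> L))"
        by (rule symp_conj_diamond[OF symp_conj_sym[OF co] KL(4)])
      moreover have "symp_conj (k + n') (?O \<diamondop> ((K \<diamondop> K) \<diamondop> L)) ((K \<diamondop> K) \<diamondop> (?O \<diamondop> L))"
        using symp_conj_diamond_exchange[OF dO dKK Ld] by (simp only: KL(3) add.assoc)
      ultimately have "symp_conj n (X * X) ((K \<diamondop> K) \<diamondop> (?O \<diamondop> L))"
        using symp_conj_trans[OF c2 symp_conj_trans] unfolding n by blast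
      moreover have "n = p + p + (2 * l + 1 + q)" using n l KL(3) by simp
      ultimately show ?thesis
        by (intro exI[of _ p] exI[of _ "2 * l + 1 + q"] exI[of _ K] exI[of _ "?O \<diamondop> L"] conjI KL(1) odd_blocks_Cons[OF E KL(2)])
    qed
  qed
qed

section \<open>Blocks with symplectic roots\<close>

definition has_root :: "nat \<Rightarrow> real mat \<Rightarrow> bool" where
  "has_root n M \<longleftrightarrow> (\<exists>X \<in> symplectic_group n. X * X = M)"

lemma has_root_diamond:
  assumes "has_root m M" "has_root n N"
  shows "has_root (m + n) (M \<diamondop> N)"
proof -
  obtain X Y where X: "X \<in> symplectic_group m" "X * X = M" and Y: "Y \<in> symplectic_group n" "Y * Y = N"
    using assms by (auto simp: has_root_def)
  have "(X \<diamondop> Y) * (X \<diamondop> Y) = M \<diamondop> N"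
    using symplectic_groupD(1,2)[OF X(1)] symplectic_groupD(1,2)[OF Y(1)] X(2) Y(2)
    by (simp add: diamond_mult[of _ m _ n])
  thus ?thesis using symplectic_diamond[OF X(1) Y(1)] by (auto simp: has_root_def)
qed

lemma has_root_symp_conj:
  assumes c: "symp_conj n M N" and "has_root n N"
  shows "has_root n M"
proof -
  note d = symp_conj_dim[OF c]
  obtain Q where Q: "Q \<in> symplectic_group n" "M * Q = Q * N" using c by (auto simp: symp_conj_def)
  obtain X where X: "X \<in> symplectic_group n" "X * X = N" using assms(2) by (auto simp: has_root_def)
  note Qd = symplectic_groupD(1,2)[OF Q(1)] and Xd = symplectic_groupD(1,2)[OF X(1)]
  let ?Y = "Q * (X * symp_inv n Q)"
  have "?Y * ?Y = Q * (X * (symp_inv n Q * (Q * (X * symp_inv n Q))))"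
    using Qd Xd by (simp add: mat_mult_assoc)
  also have "\<dots> = Q * (X * (X * symp_inv n Q))"
    using Qd Xd by (simp add: symp_inv_left_mult[OF Q(1)])
  also have "\<dots> = Q * ((X * X) * symp_inv n Q)" using Qd Xd by (simp add: mat_mult_assoc)
  also have "\<dots> = (Q * N) * symp_inv n Q" unfolding X(2) using Qd d by (simp add: mat_mult_assoc)
  also have "\<dots> = M * (Q * symp_inv n Q)" unfolding Q(2)[symmetric] using Qd d by (simp add: mat_mult_assoc)
  also have "\<dots> = M" using d by (simp add: symp_inv_right[OF Q(1)])
  finally have "?Y * ?Y = M" .
  moreover have "?Y \<in> symplectic_group n"
    by (intro symplectic_mult Q(1) X(1) symplectic_symp_inv)
  ultimately show ?thesis by (auto simp: has_root_def)
qed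

lemma odd_block_has_root:
  assumes "odd_block_data l t E" "l = 0 \<longrightarrow> E = 0\<^sub>m 1 1"
  shows "has_root (2 * l + 1) (odd_block (l, t, E))"
proof -
  have t: "t \<in> {-1, 1}" using assms(1) by (simp add: odd_block_data_def)
  have "has_root (2 * l + 1) (cyclic_root (2 * l + 1) t * cyclic_root (2 * l + 1) t)"
    using cyclic_root_symplectic[OF t] by (auto simp: has_root_def)
  thus ?thesis using has_root_symp_conj[OF odd_block_conj_cyclic_root_square[OF assms(1)]] assms(2) by simp
qed

lemma diamond_list_symplectic:
  assumes "\<forall>M \<in> set Ms. \<exists>k. M \<in> symplectic_group k"
  shows "\<exists>k. diamond_list Ms \<in> symplectic_group k"
  using assms
proof (induction Ms)
  case (Cons M Ms)
  then obtain j k where "M \<in> symplectic_group j" "diamond_list Ms \<in> symplectic_group k" by auto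
  from symplectic_diamond[OF this] show ?case by (auto simp: diamond_list_def)
qed (use zero_symplectic in \<open>auto simp: diamond_list_def\<close>)

lemma diamond_list_has_root:
  assumes "\<forall>M \<in> set Ms. \<exists>k. has_root k M"
  shows "\<exists>k. has_root k (diamond_list Ms)"
  using assms
proof (induction Ms)
  case Nil
  have "0\<^sub>m 0 0 * 0\<^sub>m 0 0 = (0\<^sub>m 0 0 :: real mat)" by simp
  hence "has_root 0 (0\<^sub>m 0 0)" using zero_symplectic unfolding has_root_def by blast
  thus ?case by (auto simp: diamond_list_def)
next
  case (Cons M Ms)
  then obtain j k where "has_root j M" "has_root k (diamond_list Ms)" by auto
  from has_root_diamond[OF this] show ?case by (auto simp: diamond_list_def)
qed

lemma diamond_zero:
  assumes "dim_row M = 2 * m" "dim_col M = 2 * m"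
  shows "M \<diamondop> 0\<^sub>m 0 0 = M"
proof -
  obtain A B C D where M: "M = four_block_mat A B C D" and
    c: "A \<in> carrier_mat m m" "B \<in> carrier_mat m m" "C \<in> carrier_mat m m" "D \<in> carrier_mat m m"
    using quadrants[OF assms] by metis
  have z: "(0\<^sub>m 0 0 :: real mat) = four_block_mat (0\<^sub>m 0 0) (0\<^sub>m 0 0) (0\<^sub>m 0 0) (0\<^sub>m 0 0)" by simp
  have e: "four_block_mat Z (0\<^sub>m m 0) (0\<^sub>m 0 m) (0\<^sub>m 0 0) = Z" if "Z \<in> carrier_mat m m" for Z :: "real mat"
    using that by (auto intro!: mat_entryI)
  have "four_block_mat A B C D \<diamondop> four_block_mat (0\<^sub>m 0 0) (0\<^sub>m 0 0) (0\<^sub>m 0 0) (0\<^sub>m 0 0) = four_block_mat A B C D"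
    by (subst diamond_four_block[OF c, of _ 0]) (simp_all add: e c)
  thus ?thesis unfolding M by simp
qed

lemma diamond_power_two:
  assumes "dim_row M = 2 * m" "dim_col M = 2 * m"
  shows "diamond_power M 2 = M \<diamondop> M"
  using diamond_zero[OF assms] by (simp add: diamond_power_def diamond_list_def numeral_2_eq_2)

section \<open>The characterisation\<close>

theorem theoremC:
  fixes n :: nat and A B C M :: "real mat"
  assumes "M \<in> symplectic_group n"
    and "M = wonenburger_mat A B C"
    and "wonenburger_relations n A B C"
    and "spectrum (map_mat complex_of_real M) = {-1}"
  shows "(\<exists>X \<in> symplectic_group n. X ^\<^sub>m 2 = M) \<longleftrightarrow>
    (\<exists>P \<in> symplectic_group n. \<exists>P'. inverts_mat P P' \<and> inverts_mat P' P \<and>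
      (\<exists>(p :: nat) (q :: nat) (m :: nat \<Rightarrow> nat) (s :: nat \<Rightarrow> real) (D :: nat \<Rightarrow> real mat)
         (l :: nat \<Rightarrow> nat) (t :: nat \<Rightarrow> real) (E :: nat \<Rightarrow> real mat).
        (\<forall>i < p. even_block_data (m i) (s i) (D i)) \<and>
        (\<forall>j < q. odd_block_data (l j) (t j) (E j) \<and> (l j = 0 \<longrightarrow> E j = 0\<^sub>m 1 1)) \<and>
        P * M * P' =
          diamond_power
            (diamond_list
              (map (\<lambda>i. wonenburger_mat (jordan_block (m i) (- 1)) (s i \<cdot>\<^sub>m anti_diag_mat (m i)) (D i))
                [0..<p])) 2
          \<diamondop>
          diamond_list
            (map (\<lambda>j. wonenburger_mat (odd_A (l j)) (odd_B (l j) (t j)) (E j)) [0..<q])))"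
    (is "?root \<longleftrightarrow> ?blocks")
proof
  note Md = symplectic_groupD(1,2)[OF assms(1)]
  assume ?root
  then obtain X where X: "X \<in> symplectic_group n" "X * X = M"
    by (auto simp: numeral_2_eq_2 dest: symplectic_groupD(1))
  obtain N where "(X * X + 1\<^sub>m (2 * n)) ^\<^sub>m N = 0\<^sub>m (2 * n) (2 * n)"
    unfolding X(2) using nilpotent_of_spectrum[OF symplectic_groupD(3)[OF assms(1)] assms(4)] by blast
  from square_conj_blocks[OF X(1) this] obtain p q K L where
    KL: "even_blocks p K" "odd_blocks q L" "symp_conj n M ((K \<diamondop> K) \<diamondop> L)" unfolding X(2) by blast
  obtain bs where bs: "\<forall>(m, s, D) \<in> set bs. even_block_data m s D" "K = diamond_list (map even_block bs)"
    using KL(1) by (auto simp: even_blocks_def)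
  obtain cs where cs: "\<forall>(l, t, E) \<in> set cs. odd_block_data l t E \<and> (l = 0 \<longrightarrow> E = 0\<^sub>m 1 1)" "L = diamond_list (map odd_block cs)"
    using KL(2) by (auto simp: odd_blocks_def)
  have Kd: "dim_row K = 2 * p" "dim_col K = 2 * p" using KL(1) symplectic_groupD(1,2) by (auto simp: even_blocks_def)
  obtain Q where Q: "Q \<in> symplectic_group n" "M * Q = Q * ((K \<diamondop> K) \<diamondop> L)" using KL(3) by (auto simp: symp_conj_def)
  note Qd = symplectic_groupD(1,2)[OF Q(1)] and d = symp_conj_dim[OF KL(3)]
  have "symp_inv n Q * M * Q = symp_inv n Q * (M * Q)" using Md Qd by (simp add: mat_mult_assoc)
  also have "\<dots> = (K \<diamondop> K) \<diamondop> L" unfolding Q(2) by (rule symp_inv_left_mult(1)[OF Q(1) d(3)])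
  finally have e: "symp_inv n Q * M * Q = diamond_power K 2 \<diamondop> L" unfolding diamond_power_two[OF Kd] .
  have mapK: "map even_block bs = map (\<lambda>i. wonenburger_mat (jordan_block (fst (bs ! i)) (- 1))
      (fst (snd (bs ! i)) \<cdot>\<^sub>m F (fst (bs ! i))) (snd (snd (bs ! i)))) [0..<length bs]"
    by (rule nth_equalityI) (simp_all add: case_prod_unfold)
  have mapL: "map odd_block cs = map (\<lambda>i. wonenburger_mat (odd_A (fst (cs ! i)))
      (odd_B (fst (cs ! i)) (fst (snd (cs ! i)))) (snd (snd (cs ! i)))) [0..<length cs]"
    by (rule nth_equalityI) (simp_all add: case_prod_unfold)
  have inv: "inverts_mat (symp_inv n Q) Q" "inverts_mat Q (symp_inv n Q)"
    using Qd by (simp_all add: inverts_mat_def symp_inv_left[OF Q(1)] symp_inv_right[OF Q(1)])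
  show ?blocks
  proof (rule bexI[of _ "symp_inv n Q"], rule exI[of _ Q], intro conjI inv,
      rule exI[of _ "length bs"], rule exI[of _ "length cs"],
      rule exI[of _ "\<lambda>i. fst (bs ! i)"], rule exI[of _ "\<lambda>i. fst (snd (bs ! i))"], rule exI[of _ "\<lambda>i. snd (snd (bs ! i))"],
      rule exI[of _ "\<lambda>i. fst (cs ! i)"], rule exI[of _ "\<lambda>i. fst (snd (cs ! i))"], rule exI[of _ "\<lambda>i. snd (snd (cs ! i))"],
      intro conjI)
    show "\<forall>i<length bs. even_block_data (fst (bs ! i)) (fst (snd (bs ! i))) (snd (snd (bs ! i)))"
      using bs(1) nth_mem[of _ bs] unfolding case_prod_unfold by blast
    show "\<forall>j<length cs. odd_block_data (fst (cs ! j)) (fst (snd (cs ! j))) (snd (snd (cs ! j))) \<and>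
       (fst (cs ! j) = 0 \<longrightarrow> snd (snd (cs ! j)) = 0\<^sub>m 1 1)"
      using cs(1) nth_mem[of _ cs] unfolding case_prod_unfold by blast
    show "symp_inv n Q \<in> symplectic_group n" by (rule symplectic_symp_inv[OF Q(1)])
  qed (rule e[unfolded bs(2) cs(2) mapK mapL])
next
  note Md = symplectic_groupD(1,2)[OF assms(1)]
  assume ?blocks
  then obtain P P' p q m s D l t E where P: "P \<in> symplectic_group n" "inverts_mat P P'" "inverts_mat P' P"
    and ev: "\<forall>i < p. even_block_data (m i) (s i) (D i)"
    and od: "\<forall>j < q. odd_block_data (l j) (t j) (E j) \<and> (l j = 0 \<longrightarrow> E j = 0\<^sub>m 1 1)"
    and e: "P * M * P' = diamond_power (diamond_list (map (\<lambda>i. wonenburger_mat (jordan_block (m i) (- 1))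
          (s i \<cdot>\<^sub>m F (m i)) (D i)) [0..<p])) 2
        \<diamondop> diamond_list (map (\<lambda>j. wonenburger_mat (odd_A (l j)) (odd_B (l j) (t j)) (E j)) [0..<q])"
    by (elim bexE exE conjE) (rule that)
  define K where "K = diamond_list (map (\<lambda>i. wonenburger_mat (jordan_block (m i) (- 1)) (s i \<cdot>\<^sub>m F (m i)) (D i)) [0..<p])"
  define L where "L = diamond_list (map (\<lambda>j. wonenburger_mat (odd_A (l j)) (odd_B (l j) (t j)) (E j)) [0..<q])"
  have "\<exists>a. K \<in> symplectic_group a"
    unfolding K_def
  proof (intro diamond_list_symplectic ballI)
    fix M assume "M \<in> set (map (\<lambda>i. wonenburger_mat (jordan_block (m i) (- 1)) (s i \<cdot>\<^sub>m F (m i)) (D i)) [0..<p])"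
    then obtain i where "i < p" "M = even_block (m i, s i, D i)" by auto
    thus "\<exists>k. M \<in> symplectic_group k" using even_block_symplectic[of "m i" "s i" "D i"] ev by blast
  qed
  then obtain a where K: "K \<in> symplectic_group a" by blast
  have "\<exists>b. has_root b L"
    unfolding L_def
  proof (intro diamond_list_has_root ballI)
    fix M assume "M \<in> set (map (\<lambda>j. wonenburger_mat (odd_A (l j)) (odd_B (l j) (t j)) (E j)) [0..<q])"
    then obtain j where "j < q" "M = odd_block (l j, t j, E j)" by auto
    thus "\<exists>k. has_root k M" using odd_block_has_root[of "l j" "t j" "E j"] od by blast
  qed
  then obtain b where L: "has_root b L" by blast
  have "has_root (a + a) (K \<diamondop> K)" using symplectic_root_of_double[OF K] unfolding has_root_def by blast
  hence "has_root (a + a + b) (diamond_power K 2 \<diamondop> L)"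
    unfolding diamond_power_two[OF symplectic_groupD(1,2)[OF K]] using L by (rule has_root_diamond)
  hence T: "has_root (a + a + b) (P * M * P')" unfolding e K_def L_def .
  note Pd = symplectic_groupD(1,2)[OF P(1)]
  have PP: "P * P' = 1\<^sub>m (2 * n)" using P(2) Pd by (simp add: inverts_mat_def)
  have P'P: "P' * P = 1\<^sub>m (dim_row P')" using P(3) by (simp add: inverts_mat_def)
  \<comment> \<open>the dimensions of \<open>P'\<close> are not assumed; the two inverse equations determine them\<close>
  have "dim_row P' = 2 * n" using arg_cong[OF P'P, of dim_col] Pd by simp
  moreover have "dim_col P' = 2 * n" using arg_cong[OF PP, of dim_col] by simp
  ultimately have P'd: "dim_row P' = 2 * n" "dim_col P' = 2 * n" .
  have "symp_inv n P * (P * P') = symp_inv n P * 1\<^sub>m (2 * n)" by (simp only: PP)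
  hence P': "P' = symp_inv n P" using P'd by (simp add: symp_inv_left_mult[OF P(1)])
  obtain Y where Y: "Y \<in> symplectic_group (a + a + b)" "Y * Y = P * M * P'" using T by (auto simp: has_root_def)
  have "dim_row (Y * Y) = dim_row (P * M * P')" by (simp only: Y(2))
  hence n: "a + a + b = n" using symplectic_groupD(1)[OF Y(1)] Pd by simp
  have "symp_conj n M (P * M * P')"
  proof (rule symp_conjI[of _ _ _ "symp_inv n P"])
    have "symp_inv n P * (P * M * P') = symp_inv n P * (P * (M * P'))"
      using Pd Md P'd by (simp add: mat_mult_assoc)
    also have "\<dots> = M * symp_inv n P" using Md by (simp add: P' symp_inv_left_mult[OF P(1)])
    finally show "M * symp_inv n P = symp_inv n P * (P * M * P')" by simp
  qed (use Md Pd P'd symplectic_symp_inv[OF P(1)] in simp_all)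
  from has_root_symp_conj[OF this] T have "has_root n M" unfolding n by blast
  thus ?root by (auto simp: has_root_def numeral_2_eq_2 dest: symplectic_groupD(1))
qed

end
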